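(* Let $P(x)=x(x+1)$. Then the limiting pair correlation function of the sequence $(\mathcal{F}_{Q,P})_Q$ exists, i.e. for every $\Lambda>0$, $\lim_{Q\to\infty}\mathcal{S}_{\mathcal{F}_{Q,P}}(\Lambda)=\int_0^\Lambda\mathfrak{g}_2(\lambda)\,d\lambda$, where \[\mathfrak{g}_2(\lambda)=\frac{1}{\zeta(2)\lambda^2}\sum_{d_2,d_4=1}^{\infty}\frac{\mu(d_2)\mu(d_4)}{d_2d_4\phi(d_2)\phi(d_4)}\sum_{1\leq m<\frac{2\lambda}{\beta_P}}\mathfrak{h}(m)\log\left(\frac{2\lambda}{m\beta_P}\right),\] with \[\mathfrak{h}(m)=\sum_{\substack{n,\delta, d_1,d_3\geq 1\\ n\delta d_1d_3=m\\ \gcd\left(\frac{d_2}{dG_1},\frac{d_4}{DG_2}\right)=1}}n\mu(d_1)\mu(d_3)\,dDG_1G_2\prod_{p\mid\frac{d_2d_4}{dDG_1G_2}}\left(1+\frac{1}{p}\right)^{-1},\] where $d=\gcd(d_1,d_2)$, $D=\gcd(d_3,d_4)$, $G_1=\gcd(\delta,d_2/d)$, $G_2=\gcd(\delta,d_4/D)$ (so $\mathfrak h$ also depends on $d_2,d_4$).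
   Context: $f_P(m)=\#\{1\le a\le m: P(a)\equiv0\pmod m\}$, $\beta_P=\prod_p(1-f_P(p)/p^2)$. $\mathcal{F}_{Q,P}=\{a/q: 1\leq a\leq q\leq Q,\ \gcd(P(a),q)=1\}$, $\mathcal{N}_{Q,P}=\#\mathcal{F}_{Q,P}$, and $\mathcal{S}_{\mathcal{F}_{Q,P}}(\Lambda)=\frac{1}{\mathcal{N}_{Q,P}}\#\{(\gamma_1,\gamma_2)\in\mathcal{F}_{Q,P}^2:\gamma_1\ne\gamma_2,\ \gamma_1-\gamma_2\in\frac{1}{\mathcal{N}_{Q,P}}(0,\Lambda)+\mathbb{Z}\}$. $\mu$ is the Möbius function, $\phi$ Euler's totient, $\zeta$ the Riemann zeta function. *)

theory Defs
  imports
    "HOL-Analysis.Analysis"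
    "HOL-Number_Theory.Number_Theory"
    "HOL-Computational_Algebra.Computational_Algebra"
begin

definition moebius :: "nat \<Rightarrow> int" where
  "moebius n = (if squarefree n then (-1) ^ card (prime_factors n) else 0)"

text \<open>Dirichlet series of the Riemann zeta function, meaningful for real \<open>s > 1\<close>.\<close>

definition zeta :: "real \<Rightarrow> real" where
  "zeta s = (\<Sum>n. 1 / real (Suc n) powr s)"

definition root_count :: "int poly \<Rightarrow> nat \<Rightarrow> nat" where
  "root_count P m = card {a::nat. 1 \<le> a \<and> a \<le> m \<and> [poly P (int a) = 0] (mod int m)}"

definition beta :: "int poly \<Rightarrow> real" where
  "beta P = (\<Prod>p. if prime p then 1 - real (root_count P p) / (real p)\<^sup>2 else 1)"

definition poly_farey :: "int poly \<Rightarrow> nat \<Rightarrow> real set" where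
  "poly_farey P Q =
     {real a / real q | a q::nat. 1 \<le> a \<and> a \<le> q \<and> q \<le> Q \<and> gcd (poly P (int a)) (int q) = 1}"

definition pair_correlation :: "real set \<Rightarrow> real \<Rightarrow> real" where
  "pair_correlation F \<Lambda> =
     1 / real (card F) *
     real (card {(\<gamma>1, \<gamma>2). \<gamma>1 \<in> F \<and> \<gamma>2 \<in> F \<and> \<gamma>1 \<noteq> \<gamma>2 \<and>
       (\<exists>x\<in>{0<..<\<Lambda>}. \<exists>k::int. \<gamma>1 - \<gamma>2 = 1 / real (card F) * x + of_int k)})"

text \<open>All uses of \<open>div\<close> below are exact divisions.\<close>

definition h_fun :: "nat \<Rightarrow> nat \<Rightarrow> nat \<Rightarrow> real" where
  "h_fun d2 d4 m =
     (\<Sum>(n, \<delta>, d1, d3) \<in> {(n, \<delta>, d1, d3).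
          n \<ge> 1 \<and> \<delta> \<ge> 1 \<and> d1 \<ge> 1 \<and> d3 \<ge> 1 \<and> n * \<delta> * d1 * d3 = m \<and>
          (let d = gcd d1 d2; D = gcd d3 d4;
               G1 = gcd \<delta> (d2 div d); G2 = gcd \<delta> (d4 div D)
           in gcd (d2 div (d * G1)) (d4 div (D * G2)) = 1)}.
        let d = gcd d1 d2; D = gcd d3 d4;
            G1 = gcd \<delta> (d2 div d); G2 = gcd \<delta> (d4 div D)
        in real n * of_int (moebius d1) * of_int (moebius d3) * real (d * D * G1 * G2) *
           (\<Prod>p \<in> prime_factors ((d2 * d4) div (d * D * G1 * G2)). inverse (1 + 1 / real p)))"

definition g2_term :: "int poly \<Rightarrow> real \<Rightarrow> nat \<Rightarrow> nat \<Rightarrow> real" where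
  "g2_term P t d2 d4 =
     of_int (moebius d2) * of_int (moebius d4) /
       (real d2 * real d4 * real (totient d2) * real (totient d4)) *
     (\<Sum>m | 1 \<le> m \<and> real m < 2 * t / beta P. h_fun d2 d4 m * ln (2 * t / (real m * beta P)))"

definition g2 :: "int poly \<Rightarrow> real \<Rightarrow> real" where
  "g2 P t = 1 / (zeta 2 * t\<^sup>2) * (\<Sum>\<^sub>\<infinity>(d2, d4) \<in> {1..} \<times> {1..}. g2_term P t d2 d4)"

end

theory Submission
  imports Defs
begin

text \<open>
  Two fractions \<open>a/q\<close>, \<open>b/y\<close> of the sequence at distance less than \<open>\<Lambda>/N\<close> modulo 1 have a
  determinant \<open>r = a y - b q\<close> that is positive and bounded independently of \<open>Q\<close>. Completing \<open>(b, y)\<close> to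
  a matrix of \<open>SL\<^sub>2(\<int>)\<close> with first row \<open>(c, x)\<close> gives \<open>(a, q) = r (c, x) + k (b, y)\<close> with a unique
  \<open>k\<close> modulo \<open>r\<close>, prime to \<open>r\<close>, and all coprimality conditions become
  \<open>gcd(x, y) = gcd(x - 1, y) = gcd(x - k, y + r) = 1\<close>. So the pairs are lattice points \<open>(x, y)\<close> in a
  region bounded by a hyperbola that are visible from three given points, and a sieve gives their
  density as a product of local factors \<open>1 - 3/p\<^sup>2\<close> (\<open>1 - 2/p\<^sup>2\<close> if \<open>p\<close> divides \<open>r\<close> and \<open>k - 1\<close>). The
  same sieve gives \<open>N \<sim> \<beta> Q\<^sup>2 / 2\<close>. Summing over \<open>k\<close> and comparing Euler factors identifies the
  density with the double series over \<open>d2\<close>, \<open>d4\<close>, and the area above the hyperbola is the integral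
  of the logarithmic kernel of \<open>g2\<close>.
\<close>

section \<open>Equidistribution of lattice points in residue classes\<close>

definition residue_class :: "int \<Rightarrow> int \<Rightarrow> int set" where
  "residue_class m a = {x. [x = a] (mod m)}"

lemma residue_class_1 [simp]: "residue_class 1 a = UNIV"
  by (simp add: residue_class_def)

lemma residue_class_Int_coprime:
  assumes "coprime m n"
  shows "\<exists>c. residue_class m a \<inter> residue_class n b = residue_class (m * n) c"
proof -
  obtain c where c: "[c = a] (mod m)" "[c = b] (mod n)"
    using binary_chinese_remainder_int[OF assms] by blast
  have "[x = a] (mod m) \<and> [x = b] (mod n) \<longleftrightarrow> [x = c] (mod m * n)" for x
  proof
    assume "[x = a] (mod m) \<and> [x = b] (mod n)"
    then have "[x = c] (mod m)" "[x = c] (mod n)"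
      using c by (auto intro: cong_trans cong_sym)
    then show "[x = c] (mod m * n)" using assms by (rule coprime_cong_mult)
  next
    assume "[x = c] (mod m * n)"
    then have "[x = c] (mod m)" "[x = c] (mod n)"
      using cong_dvd_modulus[of x c "m * n"] by auto
    then show "[x = a] (mod m) \<and> [x = b] (mod n)" using c by (auto intro: cong_trans)
  qed
  then show ?thesis by (auto simp: residue_class_def)
qed

lemma residue_class_fibre:
  assumes "coprime m n" "j \<in> {0..<n}"
  shows "\<exists>c. {k \<in> A \<inter> residue_class m a. k mod n = j} = A \<inter> residue_class (m * n) c"
proof -
  obtain c where c: "residue_class m a \<inter> residue_class n j = residue_class (m * n) c"
    using residue_class_Int_coprime[OF assms(1)] by blast
  have "k \<in> residue_class n j \<longleftrightarrow> k mod n = j" for k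
    using assms(2) by (simp add: residue_class_def cong_def)
  then have "{k \<in> A \<inter> residue_class m a. k mod n = j} = A \<inter> (residue_class m a \<inter> residue_class n j)"
    by auto
  then show ?thesis unfolding c by blast
qed

lemma residue_class_interval_eq_image:
  fixes L U :: real
  assumes "m > 0"
  shows "{x. L < of_int x \<and> of_int x \<le> U} \<inter> residue_class m a
    = (\<lambda>j. a + m * j) ` {\<lfloor>(L - a) / m\<rfloor><..\<lfloor>(U - a) / m\<rfloor>}"
proof -
  have lower: "L < a + m * j \<longleftrightarrow> \<lfloor>(L - a) / m\<rfloor> < j" and upper: "a + m * j \<le> U \<longleftrightarrow> j \<le> \<lfloor>(U - a) / m\<rfloor>" for j
    using assms by (simp_all add: floor_less_iff le_floor_iff field_simps)
  have "x \<in> residue_class m a \<longleftrightarrow> (\<exists>j. x = a + m * j)" for x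
    unfolding residue_class_def mem_Collect_eq by (metis cong_iff_lin cong_sym)
  then show ?thesis
    using lower upper by (auto intro!: imageI)
qed

lemma finite_residue_class_interval:
  fixes L U :: real
  shows "m > 0 \<Longrightarrow> finite ({x. L < of_int x \<and> of_int x \<le> U} \<inter> residue_class m a)"
  by (simp only: residue_class_interval_eq_image finite_imageI finite_greaterThanAtMost_int)

lemma card_residue_class_interval:
  fixes L U :: real
  assumes "m > 0"
  shows "card ({x. L < of_int x \<and> of_int x \<le> U} \<inter> residue_class m a)
      = nat (\<lfloor>(U - a) / m\<rfloor> - \<lfloor>(L - a) / m\<rfloor>)"
proof -
  have "inj (\<lambda>j. a + m * j)" using assms by (auto simp: inj_on_def)
  then show ?thesis
    by (simp only: residue_class_interval_eq_image[OF assms] card_image inj_on_subset[OF _ subset_UNIV]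
        card_greaterThanAtMost_int)
qed

lemma card_residue_class_interval_approx:
  fixes L U :: real
  assumes "m > 0"
  shows "\<bar>real (card ({x. L < of_int x \<and> of_int x \<le> U} \<inter> residue_class m a)) - max 0 (U - L) / m\<bar> \<le> 1"
proof -
  have m: "real_of_int m > 0" using assms by simp
  have "(U - a) / m - (L - a) / m = (U - L) / m" by (simp add: diff_divide_distrib)
  then have approx: "\<bar>real_of_int (\<lfloor>(U - a) / m\<rfloor> - \<lfloor>(L - a) / m\<rfloor>) - (U - L) / m\<bar> \<le> 1" by linarith
  show ?thesis
  proof (cases "L \<le> U")
    case True
    then have "\<lfloor>(L - a) / m\<rfloor> \<le> \<lfloor>(U - a) / m\<rfloor>"
      using m by (intro floor_mono divide_right_mono) auto
    then show ?thesis using approx True by (simp add: card_residue_class_interval[OF assms] max_def)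
  next
    case False
    then have "\<lfloor>(U - a) / m\<rfloor> \<le> \<lfloor>(L - a) / m\<rfloor>"
      using m by (intro floor_mono divide_right_mono) auto
    then show ?thesis using False by (simp add: card_residue_class_interval[OF assms] max_def)
  qed
qed

lemma card_residue_class_period:
  fixes m r a :: int
  assumes "m > 0" "m dvd r" "r \<ge> 0"
  shows "card ({0..<r} \<inter> residue_class m a) = nat (r div m)"
proof -
  obtain s where s: "r = m * s" using assms(2) by blast
  have "{0..<r} = {x. real_of_int (- 1) < of_int x \<and> of_int x \<le> real_of_int (r - 1)}"
    by (auto simp del: of_int_minus of_int_diff)
  then have "card ({0..<r} \<inter> residue_class m a)
      = nat (\<lfloor>(real_of_int (r - 1) - a) / m\<rfloor> - \<lfloor>(real_of_int (- 1) - a) / m\<rfloor>)"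
    by (simp only: card_residue_class_interval[OF assms(1)])
  also have "(real_of_int (r - 1) - a) / m = (real_of_int (- 1) - a) / m + of_int s"
    using assms(1) by (simp add: s field_simps)
  finally show ?thesis using assms(1) by (simp add: s)
qed

lemma sum_eq_sum_increments_card:
  fixes f :: "int \<Rightarrow> 'a::comm_ring_1"
  assumes "f 0 = 0" "Y \<subseteq> {1..n}"
  shows "(\<Sum>y\<in>Y. f y) = (\<Sum>j\<in>{1..n}. (f j - f (j - 1)) * of_nat (card (Y \<inter> {j..})))"
proof -
  have telescope: "(\<Sum>j\<in>{1..int k}. f j - f (j - 1)) = f (int k)" for k
  proof (induction k)
    case (Suc k)
    have "{1..int (Suc k)} = insert (int (Suc k)) {1..int k}" by auto
    then show ?case using Suc by simp
  qed (simp add: assms(1))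
  have "(\<Sum>y\<in>Y. f y) = (\<Sum>y\<in>Y. \<Sum>j\<in>{j\<in>{1..n}. j \<le> y}. f j - f (j - 1))"
  proof (intro sum.cong refl)
    fix y assume "y \<in> Y"
    then have "{j\<in>{1..n}. j \<le> y} = {1..int (nat y)}" "int (nat y) = y" using assms(2) by auto
    then show "f y = (\<Sum>j\<in>{j\<in>{1..n}. j \<le> y}. f j - f (j - 1))" using telescope[of "nat y"] by simp
  qed
  also have "\<dots> = (\<Sum>j\<in>{1..n}. \<Sum>y\<in>{y\<in>Y. j \<le> y}. f j - f (j - 1))"
    using assms(2) by (intro sum.swap_restrict) (auto intro: finite_subset)
  also have "\<dots> = (\<Sum>j\<in>{1..n}. (f j - f (j - 1)) * of_nat (card (Y \<inter> {j..})))"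
    by (intro sum.cong refl) (simp add: Int_def mult.commute)
  finally show ?thesis .
qed

lemma sum_increasing_residue_class_approx:
  fixes f :: "int \<Rightarrow> real" and m n b :: int
  assumes "m > 0" "n \<ge> 1" "f 0 = 0" and mono: "\<And>y. 1 \<le> y \<Longrightarrow> y \<le> n \<Longrightarrow> f (y - 1) \<le> f y"
  shows "\<bar>(\<Sum>y\<in>{1..n} \<inter> residue_class m b. f y) - (\<Sum>y\<in>{1..n}. f y) / m\<bar> \<le> f n"
proof -
  let ?Y = "{1..n} \<inter> residue_class m b"
  have class_card: "\<bar>real (card (?Y \<inter> {j..})) - real (card ({1..n} \<inter> {j..})) / m\<bar> \<le> 1"
      if "j \<in> {1..n}" for j
  proof -
    have "?Y \<inter> {j..}
        = {x. real_of_int (j - 1) < of_int x \<and> of_int x \<le> real_of_int n} \<inter> residue_class m b"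
      using that by (auto simp del: of_int_diff)
    moreover have "{1..n} \<inter> {j..} = {j..n}" using that by auto
    moreover have "max 0 (real_of_int n - real_of_int (j - 1)) = real (card {j..n})" using that by simp
    ultimately show ?thesis
      using card_residue_class_interval_approx[OF assms(1), of "real_of_int (j - 1)" "real_of_int n" b]
      by (simp only:)
  qed
  have "\<bar>(\<Sum>y\<in>?Y. f y) - (\<Sum>y\<in>{1..n}. f y) / m\<bar>
      = \<bar>\<Sum>j\<in>{1..n}. (f j - f (j - 1)) * (real (card (?Y \<inter> {j..})) - real (card ({1..n} \<inter> {j..})) / m)\<bar>"
    using sum_eq_sum_increments_card[of f ?Y n] sum_eq_sum_increments_card[of f "{1..n}" n] assms(3)
    by (simp add: sum_divide_distrib right_diff_distrib sum_subtractf)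
  also have "\<dots> \<le> (\<Sum>j\<in>{1..n}. f j - f (j - 1))"
  proof (rule order_trans[OF sum_abs sum_mono])
    fix j assume j: "j \<in> {1..n}"
    then have "f j - f (j - 1) \<ge> 0" using mono[of j] by simp
    then show "\<bar>(f j - f (j - 1)) * (real (card (?Y \<inter> {j..})) - real (card ({1..n} \<inter> {j..})) / m)\<bar>
        \<le> f j - f (j - 1)"
      using mult_left_mono[OF class_card[OF j]] by (simp add: abs_mult)
  qed
  also have "\<dots> = f n"
    using sum_eq_sum_increments_card[of f "{n}" n] assms(2,3) by (simp add: Int_absorb2)
  finally show ?thesis .
qed

definition has_quadratic_density :: "(nat \<Rightarrow> 'a set) \<Rightarrow> real \<Rightarrow> bool" where
  "has_quadratic_density S A \<longleftrightarrow> (\<lambda>Q. real (card (S Q)) / (real Q)\<^sup>2) \<longlonglongrightarrow> A"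

definition equidistributed :: "(nat \<Rightarrow> (int \<times> int) set) \<Rightarrow> real \<Rightarrow> bool" where
  "equidistributed S A \<longleftrightarrow> (\<forall>m>0. \<forall>a b.
     has_quadratic_density (\<lambda>Q. S Q \<inter> residue_class m a \<times> residue_class m b) (A / (real_of_int m)\<^sup>2))"

definition fibred_region :: "(int \<Rightarrow> real) \<Rightarrow> (int \<Rightarrow> real) \<Rightarrow> nat \<Rightarrow> (int \<times> int) set" where
  "fibred_region L U n = {(x, y). 1 \<le> y \<and> y \<le> int n \<and> L y < of_int x \<and> of_int x \<le> U y}"

lemma card_fibred_region_residue_class_approx:
  fixes L U :: "int \<Rightarrow> real" and m :: int
  defines "w \<equiv> \<lambda>y. max 0 (U y - L y)"
  assumes "m > 0" "n \<ge> 1" and mono: "\<And>y z. 1 \<le> y \<Longrightarrow> y \<le> z \<Longrightarrow> z \<le> int n \<Longrightarrow> w y \<le> w z"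
  shows "\<bar>real (card (fibred_region L U n \<inter> residue_class m a \<times> residue_class m b))
    - (\<Sum>y\<in>{1..int n}. w y) / (real_of_int m)\<^sup>2\<bar> \<le> n + w (int n)"
proof -
  let ?W = "\<Sum>y\<in>{1..int n}. w y"
  define Y where "Y = {1..int n} \<inter> residue_class m b"
  define X where "X y = {x. L y < of_int x \<and> of_int x \<le> U y} \<inter> residue_class m a" for y
  have finite: "finite Y" "finite (X y)" for y
    unfolding X_def Y_def using assms(2) by (auto intro: finite_residue_class_interval)
  have m: "real_of_int m \<ge> 1" using assms(2) by simp
  have "fibred_region L U n \<inter> residue_class m a \<times> residue_class m b = prod.swap ` (SIGMA y:Y. X y)"
    by (auto simp: fibred_region_def X_def Y_def image_iff)
  then have card: "real (card (fibred_region L U n \<inter> residue_class m a \<times> residue_class m b))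
      = (\<Sum>y\<in>Y. real (card (X y)))"
    using finite by (simp add: card_image)
  have "\<bar>(\<Sum>y\<in>Y. real (card (X y))) - (\<Sum>y\<in>Y. w y) / m\<bar> \<le> (\<Sum>y\<in>Y. \<bar>real (card (X y)) - w y / m\<bar>)"
    unfolding sum_divide_distrib sum_subtractf[symmetric] by (rule sum_abs)
  also have "\<dots> \<le> (\<Sum>y\<in>Y. 1)"
    unfolding X_def w_def by (intro sum_mono card_residue_class_interval_approx assms(2))
  also have "\<dots> \<le> n"
    using card_mono[of "{1..int n}" Y] by (simp add: Y_def)
  finally have fibres: "\<bar>(\<Sum>y\<in>Y. real (card (X y))) - (\<Sum>y\<in>Y. w y) / m\<bar> \<le> n" .
  define f where "f y = (if y \<le> 0 then 0 else w y)" for y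
  have "\<bar>(\<Sum>y\<in>Y. f y) - (\<Sum>y\<in>{1..int n}. f y) / m\<bar> \<le> f (int n)"
    unfolding Y_def using assms(2,3) mono
    by (intro sum_increasing_residue_class_approx) (auto simp: f_def w_def)
  moreover have "(\<Sum>y\<in>Y. f y) = (\<Sum>y\<in>Y. w y)" "(\<Sum>y\<in>{1..int n}. f y) = ?W" "f (int n) = w (int n)"
    using assms(3) by (auto simp: f_def Y_def intro!: sum.cong)
  ultimately have "\<bar>(\<Sum>y\<in>Y. w y) - ?W / m\<bar> / m \<le> w (int n) / 1"
    using m by (intro frac_le) auto
  moreover have "(\<Sum>y\<in>Y. w y) / m - ?W / (real_of_int m)\<^sup>2 = ((\<Sum>y\<in>Y. w y) - ?W / m) / m"
    by (simp add: diff_divide_distrib power2_eq_square)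
  ultimately have "\<bar>(\<Sum>y\<in>Y. w y) / m - ?W / (real_of_int m)\<^sup>2\<bar> \<le> w (int n)"
    using m by (simp add: abs_divide)
  then show ?thesis using fibres unfolding card by linarith
qed

lemma equidistributed_fibred_region:
  fixes L U :: "nat \<Rightarrow> int \<Rightarrow> real" and A C :: real
  defines "w \<equiv> \<lambda>Q y. max 0 (U Q y - L Q y)"
  assumes mono: "\<And>Q y z. 1 \<le> y \<Longrightarrow> y \<le> z \<Longrightarrow> z \<le> int Q \<Longrightarrow> w Q y \<le> w Q z"
    and bound: "\<And>Q. w Q (int Q) \<le> C * Q"
    and area: "(\<lambda>Q. (\<Sum>y\<in>{1..int Q}. w Q y) / (real Q)\<^sup>2) \<longlonglongrightarrow> A"
  shows "equidistributed (\<lambda>Q. fibred_region (L Q) (U Q) Q) A"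
  unfolding equidistributed_def has_quadratic_density_def
proof (intro allI impI)
  fix m a b :: int assume "m > 0"
  let ?c = "\<lambda>Q. real (card (fibred_region (L Q) (U Q) Q \<inter> residue_class m a \<times> residue_class m b))"
  let ?W = "\<lambda>Q. \<Sum>y\<in>{1..int Q}. w Q y"
  let ?area = "\<lambda>Q. ?W Q / (real Q)\<^sup>2 / (real_of_int m)\<^sup>2"
  have "(\<lambda>Q. ?c Q / (real Q)\<^sup>2 - ?area Q) \<longlonglongrightarrow> 0"
  proof (rule Lim_null_comparison[OF _ lim_const_over_n])
    show "\<forall>\<^sub>F Q in sequentially. norm (?c Q / (real Q)\<^sup>2 - ?area Q) \<le> (1 + C) / Q"
      using eventually_ge_at_top[of 1]
    proof eventually_elim
      case (elim Q)
      have "\<bar>?c Q - ?W Q / (real_of_int m)\<^sup>2\<bar> \<le> Q + w Q (int Q)"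
        using \<open>m > 0\<close> elim mono unfolding w_def by (rule card_fibred_region_residue_class_approx)
      also have "\<dots> \<le> (1 + C) * Q" using bound[of Q] by (simp add: algebra_simps)
      finally have "\<bar>?c Q - ?W Q / (real_of_int m)\<^sup>2\<bar> / (real Q)\<^sup>2 \<le> (1 + C) * Q / (real Q)\<^sup>2"
        by (rule divide_right_mono) simp
      moreover have "?c Q / (real Q)\<^sup>2 - ?area Q = (?c Q - ?W Q / (real_of_int m)\<^sup>2) / (real Q)\<^sup>2"
        by (simp add: diff_divide_distrib mult.commute)
      ultimately show ?case using elim by (simp add: abs_divide power2_eq_square)
    qed
  qed
  from tendsto_add[OF this tendsto_divide[OF area tendsto_const, of "(real_of_int m)\<^sup>2"]] \<open>m > 0\<close>
  show "(\<lambda>Q. ?c Q / (real Q)\<^sup>2) \<longlonglongrightarrow> A / (real_of_int m)\<^sup>2" by simp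
qed

section \<open>A sieve for visible lattice points\<close>

definition visible_from :: "(int \<times> int) set \<Rightarrow> (int \<times> int) set" where
  "visible_from B = {(x, y). \<forall>(a, b)\<in>B. coprime (x - a) (y - b)}"

definition reduce_mod :: "(int \<times> int) set \<Rightarrow> nat \<Rightarrow> (int \<times> int) set" where
  "reduce_mod B p = (\<lambda>(a, b). (a mod int p, b mod int p)) ` B"

definition congruent_points :: "(int \<times> int) set \<Rightarrow> nat \<Rightarrow> (int \<times> int) set" where
  "congruent_points B p = {(x, y). (x mod int p, y mod int p) \<in> reduce_mod B p}"

definition local_density :: "(int \<times> int) set \<Rightarrow> nat \<Rightarrow> real" where
  "local_density B p = 1 - real (card (reduce_mod B p)) / (real p)\<^sup>2"

definition primes_le :: "nat \<Rightarrow> nat set" where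
  "primes_le z = {p. prime p \<and> p \<le> z}"

definition visible_density :: "(int \<times> int) set \<Rightarrow> real" where
  "visible_density B = lim (\<lambda>z. \<Prod>p\<in>primes_le z. local_density B p)"

lemma finite_primes_le [simp]: "finite (primes_le z)"
  by (simp add: primes_le_def)

lemma prime_if_in_primes_le: "p \<in> primes_le z \<Longrightarrow> prime p"
  by (simp add: primes_le_def)

lemma convergent_prod_primes_le:
  fixes f :: "nat \<Rightarrow> real"
  assumes "\<And>p. prime p \<Longrightarrow> 0 \<le> f p \<and> f p \<le> 1"
  shows "convergent (\<lambda>z. \<Prod>p\<in>primes_le z. f p)"
proof -
  have "decseq (\<lambda>z. \<Prod>p\<in>primes_le z. f p)"
  proof (rule decseq_SucI)
    fix z
    have "primes_le z \<subseteq> primes_le (Suc z)" by (auto simp: primes_le_def)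
    then have "(\<Prod>p\<in>primes_le (Suc z). f p)
        = (\<Prod>p\<in>primes_le (Suc z) - primes_le z. f p) * (\<Prod>p\<in>primes_le z. f p)"
      by (intro prod.subset_diff) auto
    also have "\<dots> \<le> 1 * (\<Prod>p\<in>primes_le z. f p)"
      using assms prime_if_in_primes_le by (intro mult_right_mono prod_le_1 prod_nonneg) auto
    finally show "(\<Prod>p\<in>primes_le (Suc z). f p) \<le> (\<Prod>p\<in>primes_le z. f p)" by simp
  qed
  moreover have "\<forall>z. 0 \<le> (\<Prod>p\<in>primes_le z. f p)"
    using assms prime_if_in_primes_le by (auto intro!: prod_nonneg)
  ultimately show ?thesis by (metis decseq_convergent convergentI)
qed

lemma local_density_bounds:
  assumes "prime p"
  shows "0 \<le> local_density B p" "local_density B p \<le> 1"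
proof -
  have p: "p > 0" using assms by (rule prime_gt_0_nat)
  then have "reduce_mod B p \<subseteq> {0..<int p} \<times> {0..<int p}" by (auto simp: reduce_mod_def)
  from card_mono[OF _ this] have "card (reduce_mod B p) \<le> p\<^sup>2" by (simp add: power2_eq_square)
  then have "real (card (reduce_mod B p)) \<le> (real p)\<^sup>2" by (metis of_nat_le_iff of_nat_power)
  then show "0 \<le> local_density B p" using p by (simp add: local_density_def divide_le_eq)
qed (simp add: local_density_def)

lemma LIMSEQ_visible_density:
  "(\<lambda>z. \<Prod>p\<in>primes_le z. local_density B p) \<longlonglongrightarrow> visible_density B"
  unfolding visible_density_def convergent_LIMSEQ_iff[symmetric]
  by (intro convergent_prod_primes_le conjI local_density_bounds)

lemma coprime_int_iff_no_common_prime: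
  fixes u v :: int
  shows "coprime u v \<longleftrightarrow> (\<forall>p. prime p \<longrightarrow> \<not> (int p dvd u \<and> int p dvd v))"
proof
  assume "coprime u v"
  then show "\<forall>p. prime p \<longrightarrow> \<not> (int p dvd u \<and> int p dvd v)"
    by (metis coprime_common_divisor not_prime_unit prime_nat_int_transfer)
next
  assume no_prime: "\<forall>p. prime p \<longrightarrow> \<not> (int p dvd u \<and> int p dvd v)"
  show "coprime u v"
  proof (rule ccontr)
    assume "\<not> coprime u v"
    then have "nat (gcd u v) \<noteq> 1" by (simp add: coprime_iff_gcd_eq_1 nat_eq_iff)
    then obtain p where "prime p" "p dvd nat (gcd u v)" using prime_factor_nat by blast
    then have "int p dvd gcd u v" by (simp add: int_dvd_int_iff[symmetric])
    then show False using no_prime \<open>prime p\<close> by auto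
  qed
qed

lemma visible_from_eq_Compl_congruent_points:
  "visible_from B = - (\<Union>p\<in>{p. prime p}. congruent_points B p)"
  by (auto simp: visible_from_def coprime_int_iff_no_common_prime congruent_points_def reduce_mod_def
      mod_eq_dvd_iff image_iff split: prod.splits)

lemma congruent_points_eq_UN:
  "congruent_points B p = (\<Union>(a, b)\<in>reduce_mod B p. residue_class (int p) a \<times> residue_class (int p) b)"
  by (fastforce simp: congruent_points_def reduce_mod_def residue_class_def cong_def)

lemma has_quadratic_density_Diff_disjoint_UN:
  assumes "finite I" and fin: "\<And>Q. finite (X Q)"
    and sub: "\<And>i Q. i \<in> I \<Longrightarrow> Y i Q \<subseteq> X Q"
    and disj: "\<And>Q. disjoint_family_on (\<lambda>i. Y i Q) I"
    and "has_quadratic_density X A" "\<And>i. i \<in> I \<Longrightarrow> has_quadratic_density (Y i) (D i)"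
  shows "has_quadratic_density (\<lambda>Q. X Q - (\<Union>i\<in>I. Y i Q)) (A - (\<Sum>i\<in>I. D i))"
proof -
  have card: "real (card (X Q - (\<Union>i\<in>I. Y i Q))) = real (card (X Q)) - (\<Sum>i\<in>I. real (card (Y i Q)))"
      for Q
  proof -
    have union_subset: "(\<Union>i\<in>I. Y i Q) \<subseteq> X Q" using sub by blast
    have "card (\<Union>i\<in>I. Y i Q) = (\<Sum>i\<in>I. card (Y i Q))"
      using \<open>finite I\<close> finite_subset[OF sub fin] disj
      by (intro card_UN_disjoint) (auto simp: disjoint_family_on_def)
    then show ?thesis
      using card_Diff_subset[OF finite_subset[OF union_subset fin] union_subset]
        card_mono[OF fin union_subset] by (simp add: of_nat_diff)
  qed
  have "(\<lambda>Q. real (card (X Q)) / (real Q)\<^sup>2 - (\<Sum>i\<in>I. real (card (Y i Q)) / (real Q)\<^sup>2))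
      \<longlonglongrightarrow> A - (\<Sum>i\<in>I. D i)"
    using assms(5,6) unfolding has_quadratic_density_def by (intro tendsto_diff tendsto_sum)
  then show ?thesis
    by (simp only: has_quadratic_density_def card diff_divide_distrib sum_divide_distrib)
qed

lemma sieve_finitely_many_primes:
  assumes fin: "\<And>Q. finite (S Q)" and "finite B" and equi: "equidistributed S A"
    and "finite T" "\<And>p. p \<in> T \<Longrightarrow> prime p"
    and "m > 0" "\<And>p. p \<in> T \<Longrightarrow> coprime m (int p)"
  shows "has_quadratic_density
    (\<lambda>Q. S Q \<inter> residue_class m a \<times> residue_class m b - (\<Union>p\<in>T. congruent_points B p))
    (A / (real_of_int m)\<^sup>2 * (\<Prod>p\<in>T. local_density B p))"
  using assms(4-)
proof (induction T arbitrary: m a b rule: finite_induct)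
  case empty
  then show ?case using equi by (simp add: equidistributed_def)
next
  case (insert p T)
  let ?bad = "\<Union>p\<in>T. congruent_points B p"
  let ?X = "\<lambda>m a b Q. S Q \<inter> residue_class m a \<times> residue_class m b - ?bad"
  let ?\<Pi> = "\<Prod>p\<in>T. local_density B p"
  define Y where "Y = (\<lambda>(c, d) Q. ?X m a b Q \<inter> residue_class (int p) c \<times> residue_class (int p) d)"
  have p: "prime p" "p > 0" "coprime m (int p)"
    using insert.prems by (auto simp: prime_gt_0_nat)
  have coprime: "coprime (m * int p) (int q)" if "q \<in> T" for q
    using that insert.prems insert.hyps(2) primes_coprime[of p q] by auto
  have residue: "has_quadratic_density (Y c) (A / (real_of_int (m * int p))\<^sup>2 * ?\<Pi>)" for c
  proof -
    obtain u v where "residue_class m a \<inter> residue_class (int p) (fst c) = residue_class (m * int p) u"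
      "residue_class m b \<inter> residue_class (int p) (snd c) = residue_class (m * int p) v"
      using residue_class_Int_coprime[OF p(3)] by metis
    then have "Y c = ?X (m * int p) u v" unfolding Y_def by (auto simp: case_prod_unfold)
    then show ?thesis using insert.prems p coprime by (simp only:) (rule insert.IH; simp)
  qed
  have "has_quadratic_density (\<lambda>Q. ?X m a b Q - (\<Union>c\<in>reduce_mod B p. Y c Q))
     (A / (real_of_int m)\<^sup>2 * ?\<Pi> - (\<Sum>c\<in>reduce_mod B p. A / (real_of_int (m * int p))\<^sup>2 * ?\<Pi>))"
  proof (rule has_quadratic_density_Diff_disjoint_UN)
    show "disjoint_family_on (\<lambda>c. Y c Q) (reduce_mod B p)" for Q
      by (auto simp: disjoint_family_on_def Y_def reduce_mod_def residue_class_def cong_def)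
    show "has_quadratic_density (?X m a b) (A / (real_of_int m)\<^sup>2 * ?\<Pi>)"
      using insert.prems by (intro insert.IH) auto
  qed (use residue in \<open>auto simp: Y_def reduce_mod_def fin \<open>finite B\<close>\<close>)
  also have "(\<lambda>Q. ?X m a b Q - (\<Union>c\<in>reduce_mod B p. Y c Q))
     = (\<lambda>Q. S Q \<inter> residue_class m a \<times> residue_class m b - (\<Union>q\<in>insert p T. congruent_points B q))"
    by (auto simp: Y_def congruent_points_eq_UN[of B p])
  also have "A / (real_of_int m)\<^sup>2 * ?\<Pi> - (\<Sum>c\<in>reduce_mod B p. A / (real_of_int (m * int p))\<^sup>2 * ?\<Pi>)
     = A / (real_of_int m)\<^sup>2 * (\<Prod>q\<in>insert p T. local_density B q)"
    using insert.hyps by (simp add: local_density_def power_mult_distrib algebra_simps)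
  finally show ?case .
qed

lemma sum_inverse_consecutive_products:
  assumes "1 \<le> z" "z \<le> N"
  shows "(\<Sum>n\<in>{z<..N}. 1 / (real n * (real n - 1))) = 1 / real z - 1 / real N"
  using assms(2)
proof (induction N rule: dec_induct)
  case (step n)
  have "{z<..Suc n} = insert (Suc n) {z<..n}" using step by auto
  moreover have "1 / (real (Suc n) * (real (Suc n) - 1)) = 1 / real n - 1 / real (Suc n)"
    using step assms(1) by (simp add: field_simps)
  ultimately show ?case using step by simp
qed simp

lemma sum_inverse_squares_tail_le:
  assumes "1 \<le> z"
  shows "(\<Sum>n\<in>{z<..N}. 1 / (real n)\<^sup>2) \<le> 1 / real z"
proof (cases "z \<le> N")
  case True
  have "(\<Sum>n\<in>{z<..N}. 1 / (real n)\<^sup>2) \<le> (\<Sum>n\<in>{z<..N}. 1 / (real n * (real n - 1)))"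
    using assms by (intro sum_mono frac_le) (auto simp: power2_eq_square)
  also have "\<dots> \<le> 1 / real z" using sum_inverse_consecutive_products[OF assms True] by simp
  finally show ?thesis .
qed simp

definition centred_box :: "nat \<Rightarrow> (int \<times> int) set" where
  "centred_box X = {- int X..int X} \<times> {- int X..int X}"

lemma finite_centred_box [simp]: "finite (centred_box X)"
  by (simp add: centred_box_def)

lemma card_nonzero_multiples_le:
  assumes "n \<ge> 1"
  shows "real (card ({- int X..int X} \<inter> {e. e \<noteq> 0 \<and> int n dvd e})) \<le> 2 * real X / real n"
proof -
  let ?K = "{- int (X div n)..int (X div n)} - {0}"
  have "{- int X..int X} \<inter> {e. e \<noteq> 0 \<and> int n dvd e} \<subseteq> (\<lambda>j. int n * j) ` ?K"
  proof
    fix e assume "e \<in> {- int X..int X} \<inter> {e. e \<noteq> 0 \<and> int n dvd e}"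
    then obtain j where j: "e = int n * j" "j \<noteq> 0" "int n * \<bar>j\<bar> \<le> int X" by (auto simp: abs_if)
    then have "\<bar>j\<bar> \<le> int X div int n" using zdiv_mono1[OF j(3), of "int n"] assms by simp
    then show "e \<in> (\<lambda>j. int n * j) ` ?K" using j by (auto simp: zdiv_int abs_le_iff)
  qed
  then have "card ({- int X..int X} \<inter> {e. e \<noteq> 0 \<and> int n dvd e}) \<le> card ?K"
    by (rule surj_card_le[rotated]) simp
  also have "\<dots> = 2 * (X div n)" by (simp add: card_Diff_singleton nat_add_distrib)
  finally have "real (card ({- int X..int X} \<inter> {e. e \<noteq> 0 \<and> int n dvd e})) \<le> 2 * real (X div n)"
    by linarith
  also have "\<dots> \<le> 2 * (real X / real n)" by (intro mult_left_mono of_nat_div_le_of_nat) simp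
  finally show ?thesis by simp
qed

lemma card_large_common_divisor_le:
  assumes "z \<ge> 1"
  shows "real (card {(e, f)\<in>centred_box X. \<exists>n>z. int n dvd e \<and> int n dvd f})
    \<le> 2 * (2 * real X + 1) + 4 * (real X)\<^sup>2 / z" (is "real (card ?S) \<le> _")
proof -
  let ?I = "{- int X..int X}"
  let ?axes = "{0} \<times> ?I \<union> ?I \<times> {0}"
  define D where "D n = ?I \<inter> {e. e \<noteq> 0 \<and> int n dvd e}" for n
  have "?S \<subseteq> ?axes \<union> (\<Union>n\<in>{z<..X}. D n \<times> D n)"
  proof
    fix v assume "v \<in> ?S"
    then obtain e f n where v: "v = (e, f)" "e \<in> ?I" "f \<in> ?I" "n > z" "int n dvd e" "int n dvd f"
      by (auto simp: centred_box_def)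
    have "n \<le> X" if "e \<noteq> 0" using dvd_imp_le_int[OF that v(5)] v(2) by auto
    then show "v \<in> ?axes \<union> (\<Union>n\<in>{z<..X}. D n \<times> D n)"
      using v by (cases "e = 0 \<or> f = 0") (auto simp: D_def)
  qed
  then have "card ?S \<le> card (?axes \<union> (\<Union>n\<in>{z<..X}. D n \<times> D n))"
    by (rule card_mono[rotated]) (simp add: D_def)
  also have "\<dots> \<le> card ?axes + card (\<Union>n\<in>{z<..X}. D n \<times> D n)" by (rule card_Un_le)
  also have "\<dots> \<le> (card ({0::int} \<times> ?I) + card (?I \<times> {0::int})) + (\<Sum>n\<in>{z<..X}. card (D n \<times> D n))"
    by (intro add_mono card_Un_le card_UN_le) simp
  also have "card ({0::int} \<times> ?I) + card (?I \<times> {0::int}) = 2 * (2 * X + 1)"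
    by (simp add: card_cartesian_product nat_add_distrib nat_mult_distrib)
  finally have "real (card ?S) \<le> real (2 * (2 * X + 1) + (\<Sum>n\<in>{z<..X}. card (D n \<times> D n)))"
    by (rule of_nat_mono)
  also have "\<dots> = 2 * (2 * real X + 1) + (\<Sum>n\<in>{z<..X}. real (card (D n)) * real (card (D n)))"
    by (simp add: card_cartesian_product)
  also have "(\<Sum>n\<in>{z<..X}. real (card (D n)) * real (card (D n)))
      \<le> (\<Sum>n\<in>{z<..X}. (2 * real X / real n) * (2 * real X / real n))"
    unfolding D_def using assms by (intro sum_mono mult_mono card_nonzero_multiples_le) auto
  also have "\<dots> = 4 * (real X)\<^sup>2 * (\<Sum>n\<in>{z<..X}. 1 / (real n)\<^sup>2)"
    by (simp add: sum_distrib_left power2_eq_square)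
  also have "\<dots> \<le> 4 * (real X)\<^sup>2 * (1 / real z)"
    by (intro mult_left_mono sum_inverse_squares_tail_le assms) auto
  finally show ?thesis by simp
qed

lemma card_sieved_not_visible_le:
  assumes "z \<ge> 1" "S \<subseteq> centred_box X" "B \<subseteq> centred_box K"
  shows "real (card (S - (\<Union>p\<in>primes_le z. congruent_points B p) - visible_from B))
    \<le> card B * (2 * (2 * real (X + K) + 1) + 4 * (real (X + K))\<^sup>2 / z)"
proof -
  let ?V = "{(e, f)\<in>centred_box (X + K). \<exists>n>z. int n dvd e \<and> int n dvd f}"
  have finite: "finite ?V" "finite B"
    using assms(3) by (auto intro: finite_subset[OF _ finite_centred_box])
  have "S - (\<Union>p\<in>primes_le z. congruent_points B p) - visible_from B
      \<subseteq> (\<Union>(a, b)\<in>B. (\<lambda>(e, f). (e + a, f + b)) ` ?V)"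
  proof
    fix v assume v: "v \<in> S - (\<Union>p\<in>primes_le z. congruent_points B p) - visible_from B"
    obtain x y where xy: "v = (x, y)" by fastforce
    obtain p where p: "prime p" "v \<in> congruent_points B p" "p \<notin> primes_le z"
      using v by (auto simp: visible_from_eq_Compl_congruent_points)
    then obtain a b where ab: "(a, b) \<in> B" "int p dvd x - a" "int p dvd y - b"
      by (auto simp: xy congruent_points_def reduce_mod_def mod_eq_dvd_iff)
    have "p > z" using p by (simp add: primes_le_def)
    moreover have "(x - a, y - b) \<in> centred_box (X + K)"
      using assms(2,3) v ab(1) by (fastforce simp: centred_box_def xy)
    ultimately have "(x - a, y - b) \<in> ?V" using ab by auto
    then show "v \<in> (\<Union>(a, b)\<in>B. (\<lambda>(e, f). (e + a, f + b)) ` ?V)"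
      using ab(1) xy by (force intro!: bexI[of _ "(a, b)"] image_eqI[of _ _ "(x - a, y - b)"])
  qed
  then have "card (S - (\<Union>p\<in>primes_le z. congruent_points B p) - visible_from B)
      \<le> card (\<Union>(a, b)\<in>B. (\<lambda>(e, f). (e + a, f + b)) ` ?V)"
    using finite by (intro card_mono) auto
  also have "\<dots> \<le> (\<Sum>(a, b)\<in>B. card ((\<lambda>(e, f). (e + a, f + b)) ` ?V))"
    using card_UN_le[OF finite(2), of "\<lambda>(a, b). (\<lambda>(e, f). (e + a, f + b)) ` ?V"]
    by (simp add: case_prod_unfold)
  also have "\<dots> \<le> (\<Sum>(a, b)\<in>B. card ?V)"
    using card_image_le[OF finite(1)] by (intro sum_mono) (simp add: case_prod_unfold)
  also have "\<dots> = card B * card ?V" by (simp add: case_prod_unfold)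
  finally have "real (card (S - (\<Union>p\<in>primes_le z. congruent_points B p) - visible_from B))
      \<le> real (card B * card ?V)"
    by (rule of_nat_mono)
  also have "\<dots> \<le> card B * (2 * (2 * real (X + K) + 1) + 4 * (real (X + K))\<^sup>2 / z)"
    unfolding of_nat_mult by (intro mult_left_mono card_large_common_divisor_le assms(1)) simp
  finally show ?thesis .
qed

lemma LIMSEQ_of_approximations:
  fixes f :: "nat \<Rightarrow> real" and g :: "nat \<Rightarrow> nat \<Rightarrow> real"
  assumes g: "\<And>z. g z \<longlonglongrightarrow> l z" and l: "l \<longlonglongrightarrow> L"
    and bound: "\<And>z n. z \<ge> 1 \<Longrightarrow> n \<ge> 1 \<Longrightarrow> \<bar>f n - g z n\<bar> \<le> d z + e n"
    and d: "d \<longlonglongrightarrow> 0" and e: "e \<longlonglongrightarrow> 0"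
  shows "f \<longlonglongrightarrow> L"
proof (rule LIMSEQ_I)
  fix \<epsilon> :: real assume "\<epsilon> > 0"
  then have quarter: "\<epsilon> / 4 > 0" by simp
  have "\<forall>\<^sub>F z in sequentially. dist (d z) 0 < \<epsilon> / 4 \<and> dist (l z) L < \<epsilon> / 4 \<and> z \<ge> 1"
    using tendstoD[OF d quarter] tendstoD[OF l quarter] eventually_ge_at_top by (intro eventually_conj)
  then obtain z where z: "dist (d z) 0 < \<epsilon> / 4" "dist (l z) L < \<epsilon> / 4" "z \<ge> 1"
    using eventually_happens'[OF sequentially_bot] by blast
  have "\<forall>\<^sub>F n in sequentially. norm (f n - L) < \<epsilon>"
    using tendstoD[OF e quarter] tendstoD[OF g[of z] quarter] eventually_ge_at_top[of 1]
  proof eventually_elim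
    case (elim n)
    then show ?case using bound[of z n] z unfolding dist_real_def real_norm_def by linarith
  qed
  then show "\<exists>no. \<forall>n\<ge>no. norm (f n - L) < \<epsilon>" by (simp add: eventually_sequentially)
qed

lemma finite_subset_centred_box:
  assumes "finite B"
  shows "\<exists>K. B \<subseteq> centred_box K"
proof -
  have "finite ((\<lambda>(a, b). nat \<bar>a\<bar> + nat \<bar>b\<bar>) ` B)" using assms by simp
  then obtain K where "\<forall>n\<in>(\<lambda>(a, b). nat \<bar>a\<bar> + nat \<bar>b\<bar>) ` B. n \<le> K"
    using finite_nat_set_iff_bounded_le by blast
  then have "B \<subseteq> centred_box K" by (fastforce simp: centred_box_def)
  then show ?thesis by blast
qed

lemma visible_points_sieve_error:
  fixes C K z Q :: nat and D :: real
  assumes "z \<ge> 1" "Q \<ge> 1" and box: "S \<subseteq> centred_box (C * Q)" "B \<subseteq> centred_box K"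
  defines "G \<equiv> S - (\<Union>p\<in>primes_le z. congruent_points B p)" and "D \<equiv> real (C + K)"
  shows "\<bar>real (card (S \<inter> visible_from B)) / (real Q)\<^sup>2 - real (card G) / (real Q)\<^sup>2\<bar>
    \<le> card B * (4 * D\<^sup>2) / z + card B * (4 * D + 2) / Q"
proof -
  let ?c = "S \<inter> visible_from B"
  have finite: "finite G"
    using box(1) by (auto simp: G_def intro: finite_subset[OF _ finite_centred_box])
  have visible_subset: "?c \<subseteq> G"
    by (auto simp: G_def visible_from_eq_Compl_congruent_points primes_le_def)
  have "C * Q + K \<le> (C + K) * Q" using \<open>Q \<ge> 1\<close> by (simp add: add_mult_distrib)
  then have side: "real (C * Q + K) \<le> D * Q"
    unfolding D_def of_nat_mult[symmetric] by (rule of_nat_mono)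
  have "\<bar>real (card ?c) - real (card G)\<bar> = real (card (G - ?c))"
    using card_mono[OF finite visible_subset] finite_subset[OF visible_subset finite] visible_subset
    by (simp add: card_Diff_subset of_nat_diff)
  also have "G - ?c = G - visible_from B" by (auto simp: G_def)
  also have "real (card (G - visible_from B))
      \<le> card B * (2 * (2 * real (C * Q + K) + 1) + 4 * (real (C * Q + K))\<^sup>2 / z)"
    unfolding G_def by (rule card_sieved_not_visible_le[OF \<open>z \<ge> 1\<close> box])
  also have "\<dots> \<le> card B * (2 * (2 * (D * Q) + 1 * Q) + 4 * (D * Q)\<^sup>2 / z)"
    using side \<open>Q \<ge> 1\<close> by (intro mult_left_mono add_mono divide_right_mono power_mono) auto
  finally have "\<bar>real (card ?c) - real (card G)\<bar> / (real Q)\<^sup>2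
      \<le> card B * (2 * (2 * (D * Q) + 1 * Q) + 4 * (D * Q)\<^sup>2 / z) / (real Q)\<^sup>2"
    by (rule divide_right_mono) simp
  also have "\<dots> = card B * (4 * D\<^sup>2) / z + card B * (4 * D + 2) / Q"
    using \<open>Q \<ge> 1\<close> \<open>z \<ge> 1\<close> by (simp add: field_simps power2_eq_square)
  also have "\<bar>real (card ?c) - real (card G)\<bar> / (real Q)\<^sup>2
      = \<bar>real (card ?c) / (real Q)\<^sup>2 - real (card G) / (real Q)\<^sup>2\<bar>"
    by (simp add: abs_divide flip: diff_divide_distrib)
  finally show ?thesis .
qed

theorem visible_points_density:
  assumes box: "\<And>Q. S Q \<subseteq> centred_box (C * Q)" and "finite B" and equi: "equidistributed S A"
  shows "has_quadratic_density (\<lambda>Q. S Q \<inter> visible_from B) (A * visible_density B)"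
proof -
  obtain K where K: "B \<subseteq> centred_box K" using finite_subset_centred_box[OF \<open>finite B\<close>] by blast
  let ?G = "\<lambda>z Q. S Q - (\<Union>p\<in>primes_le z. congruent_points B p)"
  have finite: "finite (S Q)" for Q
    using box by (rule finite_subset) simp
  show ?thesis unfolding has_quadratic_density_def
  proof (rule LIMSEQ_of_approximations)
    show "(\<lambda>Q. real (card (?G z Q)) / (real Q)\<^sup>2) \<longlonglongrightarrow> A * (\<Prod>p\<in>primes_le z. local_density B p)" for z
      using sieve_finitely_many_primes[OF finite \<open>finite B\<close> equi, of "primes_le z" 1]
      by (simp add: has_quadratic_density_def prime_if_in_primes_le)
    show "(\<lambda>z. A * (\<Prod>p\<in>primes_le z. local_density B p)) \<longlonglongrightarrow> A * visible_density B"
      by (intro tendsto_intros LIMSEQ_visible_density)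
    show "(\<lambda>z. card B * (4 * (real (C + K))\<^sup>2) / real z) \<longlonglongrightarrow> 0"
      "(\<lambda>Q. card B * (4 * real (C + K) + 2) / real Q) \<longlonglongrightarrow> 0"
      by (rule lim_const_over_n)+
    show "\<bar>real (card (S Q \<inter> visible_from B)) / (real Q)\<^sup>2 - real (card (?G z Q)) / (real Q)\<^sup>2\<bar>
        \<le> card B * (4 * (real (C + K))\<^sup>2) / z + card B * (4 * real (C + K) + 2) / Q"
      if "z \<ge> 1" "Q \<ge> 1" for z Q
      using that box K by (rule visible_points_sieve_error)
  qed
qed

section \<open>Lattice points below the diagonal and above a hyperbola\<close>

lemma sum_mono_on_integral_approx:
  fixes f :: "real \<Rightarrow> real"
  assumes "mono_on {0..real n} f"
  shows "\<bar>(\<Sum>y\<in>{1..n}. f (real y)) - integral {0..real n} f\<bar> \<le> f (real n) - f 0"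
proof -
  have "integral {0..real n} f \<le> (\<Sum>y\<in>{1..n}. f (real y)) \<and>
      (\<Sum>y\<in>{1..n}. f (real y)) - integral {0..real n} f \<le> f (real n) - f 0"
    using assms
  proof (induction n)
    case (Suc n)
    have mono: "mono_on {0..real n} f" "mono_on {real n..real (Suc n)} f"
      by (rule mono_on_subset[OF Suc.prems]; auto)+
    have "integral {0..real (Suc n)} f = integral {0..real n} f + integral {real n..real (Suc n)} f"
      using integrable_on_mono_on[OF Suc.prems]
      by (intro Henstock_Kurzweil_Integration.integral_combine[symmetric]) auto
    moreover have "integral {real n..real (Suc n)} f
        \<le> integral {real n..real (Suc n)} (\<lambda>_. f (real (Suc n)))"
      "integral {real n..real (Suc n)} (\<lambda>_. f (real n)) \<le> integral {real n..real (Suc n)} f"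
      by (rule integral_le[OF _ _ mono_onD[OF mono(2)]];
          use integrable_on_mono_on[OF mono(2)] in auto)+
    ultimately show ?case using Suc.IH[OF mono(1)] by simp
  qed simp
  then show ?thesis by linarith
qed

text \<open>For \<open>u > 0\<close> this is the area of \<open>{(s, t) \<in> [0, 1]\<^sup>2. s t > u}\<close>.\<close>

definition hyperbola_area :: "real \<Rightarrow> real" where
  "hyperbola_area u = 1 - min u 1 + min u 1 * ln (min u 1)"

lemma hyperbola_area_eq_0: "u \<ge> 1 \<Longrightarrow> hyperbola_area u = 0"
  by (simp add: hyperbola_area_def)

lemma tendsto_hyperbola_area:
  assumes "(f \<longlongrightarrow> u) F" "u > 0"
  shows "((\<lambda>x. hyperbola_area (f x)) \<longlongrightarrow> hyperbola_area u) F"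
  unfolding hyperbola_area_def using assms by (intro tendsto_intros) auto

lemma has_integral_zero_extension:
  fixes f :: "real \<Rightarrow> 'a::banach"
  assumes "(f has_integral I) {c..b}" "a \<le> c" "c \<le> b"
  shows "((\<lambda>t. if c < t then f t else 0) has_integral I) {a..b}"
proof -
  have "((\<lambda>t. if c < t then f t else 0) has_integral 0) {a..c}"
    by (rule has_integral_is_0) auto
  moreover have "((\<lambda>t. if c < t then f t else 0) has_integral I) {c..b}"
    using has_integral_spike_finite[OF _ _ assms(1), of "{c}" "\<lambda>t. if c < t then f t else 0"] by auto
  ultimately show ?thesis
    using has_integral_combine[OF assms(2,3)] by fastforce
qed

lemma has_integral_hyperbola:
  fixes T N :: real
  assumes "T > 0" "N > 0"
  shows "((\<lambda>t. if T / N < t then N - T / t else 0) has_integral N\<^sup>2 * hyperbola_area (T / N\<^sup>2)) {0..N}"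
proof (cases "T < N\<^sup>2")
  case False
  then have "N \<le> T / N" using assms by (simp add: power2_eq_square le_divide_eq)
  then have "((\<lambda>t. if T / N < t then N - T / t else 0) has_integral 0) {0..N}"
    by (intro has_integral_is_0) auto
  moreover have "hyperbola_area (T / N\<^sup>2) = 0"
    using False assms by (intro hyperbola_area_eq_0) simp
  ultimately show ?thesis by simp
next
  case True
  let ?F = "\<lambda>t. N * t - T * ln t"
  have cutoff: "T / N \<le> N" using True assms by (simp add: power2_eq_square divide_le_eq)
  have "((\<lambda>t. N - T / t) has_integral ?F N - ?F (T / N)) {T / N..N}"
  proof (rule fundamental_theorem_of_calculus[OF cutoff])
    fix t assume "t \<in> {T / N..N}"
    then have "t > 0" using assms by (auto intro: less_le_trans[of 0 "T / N"])
    then show "(?F has_vector_derivative N - T / t) (at t within {T / N..N})"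
      unfolding has_real_derivative_iff_has_vector_derivative[symmetric]
      by (auto intro!: derivative_eq_intros)
  qed
  moreover have "?F N - ?F (T / N) = N\<^sup>2 * hyperbola_area (T / N\<^sup>2)"
    using True assms
    by (simp add: hyperbola_area_def ln_div ln_mult min_def field_simps power2_eq_square)
  ultimately show ?thesis
    using assms cutoff by (intro has_integral_zero_extension) simp_all
qed

lemma hyperbola_sum_approx:
  fixes T :: real
  assumes "T > 0" "n > 0"
  shows "\<bar>(\<Sum>y\<in>{1..n}. max 0 (real n - T / real y)) - (real n)\<^sup>2 * hyperbola_area (T / (real n)\<^sup>2)\<bar> \<le> n"
proof -
  have n: "real n > 0" using assms(2) by simp
  let ?f = "\<lambda>t. if T / n < t then n - T / t else 0"
  have f_eq: "?f t = max 0 (n - T / t)" if "t > 0" for t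
  proof -
    have "T / n < t \<longleftrightarrow> T / t < n" using that n by (simp add: divide_less_eq mult.commute)
    then show ?thesis by (auto simp: max_def)
  qed
  have "mono_on {0..real n} ?f"
  proof (rule mono_onI)
    fix s t assume "s \<in> {0..real n}" "s \<le> t"
    then consider "s = 0" "t = 0" | "s = 0" "t > 0" | "s > 0" "t > 0" by fastforce
    then show "?f s \<le> ?f t"
    proof cases
      case 2
      then show ?thesis using assms(1) n by (simp add: f_eq divide_less_0_iff)
    next
      case 3
      then show ?thesis
        unfolding f_eq[OF 3(1)] f_eq[OF 3(2)] using assms(1) \<open>s \<le> t\<close>
        by (intro max.mono diff_mono divide_left_mono) auto
    qed simp
  qed
  then have "\<bar>(\<Sum>y\<in>{1..n}. ?f (real y)) - integral {0..real n} ?f\<bar> \<le> ?f (real n) - ?f 0"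
    by (rule sum_mono_on_integral_approx)
  also have "\<dots> \<le> n" using assms(1) n by (auto simp: divide_less_0_iff)
  also have "(\<Sum>y\<in>{1..n}. ?f (real y)) = (\<Sum>y\<in>{1..n}. max 0 (real n - T / real y))"
    by (intro sum.cong refl f_eq) auto
  also have "integral {0..real n} ?f = (real n)\<^sup>2 * hyperbola_area (T / (real n)\<^sup>2)"
    using has_integral_hyperbola[OF assms(1) n] by (rule integral_unique)
  finally show ?thesis .
qed

lemma hyperbola_sum_limit:
  fixes T :: "nat \<Rightarrow> real"
  assumes T: "(\<lambda>Q. T Q / (real Q)\<^sup>2) \<longlonglongrightarrow> u" and u: "u > 0"
  shows "(\<lambda>Q. (\<Sum>y\<in>{1..Q}. max 0 (real Q - T Q / real y)) / (real Q)\<^sup>2) \<longlonglongrightarrow> hyperbola_area u"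
proof -
  let ?s = "\<lambda>Q. \<Sum>y\<in>{1..Q}. max 0 (real Q - T Q / real y)"
  let ?area = "\<lambda>Q. hyperbola_area (T Q / (real Q)\<^sup>2)"
  have "(\<lambda>Q. ?s Q / (real Q)\<^sup>2 - ?area Q) \<longlonglongrightarrow> 0"
  proof (rule Lim_null_comparison[OF _ lim_const_over_n])
    show "\<forall>\<^sub>F Q in sequentially. norm (?s Q / (real Q)\<^sup>2 - ?area Q) \<le> 1 / real Q"
      using order_tendstoD(1)[OF T u] eventually_gt_at_top[of 0]
    proof eventually_elim
      case (elim Q)
      then have "\<bar>?s Q - (real Q)\<^sup>2 * ?area Q\<bar> \<le> Q"
        by (intro hyperbola_sum_approx) (simp_all add: zero_less_divide_iff)
      then have "\<bar>?s Q - (real Q)\<^sup>2 * ?area Q\<bar> / (real Q)\<^sup>2 \<le> Q / (real Q)\<^sup>2"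
        by (rule divide_right_mono) simp
      moreover have "?s Q / (real Q)\<^sup>2 - ?area Q = (?s Q - (real Q)\<^sup>2 * ?area Q) / (real Q)\<^sup>2"
        using elim by (simp add: diff_divide_distrib)
      ultimately show ?case using elim by (simp add: abs_divide power2_eq_square)
    qed
  qed
  from tendsto_add[OF this tendsto_hyperbola_area[OF T u]] show ?thesis by simp
qed

lemma sum_int_interval_eq_nat: "(\<Sum>y\<in>{1..int Q}. f y) = (\<Sum>y\<in>{1..Q}. f (int y))"
  by (rule sum.reindex_bij_witness[of _ int nat]) auto

definition hyperbola_region :: "int \<Rightarrow> int \<Rightarrow> real \<Rightarrow> nat \<Rightarrow> (int \<times> int) set" where
  "hyperbola_region r k T Q = {(x, y). 1 \<le> y \<and> y \<le> int Q \<and> r * x + k * y \<le> int Q \<and>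
     T < of_int ((r * x + k * y) * y)}"

lemma hyperbola_region_eq_fibred_region:
  assumes "r > 0"
  shows "hyperbola_region r k T Q
    = fibred_region (\<lambda>y. (T / of_int y - k * y) / r) (\<lambda>y. (real Q - k * y) / r) Q"
proof -
  have lower: "(T / of_int y - k * y) / r < of_int x \<longleftrightarrow> T < of_int ((r * x + k * y) * y)"
      if "y \<ge> 1" for x y :: int
  proof -
    have "(T / of_int y - k * y) / r < of_int x \<longleftrightarrow> T / of_int y < of_int (r * x + k * y)"
      using assms by (simp add: divide_less_eq algebra_simps)
    also have "\<dots> \<longleftrightarrow> T < of_int ((r * x + k * y) * y)"
      using that by (simp add: divide_less_eq)
    finally show ?thesis .
  qed
  have upper: "of_int x \<le> (real Q - k * y) / r \<longleftrightarrow> r * x + k * y \<le> int Q" for x y :: int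
  proof -
    have "of_int x \<le> (real Q - k * y) / r \<longleftrightarrow> real_of_int (r * x + k * y) \<le> real_of_int (int Q)"
      using assms by (simp add: le_divide_eq algebra_simps)
    then show ?thesis by (simp only: of_int_le_iff)
  qed
  show ?thesis
    unfolding hyperbola_region_def fibred_region_def upper using lower by blast
qed

lemma hyperbola_region_subset_centred_box:
  assumes "0 \<le> k" "k < r" "T \<ge> 0"
  shows "hyperbola_region r k T Q \<subseteq> centred_box Q"
proof clarify
  fix x y assume "(x, y) \<in> hyperbola_region r k T Q"
  then have y: "1 \<le> y" "y \<le> int Q" "r * x + k * y \<le> int Q" and T: "T < of_int ((r * x + k * y) * y)"
    by (auto simp: hyperbola_region_def)
  have "0 < real_of_int ((r * x + k * y) * y)" using T assms(3) by linarith
  then have pos: "0 < r * x + k * y"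
    using y(1) by (simp only: of_int_0_less_iff zero_less_mult_iff) auto
  have "r * (- x) \<le> r * int Q"
    using pos mult_mono[of k r y "int Q"] y assms by simp
  then have "- x \<le> int Q" using assms by (simp only: mult_le_cancel_left_pos)
  moreover have "r * x \<le> r * int Q"
    using y(3) mult_nonneg_nonneg[of k y] mult_right_mono[of 1 r "int Q"] y(1) assms by linarith
  then have "x \<le> int Q" using assms by (simp only: mult_le_cancel_left_pos)
  ultimately show "(x, y) \<in> centred_box Q" using y by (auto simp: centred_box_def)
qed

lemma equidistributed_hyperbola_region:
  assumes r: "r > 0" and T: "(\<lambda>Q. T Q / (real Q)\<^sup>2) \<longlonglongrightarrow> u" "u > 0" "\<And>Q. T Q \<ge> 0"
  shows "equidistributed (\<lambda>Q. hyperbola_region r k (T Q) Q) (hyperbola_area u / of_int r)"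
proof -
  let ?L = "\<lambda>Q y. (T Q / of_int y - k * y) / r" and ?U = "\<lambda>Q y. (real Q - k * y) / r"
  have width: "max 0 (?U Q y - ?L Q y) = max 0 (real Q - T Q / of_int y) / r" for Q y
  proof -
    have "?U Q y - ?L Q y = (real Q - T Q / of_int y) / r" by (simp add: diff_divide_distrib)
    then show ?thesis using r by (simp add: max_divide_distrib_right)
  qed
  have "equidistributed (\<lambda>Q. fibred_region (?L Q) (?U Q) Q) (hyperbola_area u / r)"
  proof (rule equidistributed_fibred_region[where C = 1]; unfold width)
    show "max 0 (real Q - T Q / of_int y) / r \<le> max 0 (real Q - T Q / of_int z) / r"
        if "1 \<le> y" "y \<le> z" for Q y z
      using that r T(3)[of Q] by (intro divide_right_mono max.mono diff_mono divide_left_mono) auto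
    show "max 0 (real Q - T Q / of_int (int Q)) / r \<le> 1 * real Q" for Q
    proof -
      have "max 0 (real Q - T Q / of_int (int Q)) / r \<le> real Q / 1"
        using T(3)[of Q] r by (intro frac_le) auto
      then show ?thesis by simp
    qed
    have "(\<lambda>Q. (\<Sum>y\<in>{1..Q}. max 0 (real Q - T Q / real y)) / (real Q)\<^sup>2 / r) \<longlonglongrightarrow> hyperbola_area u / r"
      using r by (intro tendsto_intros hyperbola_sum_limit T) auto
    then show "(\<lambda>Q. (\<Sum>y\<in>{1..int Q}. max 0 (real Q - T Q / of_int y) / r) / (real Q)\<^sup>2)
        \<longlonglongrightarrow> hyperbola_area u / r"
      by (simp add: sum_int_interval_eq_nat mult.commute flip: sum_divide_distrib)
  qed
  then show ?thesis by (simp only: hyperbola_region_eq_fibred_region[OF r])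
qed

lemma visible_points_density_hyperbola_region:
  assumes k: "0 \<le> k" "k < r" and T: "(\<lambda>Q. T Q / (real Q)\<^sup>2) \<longlonglongrightarrow> u" "u > 0" "\<And>Q. T Q \<ge> 0"
    and "finite B"
  shows "has_quadratic_density (\<lambda>Q. hyperbola_region r k (T Q) Q \<inter> visible_from B)
    (hyperbola_area u / of_int r * visible_density B)"
proof (rule visible_points_density)
  show "hyperbola_region r k (T Q) Q \<subseteq> centred_box (1 * Q)" for Q
    using hyperbola_region_subset_centred_box[OF k T(3)] by simp
  show "equidistributed (\<lambda>Q. hyperbola_region r k (T Q) Q) (hyperbola_area u / of_int r)"
    using k T by (intro equidistributed_hyperbola_region) auto
qed fact

lemma visible_points_density_triangle:
  assumes "finite B"
  shows "has_quadratic_density (\<lambda>Q. {(a, q). 0 < a \<and> a \<le> q \<and> q \<le> int Q} \<inter> visible_from B)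
    (1 / 2 * visible_density B)"
proof (rule visible_points_density)
  show "{(a, q). 0 < a \<and> a \<le> q \<and> q \<le> int Q} \<subseteq> centred_box (1 * Q)" for Q
    by (auto simp: centred_box_def)
  have "equidistributed (\<lambda>Q. fibred_region (\<lambda>_. 0) real_of_int Q) (1 / 2)"
  proof (rule equidistributed_fibred_region[where C = 1])
    have "(\<lambda>Q. 1 / 2 + (1 / 2) / real Q) \<longlonglongrightarrow> 1 / 2 + 0"
      by (intro tendsto_intros)
    moreover have "\<forall>\<^sub>F Q in sequentially.
        1 / 2 + (1 / 2) / real Q = (\<Sum>y\<in>{1..int Q}. max 0 (real_of_int y - 0)) / (real Q)\<^sup>2"
      using eventually_ge_at_top[of 1]
    proof eventually_elim
      case (elim Q)
      have "(\<Sum>y\<in>{1..int Q}. max 0 (real_of_int y - 0)) = (\<Sum>y\<in>{1..Q}. real y)"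
        by (simp add: sum_int_interval_eq_nat)
      also have "\<dots> = real Q * (real Q + 1) / 2"
        using double_gauss_sum_from_Suc_0[of Q, where ?'a = real] by simp
      finally show ?case using elim by (simp add: field_simps power2_eq_square)
    qed
    ultimately show "(\<lambda>Q. (\<Sum>y\<in>{1..int Q}. max 0 (real_of_int y - 0)) / (real Q)\<^sup>2) \<longlonglongrightarrow> 1 / 2"
      by (simp add: tendsto_cong)
  qed auto
  moreover have "fibred_region (\<lambda>_. 0) real_of_int Q = {(a, q). 0 < a \<and> a \<le> q \<and> q \<le> int Q}" for Q
    by (auto simp: fibred_region_def)
  ultimately show "equidistributed (\<lambda>Q. {(a, q). 0 < a \<and> a \<le> q \<and> q \<le> int Q}) (1 / 2)" by simp
qed fact

section \<open>Close pairs of fractions as visible lattice points\<close>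

definition pronic_poly :: "int poly" where
  "pronic_poly = [:0, 1:] * [:1, 1:]"

lemma poly_pronic_poly: "poly pronic_poly a = a * (a + 1)"
  by (simp add: pronic_poly_def algebra_simps)

definition farey_pairs :: "nat \<Rightarrow> (int \<times> int) set" where
  "farey_pairs Q = {(a, q). 0 < a \<and> a \<le> q \<and> q \<le> int Q \<and> coprime a q \<and> coprime (a + 1) q}"

definition fraction_of :: "int \<times> int \<Rightarrow> real" where
  "fraction_of = (\<lambda>(a, q). of_int a / of_int q)"

lemma farey_pairs_eq_visible:
  "farey_pairs Q = {(a, q). 0 < a \<and> a \<le> q \<and> q \<le> int Q} \<inter> visible_from {(0, 0), (- 1, 0)}"
  by (auto simp: farey_pairs_def visible_from_def)

lemma finite_farey_pairs: "finite (farey_pairs Q)"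
  by (rule finite_subset[of _ "centred_box Q"]) (auto simp: farey_pairs_def centred_box_def)

lemma fraction_of_eq_iff:
  assumes "coprime a q" "coprime b s" "q > 0" "s > 0"
  shows "fraction_of (a, q) = fraction_of (b, s) \<longleftrightarrow> a = b \<and> q = s"
proof
  assume "fraction_of (a, q) = fraction_of (b, s)"
  then have "real_of_int (a * s) = real_of_int (b * q)"
    using assms by (simp add: fraction_of_def field_simps)
  then have eq: "a * s = b * q" by linarith
  then have "q dvd a * s" "s dvd b * q" by (metis dvd_triv_right)+
  then have "q dvd s" "s dvd q" using assms by (auto simp: coprime_dvd_mult_right_iff coprime_commute)
  then have "q = s" using assms by (simp add: zdvd_antisym_nonneg)
  then show "a = b \<and> q = s" using eq assms by simp
qed simp

lemma poly_farey_pronic_poly: "poly_farey pronic_poly Q = fraction_of ` farey_pairs Q"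
proof -
  have "gcd (poly pronic_poly a) q = 1 \<longleftrightarrow> coprime a q \<and> coprime (a + 1) q" for a q :: int
    by (simp only: poly_pronic_poly coprime_iff_gcd_eq_1[symmetric] coprime_mult_left_iff)
  then have "poly_farey pronic_poly Q
      = {fraction_of (int a, int q) | a q. (int a, int q) \<in> farey_pairs Q}"
    by (auto simp: poly_farey_def fraction_of_def farey_pairs_def Suc_le_eq)
  also have "\<dots> = fraction_of ` farey_pairs Q"
  proof (intro equalityI subsetI)
    fix \<gamma> assume "\<gamma> \<in> fraction_of ` farey_pairs Q"
    then obtain a q where aq: "\<gamma> = fraction_of (a, q)" "(a, q) \<in> farey_pairs Q" by auto
    then have "a \<ge> 0" "q \<ge> 0" by (auto simp: farey_pairs_def)
    then have "\<gamma> = fraction_of (int (nat a), int (nat q))" "(int (nat a), int (nat q)) \<in> farey_pairs Q"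
      using aq by simp_all
    then show "\<gamma> \<in> {fraction_of (int a, int q) | a q. (int a, int q) \<in> farey_pairs Q}" by blast
  qed auto
  finally show ?thesis .
qed

lemma card_fraction_of_farey_pairs: "card (fraction_of ` farey_pairs Q) = card (farey_pairs Q)"
  by (rule card_image) (auto simp: inj_on_def farey_pairs_def fraction_of_eq_iff)

definition close_pairs :: "real set \<Rightarrow> real \<Rightarrow> (real \<times> real) set" where
  "close_pairs F \<Lambda> = {(\<gamma>1, \<gamma>2). \<gamma>1 \<in> F \<and> \<gamma>2 \<in> F \<and> \<gamma>1 \<noteq> \<gamma>2 \<and>
     (\<exists>x\<in>{0<..<\<Lambda>}. \<exists>k::int. \<gamma>1 - \<gamma>2 = 1 / real (card F) * x + of_int k)}"

text \<open>Pairs \<open>a/q\<close>, \<open>b/y\<close> with \<open>0 < a/q - b/y < \<Lambda>/N\<close>, where only \<open>b/y\<close> is confined to \<open>(0, 1]\<close>.\<close>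

definition lifted_close_pairs :: "real \<Rightarrow> real \<Rightarrow> nat \<Rightarrow> (int \<times> int \<times> int \<times> int) set" where
  "lifted_close_pairs N \<Lambda> Q = {(a, q, b, y). (b, y) \<in> farey_pairs Q \<and>
     0 < q \<and> q \<le> int Q \<and> coprime a q \<and> coprime (a + 1) q \<and>
     0 < a * y - b * q \<and> of_int (a * y - b * q) * N < \<Lambda> * of_int (q * y)}"

definition positive_residue :: "int \<Rightarrow> int \<Rightarrow> int" where
  "positive_residue a q = (a - 1) mod q + 1"

lemma positive_residue_bounds:
  assumes "q > 0"
  shows "0 < positive_residue a q" "positive_residue a q \<le> q"
  using assms by (simp_all add: positive_residue_def add1_zle_eq add_nonneg_pos)

lemma positive_residue_eq: "positive_residue a q = a - q * ((a - 1) div q)"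
  using mult_div_mod_eq[of q "a - 1"] unfolding positive_residue_def by linarith

lemma cong_positive_residue: "[positive_residue a q = a] (mod q)"
  by (simp add: positive_residue_eq cong_iff_dvd_diff)

lemma coprime_positive_residue_add:
  "coprime (positive_residue a q + j) q \<longleftrightarrow> coprime (a + j) q"
proof -
  have "[positive_residue a q + j = a + j] (mod q)" by (intro cong_add cong_positive_residue cong_refl)
  then show ?thesis by (metis cong_imp_coprime cong_sym)
qed

lemma coprime_positive_residue: "coprime (positive_residue a q) q \<longleftrightarrow> coprime a q"
  using coprime_positive_residue_add[of a q 0] by simp

lemma zero_if_dvd_if_abs_less:
  fixes d m :: int
  shows "m dvd d \<Longrightarrow> \<bar>d\<bar> < m \<Longrightarrow> d = 0"
  using dvd_imp_le_int[of d m] by linarith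

lemma positive_residue_unique:
  assumes "[x = a] (mod q)" "0 < x" "x \<le> q"
  shows "positive_residue a q = x"
proof -
  have "[positive_residue a q = x] (mod q)"
    using cong_positive_residue cong_sym[OF assms(1)] by (rule cong_trans)
  then have "q dvd positive_residue a q - x" by (simp add: cong_iff_dvd_diff)
  then have "positive_residue a q - x = 0"
    using positive_residue_bounds[of q a] assms by (intro zero_if_dvd_if_abs_less) auto
  then show ?thesis by simp
qed

definition reduce_lifted_pair :: "int \<times> int \<times> int \<times> int \<Rightarrow> real \<times> real" where
  "reduce_lifted_pair = (\<lambda>(a, q, b, y). (fraction_of (positive_residue a q, q), fraction_of (b, y)))"

lemma inj_on_reduce_lifted_pair:
  assumes N: "0 < N" "\<Lambda> \<le> N"
  shows "inj_on reduce_lifted_pair (lifted_close_pairs N \<Lambda> Q)"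
proof (unfold inj_on_def reduce_lifted_pair_def,
    intro ballI impI, unfold split_paired_all prod.case prod.inject, elim conjE)
  fix a q b y a' q' b' y'
  assume v: "(a, q, b, y) \<in> lifted_close_pairs N \<Lambda> Q"
    and v': "(a', q', b', y') \<in> lifted_close_pairs N \<Lambda> Q"
    and eq: "fraction_of (positive_residue a q, q) = fraction_of (positive_residue a' q', q')"
      "fraction_of (b, y) = fraction_of (b', y')"
  have q: "q' = q" "positive_residue a' q = positive_residue a q" and b: "b' = b" "y' = y"
    using eq v v' by (auto simp: lifted_close_pairs_def farey_pairs_def fraction_of_eq_iff
      coprime_positive_residue)
  have pos: "0 < q" "0 < y" using v by (auto simp: lifted_close_pairs_def farey_pairs_def)
  have det: "0 < e * y - b * q \<and> e * y - b * q < q * y"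
      if "(e, q, b, y) \<in> lifted_close_pairs N \<Lambda> Q" for e
  proof -
    have "of_int (e * y - b * q) * N < \<Lambda> * of_int (q * y)" "0 < e * y - b * q"
      using that by (auto simp: lifted_close_pairs_def)
    moreover have "\<Lambda> * of_int (q * y) \<le> of_int (q * y) * N"
      using mult_right_mono[OF N(2), of "of_int (q * y)"] pos by (simp add: mult.commute)
    ultimately have "of_int (e * y - b * q) * N < of_int (q * y) * N" by linarith
    then have "real_of_int (e * y - b * q) < of_int (q * y)" using N(1) by simp
    then show ?thesis using \<open>0 < e * y - b * q\<close> by linarith
  qed
  have "(a, q, b, y) \<in> lifted_close_pairs N \<Lambda> Q" "(a', q, b, y) \<in> lifted_close_pairs N \<Lambda> Q"
    using v v' q b by simp_all
  from det[OF this(1)] det[OF this(2)] have "\<bar>(a - a') * y\<bar> < q * y"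
    unfolding left_diff_distrib by linarith
  then have "\<bar>a - a'\<bar> < q" using pos by (simp add: abs_mult)
  moreover have "[a = a'] (mod q)"
    using cong_positive_residue[of a q] cong_positive_residue[of a' q] q(2)
    by (metis cong_sym cong_trans)
  then have "q dvd a - a'" by (simp add: cong_iff_dvd_diff)
  ultimately have "a = a'" using zero_if_dvd_if_abs_less by fastforce
  then show "a = a' \<and> q = q' \<and> b = b' \<and> y = y'" using q b by simp
qed

lemma fraction_of_diff:
  assumes "q > 0" "y > 0"
  shows "fraction_of (a, q) - fraction_of (b, y) = of_int (a * y - b * q) / of_int (q * y)"
  using assms by (simp add: fraction_of_def field_simps)

lemma fraction_of_positive_residue:
  assumes "q > 0"
  shows "fraction_of (positive_residue a q, q) = fraction_of (a, q) - of_int ((a - 1) div q)"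
  using assms by (simp add: positive_residue_eq fraction_of_def field_simps)

lemma reduce_lifted_pair_in_close_pairs:
  fixes Q :: nat and \<Lambda> :: real
  defines "N \<equiv> real (card (farey_pairs Q))"
  assumes "\<Lambda> \<le> N" and lifted: "(a, q, b, y) \<in> lifted_close_pairs N \<Lambda> Q"
  shows "reduce_lifted_pair (a, q, b, y) \<in> close_pairs (fraction_of ` farey_pairs Q) \<Lambda>"
proof -
  let ?\<gamma> = "fraction_of (positive_residue a q, q)" and ?F = "fraction_of ` farey_pairs Q"
  define r m where "r = a * y - b * q" and "m = (a - 1) div q"
  have pos: "q > 0" "y > 0" and "0 < r" and r: "of_int r * N < \<Lambda> * of_int (q * y)"
    and b: "(b, y) \<in> farey_pairs Q"
    using lifted by (auto simp: lifted_close_pairs_def farey_pairs_def r_def)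
  have N: "N > 0" "real (card ?F) = N"
    using b finite_farey_pairs[of Q] by (auto simp: N_def card_fraction_of_farey_pairs card_gt_0_iff)
  have qy: "real_of_int (q * y) > 0" using pos by simp
  define x where "x = N * (of_int r / of_int (q * y))"
  have x: "0 < x" "x < \<Lambda>" using \<open>0 < r\<close> r qy N by (simp_all add: x_def field_simps)
  have diff: "?\<gamma> - fraction_of (b, y) = 1 / N * x + of_int (- m)"
    using fraction_of_diff[OF pos] N pos by (simp add: fraction_of_positive_residue x_def r_def m_def)
  have "?\<gamma> \<noteq> fraction_of (b, y)"
  proof
    assume "?\<gamma> = fraction_of (b, y)"
    then have "x / N = of_int m" using diff N by (simp add: field_simps)
    moreover have "0 < x / N" "x / N < 1" using x N \<open>\<Lambda> \<le> N\<close> by (simp_all add: divide_less_eq)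
    ultimately show False by simp
  qed
  moreover have "(positive_residue a q, q) \<in> farey_pairs Q"
    using lifted positive_residue_bounds[of q a]
    by (auto simp: lifted_close_pairs_def farey_pairs_def coprime_positive_residue
        coprime_positive_residue_add)
  ultimately show ?thesis
    unfolding reduce_lifted_pair_def close_pairs_def N(2)
    using x diff b by (auto intro!: bexI[of _ x] exI[of _ "- m"])
qed

lemma close_pair_lifts:
  fixes Q :: nat and \<Lambda> :: real
  defines "N \<equiv> real (card (farey_pairs Q))"
  assumes "v \<in> close_pairs (fraction_of ` farey_pairs Q) \<Lambda>"
  shows "v \<in> reduce_lifted_pair ` lifted_close_pairs N \<Lambda> Q"
proof -
  obtain a q b y x m where v: "v = (fraction_of (a, q), fraction_of (b, y))"
    and aq: "(a, q) \<in> farey_pairs Q" and b: "(b, y) \<in> farey_pairs Q" and x: "0 < x" "x < \<Lambda>"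
    and diff: "fraction_of (a, q) - fraction_of (b, y) = 1 / N * x + of_int m"
    using assms(2) unfolding close_pairs_def N_def card_fraction_of_farey_pairs by auto
  have N: "N > 0"
    using b finite_farey_pairs[of Q] by (auto simp: N_def card_gt_0_iff)
  define a' where "a' = a - q * m"
  have pos: "q > 0" "y > 0" using aq b by (auto simp: farey_pairs_def)
  then have qy: "real_of_int (q * y) > 0" by simp
  have "fraction_of (a', q) = fraction_of (a, q) - of_int m"
    using pos by (simp add: a'_def fraction_of_def field_simps)
  then have "of_int (a' * y - b * q) / of_int (q * y) = x / N"
    using diff fraction_of_diff[OF pos, of a' b] by simp
  then have r: "real_of_int (a' * y - b * q) = x / N * of_int (q * y)"
    using qy by (metis less_irrefl nonzero_divide_eq_eq)
  have "real_of_int (a' * y - b * q) > 0" unfolding r using x N qy by simp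
  then have "a' * y - b * q > 0" by linarith
  moreover have "of_int (a' * y - b * q) * N < \<Lambda> * of_int (q * y)"
    unfolding r using x N mult_strict_right_mono[OF x(2) qy] by simp
  moreover have "[a' + j = a + j] (mod q)" for j by (simp add: a'_def cong_iff_dvd_diff)
  then have "coprime (a' + j) q \<longleftrightarrow> coprime (a + j) q" for j by (metis cong_imp_coprime cong_sym)
  from this[of 0] this[of 1] have "coprime a' q" "coprime (a' + 1) q"
    using aq by (auto simp: farey_pairs_def)
  ultimately have "(a', q, b, y) \<in> lifted_close_pairs N \<Lambda> Q"
    using aq b pos by (auto simp: lifted_close_pairs_def farey_pairs_def)
  moreover have "positive_residue a' q = a"
    using aq by (intro positive_residue_unique) (auto simp: farey_pairs_def a'_def cong_iff_dvd_diff)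
  ultimately show ?thesis
    unfolding v reduce_lifted_pair_def by (force intro: image_eqI[of _ _ "(a', q, b, y)"])
qed

lemma card_close_pairs_eq_card_lifted_close_pairs:
  fixes Q :: nat and \<Lambda> :: real
  defines "N \<equiv> real (card (farey_pairs Q))"
  assumes "0 < \<Lambda>" "\<Lambda> \<le> N"
  shows "card (close_pairs (fraction_of ` farey_pairs Q) \<Lambda>) = card (lifted_close_pairs N \<Lambda> Q)"
proof -
  have "reduce_lifted_pair ` lifted_close_pairs N \<Lambda> Q = close_pairs (fraction_of ` farey_pairs Q) \<Lambda>"
    using reduce_lifted_pair_in_close_pairs[of \<Lambda> Q] close_pair_lifts[of _ Q \<Lambda>] assms(3)
    unfolding N_def by auto
  then show ?thesis using card_image[OF inj_on_reduce_lifted_pair[of N \<Lambda> Q]] assms by simp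
qed

lemma coprime_unimodular_iff:
  fixes a b :: int
  assumes "s * v - t * u = 1"
  shows "coprime (s * a + t * b) (u * a + v * b) \<longleftrightarrow> coprime a b"
proof -
  have combination: "coprime a b" if "coprime (s * a + t * b) (u * a + v * b)" for a b s t u v :: int
    using that by (intro coprimeI) (meson coprime_common_divisor dvd_add dvd_mult)
  have "v * (s * a + t * b) + (- t) * (u * a + v * b) = a * (s * v - t * u)"
    "(- u) * (s * a + t * b) + s * (u * a + v * b) = b * (s * v - t * u)"
    by (simp_all add: algebra_simps)
  then show ?thesis
    using combination[of s a t b u v] combination[of v "s * a + t * b" "- t" "u * a + v * b" "- u" s]
      assms by auto
qed

lemma coprime_if_det_1:
  fixes c y b x :: int
  assumes "c * y - b * x = 1"
  shows "coprime x y" "coprime b y"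
proof -
  have "d dvd 1" if "d dvd y" "d dvd x \<or> d dvd b" for d
    using that assms by (metis dvd_diff dvd_mult dvd_mult2)
  then show "coprime x y" "coprime b y" by (metis coprimeI)+
qed

lemma bezout_completion_exists:
  fixes x y :: int
  assumes "coprime x y" "y > 0"
  shows "\<exists>c b. c * y - b * x = 1 \<and> 0 < b \<and> b \<le> y"
proof -
  obtain s t where st: "s * x + t * y = 1"
    using assms bezout_int[of x y] by (auto simp: coprime_iff_gcd_eq_1)
  define b where "b = positive_residue (- s) y"
  define c where "c = t - ((- s - 1) div y) * x"
  have "c * y - b * x = 1"
    using st by (simp add: b_def c_def positive_residue_eq algebra_simps)
  then show ?thesis using positive_residue_bounds[OF assms(2)] b_def by blast
qed

lemma bezout_completion_unique:
  fixes x y :: int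
  assumes "c * y - b * x = 1" "0 < b" "b \<le> y" and "c' * y - b' * x = 1" "0 < b'" "b' \<le> y"
  shows "c = c' \<and> b = b'"
proof -
  have "(c - c') * y = (b - b') * x" using assms by (simp add: algebra_simps)
  then have "y dvd (b - b') * x" by (metis dvd_triv_right)
  then have "y dvd b - b'"
    using coprime_if_det_1(1)[OF assms(1)] by (simp add: coprime_dvd_mult_left_iff coprime_commute)
  then have "b - b' = 0" using assms by (intro zero_if_dvd_if_abs_less) auto
  then have "b = b'" by simp
  then have "c * y = c' * y" using assms(1,4) by (metis diff_add_cancel)
  then show ?thesis using \<open>b = b'\<close> assms by simp
qed

lemma unimodular_decomposition_exists:
  fixes a q b y r :: int
  assumes "coprime b y" "a * y - b * q = r" "r > 0"
  shows "\<exists>k x c. 0 \<le> k \<and> k < r \<and> c * y - b * x = 1 \<and> a = r * c + k * b \<and> q = r * x + k * y"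
proof -
  obtain s t where st: "s * y + t * b = 1"
    using assms(1) bezout_int[of y b] by (auto simp: coprime_iff_gcd_eq_1 gcd.commute)
  define k0 where "k0 = q * s + a * t"
  define k x c where "k = k0 mod r" and "x = - t + (k0 div r) * y" and "c = s + (k0 div r) * b"
  have k0: "k0 = k + r * (k0 div r)" by (simp add: k_def)
  have "c * y - b * x = 1" using st by (simp add: x_def c_def algebra_simps)
  moreover have "r * x + k * y = q * (s * y + t * b)"
  proof -
    have "r * x + k * y = (k + r * (k0 div r)) * y - r * t" by (simp add: x_def algebra_simps)
    then show ?thesis unfolding k0[symmetric] by (simp add: k0_def algebra_simps flip: assms(2))
  qed
  moreover have "r * c + k * b = a * (s * y + t * b)"
  proof -
    have "r * c + k * b = (k + r * (k0 div r)) * b + r * s" by (simp add: c_def algebra_simps)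
    then show ?thesis unfolding k0[symmetric] by (simp add: k0_def algebra_simps flip: assms(2))
  qed
  moreover have "0 \<le> k" "k < r" using assms(3) by (auto simp: k_def)
  ultimately show ?thesis unfolding st mult_1_right by metis
qed

lemma unimodular_decomposition_unique:
  fixes r k x y c b :: int
  assumes "0 \<le> k" "k < r" "0 \<le> k'" "k' < r" "y > 0" "c * y - b * x = 1" "c' * y - b * x' = 1"
    and q: "r * x + k * y = r * x' + k' * y"
  shows "k = k' \<and> x = x' \<and> c = c'"
proof -
  have "(c - c') * y = b * (x - x')" using assms by (simp add: algebra_simps)
  then have "y dvd b * (x - x')" by (metis dvd_triv_right)
  then have "y dvd x - x'"
    using coprime_if_det_1(2)[OF assms(6)] by (simp add: coprime_dvd_mult_right_iff coprime_commute)
  then obtain j where j: "x = x' + y * j" by (metis add.commute diff_add_cancel dvdE)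
  have "(r * j + k) * y = k' * y" using q by (simp add: j algebra_simps)
  then have shift: "k' - k = r * j" using assms(5) by simp
  then have "k' - k = 0" using assms by (intro zero_if_dvd_if_abs_less[of r]) auto
  then have "k = k'" "x = x'" using shift j assms by auto
  then have "c * y = c' * y" using assms(6,7) by (metis diff_add_cancel)
  then show ?thesis using \<open>k = k'\<close> \<open>x = x'\<close> assms(5) by simp
qed

definition reduced_residues :: "int \<Rightarrow> int set" where
  "reduced_residues r = {k. 0 \<le> k \<and> k < r \<and> coprime k r}"

abbreviation viewpoints :: "int \<Rightarrow> int \<Rightarrow> (int \<times> int) set" where
  "viewpoints r k \<equiv> {(0, 0), (1, 0), (k, - r)}"

definition lattice_tuples :: "real \<Rightarrow> real \<Rightarrow> nat \<Rightarrow> (int \<times> int \<times> int \<times> int) set" where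
  "lattice_tuples N \<Lambda> Q = (SIGMA r:{0<..}. SIGMA k:reduced_residues r.
     hyperbola_region r k (of_int r * N / \<Lambda>) Q \<inter> visible_from (viewpoints r k))"

definition bezout_tuples :: "real \<Rightarrow> real \<Rightarrow> nat \<Rightarrow> (int \<times> int \<times> int \<times> int \<times> int \<times> int) set" where
  "bezout_tuples N \<Lambda> Q = {(r, k, x, y, c, b). (r, k, x, y) \<in> lattice_tuples N \<Lambda> Q \<and>
     c * y - b * x = 1 \<and> 0 < b \<and> b \<le> y}"

definition bezout_combination :: "int \<times> int \<times> int \<times> int \<times> int \<times> int \<Rightarrow> int \<times> int \<times> int \<times> int" where
  "bezout_combination = (\<lambda>(r, k, x, y, c, b). (r * c + k * b, r * x + k * y, b, y))"

lemma coprime_add_1_iff_if_det_1: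
  fixes c y b x :: int
  assumes "c * y - b * x = 1"
  shows "coprime (b + 1) y \<longleftrightarrow> coprime (x - 1) y"
proof -
  have "b + 1 = - b * (x - 1) + c * y" using assms by (simp add: algebra_simps)
  then have "[b + 1 = - b * (x - 1)] (mod y)" by (simp add: cong_iff_dvd_diff)
  then have "coprime (b + 1) y \<longleftrightarrow> coprime (- b * (x - 1)) y" by (metis cong_imp_coprime cong_sym)
  then show ?thesis using coprime_if_det_1(2)[OF assms] by simp
qed

lemma lifted_close_pairs_iff_lattice_tuples:
  fixes r k x y c b :: int
  assumes det: "c * y - b * x = 1" and b: "0 < b" "b \<le> y" and k: "0 \<le> k" "k < r" and N: "N > 0" "\<Lambda> > 0"
  shows "bezout_combination (r, k, x, y, c, b) \<in> lifted_close_pairs N \<Lambda> Q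
      \<longleftrightarrow> (r, k, x, y) \<in> lattice_tuples N \<Lambda> Q"
proof -
  let ?a = "r * c + k * b" and ?q = "r * x + k * y"
  have "?a * y - b * ?q = r * (c * y - b * x)" by (simp add: algebra_simps)
  then have r: "?a * y - b * ?q = r" using det by simp
  have aq: "coprime ?a ?q \<longleftrightarrow> coprime k r"
    using coprime_unimodular_iff[of c y b x r k] det by (simp add: mult.commute coprime_commute)
  have "?a + 1 = - b * (x - k) + c * (y + r)" "?q = - y * (x - k) + x * (y + r)"
    using det by (simp_all add: algebra_simps)
  then have a1q: "coprime (?a + 1) ?q \<longleftrightarrow> coprime (x - k) (y + r)"
    using coprime_unimodular_iff[of "- b" x c "- y" "x - k" "y + r"] det by (simp add: mult.commute)
  have height: "of_int r * N < \<Lambda> * of_int (?q * y) \<longleftrightarrow> of_int r * N / \<Lambda> < of_int (?q * y)"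
    using N by (simp only: divide_less_eq mult.commute) simp
  have q: "0 < ?q" if "of_int r * N / \<Lambda> < of_int (?q * y)"
  proof -
    have "0 < of_int r * N / \<Lambda>" using k N by simp
    then have "0 < real_of_int (?q * y)" using that by linarith
    then show ?thesis using b by (simp only: of_int_0_less_iff zero_less_mult_iff) auto
  qed
  show ?thesis
    unfolding bezout_combination_def lifted_close_pairs_def lattice_tuples_def farey_pairs_def
      hyperbola_region_def reduced_residues_def visible_from_def
      mem_Collect_eq prod.case mem_Sigma_iff Int_iff r aq a1q height
      coprime_add_1_iff_if_det_1[OF det]
    using q b k coprime_if_det_1[OF det] by auto
qed

lemma card_bezout_tuples_eq_card_lattice_tuples:
  "card (bezout_tuples N \<Lambda> Q) = card (lattice_tuples N \<Lambda> Q)"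
proof (rule bij_betw_same_card, rule bij_betw_imageI)
  let ?\<pi> = "\<lambda>(r, k, x, y, c, b). (r, k, x, y)"
  show "inj_on ?\<pi> (bezout_tuples N \<Lambda> Q)"
    by (clarsimp simp: inj_on_def bezout_tuples_def) (rule bezout_completion_unique)
  show "?\<pi> ` bezout_tuples N \<Lambda> Q = lattice_tuples N \<Lambda> Q"
  proof (intro equalityI subsetI)
    fix v assume "v \<in> lattice_tuples N \<Lambda> Q"
    moreover obtain r k x y where v: "v = (r, k, x, y)" by (metis prod.exhaust)
    ultimately have "coprime x y" "y > 0"
      by (auto simp: lattice_tuples_def hyperbola_region_def visible_from_def)
    then obtain c b where "c * y - b * x = 1" "0 < b" "b \<le> y" using bezout_completion_exists by blast
    then have "(r, k, x, y, c, b) \<in> bezout_tuples N \<Lambda> Q"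
      using \<open>v \<in> _\<close> v by (simp add: bezout_tuples_def)
    then show "v \<in> ?\<pi> ` bezout_tuples N \<Lambda> Q" unfolding v by force
  qed (auto simp: bezout_tuples_def)
qed

lemma residue_bounds_lattice_tuples: "(r, k, x, y) \<in> lattice_tuples N \<Lambda> Q \<Longrightarrow> 0 \<le> k \<and> k < r"
  by (auto simp: lattice_tuples_def reduced_residues_def)

lemma inj_on_bezout_combination: "inj_on bezout_combination (bezout_tuples N \<Lambda> Q)"
proof (unfold inj_on_def bezout_combination_def,
    intro ballI impI, unfold split_paired_all prod.case prod.inject, elim conjE)
  fix r k x y c b r' k' x' y' c' b'
  assume v: "(r, k, x, y, c, b) \<in> bezout_tuples N \<Lambda> Q"
    and v': "(r', k', x', y', c', b') \<in> bezout_tuples N \<Lambda> Q"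
    and a: "r * c + k * b = r' * c' + k' * b'" and q: "r * x + k * y = r' * x' + k' * y'"
    and b: "b = b'" "y = y'"
  have det: "c * y - b * x = 1" "c' * y - b * x' = 1" "y > 0"
    using v v' b by (auto simp: bezout_tuples_def)
  have "r * (c * y - b * x) = r' * (c' * y - b * x')"
    using arg_cong[OF a, of "\<lambda>t. t * y"] arg_cong[OF q, of "\<lambda>t. b * t"] b by (simp add: algebra_simps)
  then have "r = r'" using det by simp
  moreover have "k = k' \<and> x = x' \<and> c = c'"
    using residue_bounds_lattice_tuples v v' det q b \<open>r = r'\<close>
    by (intro unimodular_decomposition_unique[of k r k' y]) (auto simp: bezout_tuples_def)
  ultimately show "r = r' \<and> k = k' \<and> x = x' \<and> y = y' \<and> c = c' \<and> b = b'" using b by simp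
qed

lemma image_bezout_combination:
  assumes N: "N > 0" "\<Lambda> > 0"
  shows "bezout_combination ` bezout_tuples N \<Lambda> Q = lifted_close_pairs N \<Lambda> Q"
proof (intro equalityI subsetI)
  fix v assume "v \<in> bezout_combination ` bezout_tuples N \<Lambda> Q"
  then show "v \<in> lifted_close_pairs N \<Lambda> Q"
    using residue_bounds_lattice_tuples N
    by (auto simp: bezout_tuples_def lifted_close_pairs_iff_lattice_tuples)
next
  fix v assume v: "v \<in> lifted_close_pairs N \<Lambda> Q"
  obtain a q b y where aq: "v = (a, q, b, y)" by (metis prod.exhaust)
  define r where "r = a * y - b * q"
  have b: "coprime b y" "0 < b" "b \<le> y" "0 < r"
    using v by (auto simp: aq lifted_close_pairs_def farey_pairs_def r_def)
  obtain k x c where kxc: "0 \<le> k" "k < r" "c * y - b * x = 1" "a = r * c + k * b" "q = r * x + k * y"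
    using unimodular_decomposition_exists[OF b(1) r_def[symmetric] b(4)] by blast
  then have combination: "v = bezout_combination (r, k, x, y, c, b)"
    by (simp add: bezout_combination_def aq)
  then have "(r, k, x, y) \<in> lattice_tuples N \<Lambda> Q"
    using lifted_close_pairs_iff_lattice_tuples[OF kxc(3) b(2,3) kxc(1,2) N] v by simp
  then have "(r, k, x, y, c, b) \<in> bezout_tuples N \<Lambda> Q" using kxc b by (simp add: bezout_tuples_def)
  then show "v \<in> bezout_combination ` bezout_tuples N \<Lambda> Q" using combination by (rule rev_image_eqI)
qed

lemma card_lattice_tuples:
  assumes N: "N > 0" "\<Lambda> > 0" and R: "\<Lambda> * (real Q)\<^sup>2 \<le> real R * N"
  shows "card (lattice_tuples N \<Lambda> Q) = (\<Sum>r\<in>{1..R}. \<Sum>k\<in>reduced_residues (int r).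
    card (hyperbola_region (int r) k (real r * N / \<Lambda>) Q \<inter> visible_from (viewpoints (int r) k)))"
proof -
  let ?V = "\<lambda>r k. hyperbola_region r k (of_int r * N / \<Lambda>) Q \<inter> visible_from (viewpoints r k)"
  have empty: "r \<le> int R" if "(x, y) \<in> ?V r k" for r k x y
  proof -
    have y: "1 \<le> y" "y \<le> int Q" "r * x + k * y \<le> int Q"
        "of_int r * N / \<Lambda> < of_int ((r * x + k * y) * y)"
      using that by (auto simp: hyperbola_region_def)
    have "(r * x + k * y) * y \<le> int Q * int Q" using y by (intro mult_mono) auto
    then have "real_of_int ((r * x + k * y) * y) \<le> real_of_int (int Q * int Q)"
      by (simp only: of_int_le_iff)
    then have "of_int r * N / \<Lambda> < (real Q)\<^sup>2" using y(4) by (simp add: power2_eq_square)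
    then have "of_int r * N < \<Lambda> * (real Q)\<^sup>2" using N by (simp add: divide_less_eq mult.commute)
    then have "of_int r * N < real R * N" using R by linarith
    then show ?thesis using N(1) by simp
  qed
  have finite_residues: "finite (reduced_residues r)" for r
    by (rule finite_subset[of _ "{0..<r}"]) (auto simp: reduced_residues_def)
  have finite_region: "finite (?V r k)" if "k \<in> reduced_residues r" for r k
    using that N hyperbola_region_subset_centred_box[of k r "of_int r * N / \<Lambda>" Q]
    by (intro finite_Int disjI1)
       (auto simp: reduced_residues_def intro!: finite_subset[OF _ finite_centred_box])
  have "lattice_tuples N \<Lambda> Q = (SIGMA r:{1..int R}. SIGMA k:reduced_residues r. ?V r k)"
    using empty by (auto simp: lattice_tuples_def)
  then have "card (lattice_tuples N \<Lambda> Q) = (\<Sum>r\<in>{1..int R}. \<Sum>k\<in>reduced_residues r. card (?V r k))"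
    using finite_residues finite_region by (simp add: card_SigmaI)
  then show ?thesis by (simp add: sum_int_interval_eq_nat)
qed

lemma card_close_pairs:
  fixes Q :: nat and \<Lambda> :: real
  defines "N \<equiv> real (card (farey_pairs Q))"
  assumes "0 < \<Lambda>" "\<Lambda> \<le> N" "\<Lambda> * (real Q)\<^sup>2 \<le> real R * N"
  shows "card (close_pairs (fraction_of ` farey_pairs Q) \<Lambda>) = (\<Sum>r\<in>{1..R}. \<Sum>k\<in>reduced_residues (int r).
    card (hyperbola_region (int r) k (real r * N / \<Lambda>) Q \<inter> visible_from (viewpoints (int r) k)))"
proof -
  have N: "N > 0" using assms by linarith
  have "card (close_pairs (fraction_of ` farey_pairs Q) \<Lambda>) = card (lifted_close_pairs N \<Lambda> Q)"
    unfolding N_def using assms(2,3)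
    by (intro card_close_pairs_eq_card_lifted_close_pairs) (simp_all add: N_def)
  also have "\<dots> = card (bezout_tuples N \<Lambda> Q)"
    using card_image[OF inj_on_bezout_combination] by (metis image_bezout_combination[OF N assms(2)])
  also have "\<dots> = card (lattice_tuples N \<Lambda> Q)" by (rule card_bezout_tuples_eq_card_lattice_tuples)
  finally show ?thesis using card_lattice_tuples[OF N assms(2,4)] by simp
qed

section \<open>Euler factors of the coefficients\<close>

lemma prime_factorization_prod_primes:
  assumes "finite X" "\<And>p. p \<in> X \<Longrightarrow> prime (p::nat)"
  shows "prime_factorization (\<Prod>X) = mset_set X"
  unfolding prod_unfold_prod_mset image_mset.identity id_apply
  using assms by (intro prime_factorization_prod_mset_primes) simp

lemma prime_factors_prod_primes:
  assumes "finite X" "\<And>p. p \<in> X \<Longrightarrow> prime (p::nat)"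
  shows "prime_factors (\<Prod>X) = X"
  using assms by (simp add: prime_factorization_prod_primes)

lemma prod_primes_nonzero:
  assumes "finite X" "\<And>p. p \<in> X \<Longrightarrow> prime (p::nat)"
  shows "\<Prod>X \<noteq> 0"
  using assms by (metis not_prime_0 prod_zero_iff)

lemma coprime_prod_primes_iff:
  assumes "finite X" "\<And>p. p \<in> X \<Longrightarrow> prime (p::nat)" "finite Y" "\<And>p. p \<in> Y \<Longrightarrow> prime p"
  shows "coprime (\<Prod>X) (\<Prod>Y) \<longleftrightarrow> X \<inter> Y = {}"
proof
  assume "coprime (\<Prod>X) (\<Prod>Y)"
  then have "\<not> (p \<in> X \<and> p \<in> Y)" for p
    using assms(1,3) assms(2)[of p] by (metis coprime_common_divisor dvd_prodI not_prime_unit)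
  then show "X \<inter> Y = {}" by auto
next
  assume "X \<inter> Y = {}"
  then show "coprime (\<Prod>X) (\<Prod>Y)"
    using assms(2,4) by (intro prod_coprime_left prod_coprime_right primes_coprime) auto
qed

lemma squarefree_prod_primes:
  assumes "\<And>p. p \<in> X \<Longrightarrow> prime (p::nat)"
  shows "squarefree (\<Prod>X)"
  using assms by (intro squarefree_prod_coprime primes_coprime squarefree_prime) auto

lemma moebius_prod_primes:
  assumes "finite X" "\<And>p. p \<in> X \<Longrightarrow> prime (p::nat)"
  shows "moebius (\<Prod>X) = (-1) ^ card X"
  unfolding moebius_def using assms by (simp add: prime_factors_prod_primes squarefree_prod_primes)

lemma totient_prod_primes:
  assumes "\<And>p. p \<in> X \<Longrightarrow> prime (p::nat)"
  shows "real (totient (\<Prod>X)) = (\<Prod>p\<in>X. real p - 1)"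
proof -
  have "totient (\<Prod>X) = (\<Prod>p\<in>X. totient p)"
    using assms by (intro totient_prod_coprime) (auto intro!: pairwiseI primes_coprime)
  also have "real \<dots> = (\<Prod>p\<in>X. real p - 1)"
    unfolding of_nat_prod using assms
    by (intro prod.cong refl) (simp add: totient_prime of_nat_diff prime_ge_Suc_0_nat)
  finally show ?thesis .
qed

lemma prod_Collect_mult_prod_Collect_not:
  fixes f :: "'a \<Rightarrow> 'b::comm_monoid_mult"
  assumes "finite X"
  shows "(\<Prod>x | x \<in> X \<and> P x. f x) * (\<Prod>x | x \<in> X \<and> \<not> P x. f x) = (\<Prod>x\<in>X. f x)"
proof -
  have "(\<Prod>x | x \<in> X \<and> P x. f x) * (\<Prod>x | x \<in> X \<and> \<not> P x. f x)
      = (\<Prod>x\<in>{x. x \<in> X \<and> P x} \<union> {x. x \<in> X \<and> \<not> P x}. f x)"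
    using assms by (intro prod.union_disjoint[symmetric]) auto
  also have "{x. x \<in> X \<and> P x} \<union> {x. x \<in> X \<and> \<not> P x} = X" by auto
  finally show ?thesis .
qed

lemma prod_primes_dvd:
  assumes "finite X" "\<And>p. p \<in> X \<Longrightarrow> prime (p::nat)" "\<And>p. p \<in> X \<Longrightarrow> p dvd a"
  shows "\<Prod>X dvd a"
  using assms
proof (induction X rule: finite_induct)
  case (insert q X)
  have "coprime q (\<Prod>X)" using insert by (intro prod_coprime_right primes_coprime) auto
  then show ?case using insert by (simp add: divides_mult)
qed simp

lemma gcd_prod_primes:
  assumes "finite X" "\<And>p. p \<in> X \<Longrightarrow> prime (p::nat)"
  shows "gcd a (\<Prod>X) = \<Prod>{p\<in>X. p dvd a}"
proof (rule dvd_antisym)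
  have split: "\<Prod>X = \<Prod>{p\<in>X. p dvd a} * \<Prod>{p\<in>X. \<not> p dvd a}"
    using prod_Collect_mult_prod_Collect_not[OF assms(1)] by metis
  have "\<Prod>{p\<in>X. p dvd a} dvd a"
    using assms by (intro prod_primes_dvd) auto
  then show "\<Prod>{p\<in>X. p dvd a} dvd gcd a (\<Prod>X)" using split by simp
  have "coprime a (\<Prod>{p\<in>X. \<not> p dvd a})"
    using assms prime_imp_coprime[of _ a] by (intro prod_coprime_right) (auto simp: coprime_commute)
  then have "coprime (gcd a (\<Prod>X)) (\<Prod>{p\<in>X. \<not> p dvd a})"
    by (meson coprime_divisors dvd_refl gcd_dvd1)
  moreover have "gcd a (\<Prod>X) dvd \<Prod>{p\<in>X. p dvd a} * \<Prod>{p\<in>X. \<not> p dvd a}"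
    by (subst split[symmetric]) simp
  ultimately show "gcd a (\<Prod>X) dvd \<Prod>{p\<in>X. p dvd a}"
    by (simp add: coprime_dvd_mult_left_iff)
qed

lemma prod_primes_div:
  assumes "finite X" "\<And>p. p \<in> X \<Longrightarrow> prime (p::nat)"
  shows "\<Prod>X div \<Prod>{p\<in>X. P p} = \<Prod>{p\<in>X. \<not> P p}"
proof -
  have "\<Prod>{p\<in>X. P p} \<noteq> 0" using assms by (intro prod_primes_nonzero) auto
  then show ?thesis
    using prod_Collect_mult_prod_Collect_not[OF assms(1), where P = P and f = "\<lambda>p. p"]
    by (metis nonzero_mult_div_cancel_left)
qed

lemma iterated_gcd_prod_primes:
  assumes "finite X" "\<And>p. p \<in> X \<Longrightarrow> prime (p::nat)"
  shows "gcd e (\<Prod>X) * gcd \<delta> (\<Prod>X div gcd e (\<Prod>X)) = \<Prod>{p\<in>X. p dvd e * \<delta>}"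
proof -
  let ?E = "{p\<in>X. \<not> p dvd e}"
  have "gcd e (\<Prod>X) * gcd \<delta> (\<Prod>X div gcd e (\<Prod>X)) = \<Prod>{p\<in>X. p dvd e} * gcd \<delta> (\<Prod>?E)"
    by (simp only: gcd_prod_primes[OF assms] prod_primes_div[OF assms])
  also have "gcd \<delta> (\<Prod>?E) = \<Prod>{p\<in>?E. p dvd \<delta>}"
    using assms by (intro gcd_prod_primes) auto
  also have "\<Prod>{p\<in>X. p dvd e} * \<Prod>{p\<in>?E. p dvd \<delta>} = \<Prod>({p\<in>X. p dvd e} \<union> {p\<in>?E. p dvd \<delta>})"
    using assms by (intro prod.union_disjoint[symmetric]) auto
  also have "{p\<in>X. p dvd e} \<union> {p\<in>?E. p dvd \<delta>} = {p\<in>X. p dvd e * \<delta>}"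
    using assms by (auto simp: prime_dvd_mult_iff)
  finally show ?thesis .
qed

definition factorizations4 :: "nat \<Rightarrow> (nat \<times> nat \<times> nat \<times> nat) set" where
  "factorizations4 m = {(n, \<delta>, d1, d3). n \<ge> 1 \<and> \<delta> \<ge> 1 \<and> d1 \<ge> 1 \<and> d3 \<ge> 1 \<and> n * \<delta> * d1 * d3 = m}"

lemma finite_factorizations4: "finite (factorizations4 m)"
proof (rule finite_subset)
  show "factorizations4 m \<subseteq> {..m} \<times> {..m} \<times> {..m} \<times> {..m}"
    by (auto simp: factorizations4_def intro!: dvd_imp_le)
qed simp

definition h_weight :: "nat \<Rightarrow> nat \<Rightarrow> nat \<Rightarrow> nat \<Rightarrow> nat \<Rightarrow> real" where
  "h_weight d2 d4 \<delta> d1 d3 =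
     (let d = gcd d1 d2; D = gcd d3 d4; G1 = gcd \<delta> (d2 div d); G2 = gcd \<delta> (d4 div D)
      in if gcd (d2 div (d * G1)) (d4 div (D * G2)) = 1
         then real (d * D * G1 * G2) *
           (\<Prod>p \<in> prime_factors ((d2 * d4) div (d * D * G1 * G2)). inverse (1 + 1 / real p))
         else 0)"

lemma h_fun_eq_sum_h_weight:
  "h_fun d2 d4 m = (\<Sum>(n, \<delta>, d1, d3)\<in>factorizations4 m.
     real n * of_int (moebius d1) * of_int (moebius d3) * h_weight d2 d4 \<delta> d1 d3)"
proof -
  let ?c = "\<lambda>(n::nat, \<delta>, d1, d3). let d = gcd d1 d2; D = gcd d3 d4;
    G1 = gcd \<delta> (d2 div d); G2 = gcd \<delta> (d4 div D) in gcd (d2 div (d * G1)) (d4 div (D * G2)) = 1"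
  have "{(n, \<delta>, d1, d3). n \<ge> 1 \<and> \<delta> \<ge> 1 \<and> d1 \<ge> 1 \<and> d3 \<ge> 1 \<and> n * \<delta> * d1 * d3 = m \<and> ?c (n, \<delta>, d1, d3)}
     = {v \<in> factorizations4 m. ?c v}"
    by (auto simp: factorizations4_def)
  then show ?thesis
    unfolding h_fun_def prod.case
    by (simp only: sum.inter_filter[OF finite_factorizations4])
       (rule sum.cong; simp add: h_weight_def Let_def mult.assoc split: prod.split)
qed

lemma h_weight_prod_primes:
  fixes X Y :: "nat set" and \<delta> d1 d3 :: nat
  assumes X: "finite X" "\<And>p. p \<in> X \<Longrightarrow> prime p" and Y: "finite Y" "\<And>p. p \<in> Y \<Longrightarrow> prime p"
  defines "X0 \<equiv> {p\<in>X. \<not> p dvd d1 * \<delta>}" and "Y0 \<equiv> {p\<in>Y. \<not> p dvd d3 * \<delta>}"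
  shows "h_weight (\<Prod>X) (\<Prod>Y) \<delta> d1 d3 = (if X0 \<inter> Y0 = {} then
    (real (\<Prod>{p\<in>X. p dvd d1 * \<delta>}) * (\<Prod>p\<in>X0. inverse (1 + 1 / real p))) *
    (real (\<Prod>{p\<in>Y. p dvd d3 * \<delta>}) * (\<Prod>p\<in>Y0. inverse (1 + 1 / real p))) else 0)"
proof -
  let ?d = "gcd d1 (\<Prod>X)" and ?D = "gcd d3 (\<Prod>Y)"
  let ?G1 = "gcd \<delta> (\<Prod>X div ?d)" and ?G2 = "gcd \<delta> (\<Prod>Y div ?D)"
  let ?X1 = "{p\<in>X. p dvd d1 * \<delta>}" and ?Y1 = "{p\<in>Y. p dvd d3 * \<delta>}"
  have gcds: "?d * ?G1 = \<Prod>?X1" "?D * ?G2 = \<Prod>?Y1"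
    using X Y by (intro iterated_gcd_prod_primes; blast)+
  have all_gcds: "?d * ?D * ?G1 * ?G2 = \<Prod>?X1 * \<Prod>?Y1"
    unfolding gcds[symmetric] by (simp only: mult_ac)
  have quotients: "\<Prod>X div \<Prod>?X1 = \<Prod>X0" "\<Prod>Y div \<Prod>?Y1 = \<Prod>Y0"
    unfolding X0_def Y0_def by (rule prod_primes_div; use X Y in blast)+
  have primes: "finite X0" "\<And>p. p \<in> X0 \<Longrightarrow> prime p" "finite Y0" "\<And>p. p \<in> Y0 \<Longrightarrow> prime p"
    using X Y by (auto simp: X0_def Y0_def)
  have nonzero: "\<Prod>?X1 * \<Prod>?Y1 \<noteq> 0" "\<Prod>X0 \<noteq> 0" "\<Prod>Y0 \<noteq> 0"
    using X Y primes prod_primes_nonzero[of ?X1] prod_primes_nonzero[of ?Y1]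
      prod_primes_nonzero[of X0] prod_primes_nonzero[of Y0]
    by auto
  have "\<Prod>X * \<Prod>Y = (\<Prod>X0 * \<Prod>Y0) * (\<Prod>?X1 * \<Prod>?Y1)"
    unfolding X0_def Y0_def
      prod_Collect_mult_prod_Collect_not[OF X(1), where P = "\<lambda>p. p dvd d1 * \<delta>", symmetric]
      prod_Collect_mult_prod_Collect_not[OF Y(1), where P = "\<lambda>p. p dvd d3 * \<delta>", symmetric]
    by (simp only: mult_ac)
  then have quotient: "(\<Prod>X * \<Prod>Y) div (\<Prod>?X1 * \<Prod>?Y1) = \<Prod>X0 * \<Prod>Y0" using nonzero(1) by simp
  have factors: "prime_factors (\<Prod>X0 * \<Prod>Y0) = X0 \<union> Y0"
    using nonzero primes by (simp add: prime_factors_product prime_factors_prod_primes)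
  have "gcd (\<Prod>X0) (\<Prod>Y0) = 1 \<longleftrightarrow> X0 \<inter> Y0 = {}"
    unfolding coprime_iff_gcd_eq_1[symmetric] by (rule coprime_prod_primes_iff[OF primes])
  then have "h_weight (\<Prod>X) (\<Prod>Y) \<delta> d1 d3 = (if X0 \<inter> Y0 = {} then
      real (\<Prod>?X1 * \<Prod>?Y1) * (\<Prod>p\<in>X0 \<union> Y0. inverse (1 + 1 / real p)) else 0)"
    unfolding h_weight_def Let_def all_gcds unfolding gcds quotients quotient factors by simp
  then show ?thesis using primes by (simp add: prod.union_disjoint mult_ac)
qed

definition moebius_weight :: "nat \<Rightarrow> real" where
  "moebius_weight d = of_int (moebius d) / (real d * real (totient d))"

lemma moebius_weight_prod_primes:
  assumes "finite X" "\<And>p. p \<in> X \<Longrightarrow> prime p"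
  shows "moebius_weight (\<Prod>X) = (\<Prod>p\<in>X. - 1 / (real p * (real p - 1)))"
  by (simp only: moebius_weight_def moebius_prod_primes[OF assms] totient_prod_primes[OF assms(2)]
      prod_dividef prod.distrib prod_constant of_nat_prod of_int_power of_int_minus of_int_1)

text \<open>The booleans \<open>x\<close>, \<open>A\<close> say whether \<open>p\<close> divides \<open>d2\<close> and \<open>d1 \<delta>\<close>, or \<open>d4\<close> and \<open>d3 \<delta>\<close>.\<close>

definition half_euler_term :: "nat \<Rightarrow> bool \<Rightarrow> bool \<Rightarrow> real" where
  "half_euler_term p x A =
     (if x then (if A then real p else inverse (1 + 1 / real p)) * (- 1 / (real p * (real p - 1)))
      else 1)"

definition euler_term :: "nat \<Rightarrow> bool \<Rightarrow> bool \<Rightarrow> bool \<Rightarrow> bool \<Rightarrow> real" where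
  "euler_term p x y A B =
     half_euler_term p x A * half_euler_term p y B * of_bool (\<not> (x \<and> \<not> A \<and> y \<and> \<not> B))"

lemma prod_half_euler_term:
  assumes "finite S" "X \<subseteq> S"
  shows "(\<Prod>p\<in>S. half_euler_term p (p \<in> X) (p dvd a))
    = real (\<Prod>{p\<in>X. p dvd a}) * (\<Prod>p | p \<in> X \<and> \<not> p dvd a. inverse (1 + 1 / real p)) *
      (\<Prod>p\<in>X. - 1 / (real p * (real p - 1)))"
proof -
  let ?w = "\<lambda>p. if p dvd a then real p else inverse (1 + 1 / real p)"
  have "(\<Prod>p\<in>S. half_euler_term p (p \<in> X) (p dvd a)) = (\<Prod>p\<in>X. ?w p * (- 1 / (real p * (real p - 1))))"
    unfolding half_euler_term_def using assms by (intro prod.mono_neutral_cong_right) auto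
  also have "\<dots> = (\<Prod>p\<in>X. ?w p) * (\<Prod>p\<in>X. - 1 / (real p * (real p - 1)))"
    by (rule prod.distrib)
  also have "(\<Prod>p\<in>X. ?w p) = (\<Prod>p | p \<in> X \<and> p dvd a. ?w p) * (\<Prod>p | p \<in> X \<and> \<not> p dvd a. ?w p)"
    using finite_subset[OF assms(2,1)] by (rule prod_Collect_mult_prod_Collect_not[symmetric])
  finally show ?thesis by simp
qed

lemma prod_of_bool:
  "finite S \<Longrightarrow> (\<Prod>p\<in>S. of_bool (P p)) = (of_bool (\<forall>p\<in>S. P p) :: 'a::comm_semiring_1)"
  by (induction S rule: finite_induct) auto

lemma moebius_weight_h_weight_prod_primes:
  assumes S: "finite S" "\<And>p. p \<in> S \<Longrightarrow> prime p" and "X \<subseteq> S" "Y \<subseteq> S"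
  shows "moebius_weight (\<Prod>X) * moebius_weight (\<Prod>Y) * h_weight (\<Prod>X) (\<Prod>Y) \<delta> d1 d3
    = (\<Prod>p\<in>S. euler_term p (p \<in> X) (p \<in> Y) (p dvd d1 * \<delta>) (p dvd d3 * \<delta>))"
proof -
  let ?bad = "\<lambda>p. p \<in> X \<and> \<not> p dvd d1 * \<delta> \<and> p \<in> Y \<and> \<not> p dvd d3 * \<delta>"
  have X: "finite X" "\<And>p. p \<in> X \<Longrightarrow> prime p" and Y: "finite Y" "\<And>p. p \<in> Y \<Longrightarrow> prime p"
    using assms by (auto intro: finite_subset)
  have "(\<Prod>p\<in>S. of_bool (\<not> ?bad p)) = (of_bool (\<forall>p\<in>S. \<not> ?bad p) :: real)"
    using S(1) by (rule prod_of_bool)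
  also have "(\<forall>p\<in>S. \<not> ?bad p) \<longleftrightarrow> {p\<in>X. \<not> p dvd d1 * \<delta>} \<inter> {p\<in>Y. \<not> p dvd d3 * \<delta>} = {}"
    using \<open>X \<subseteq> S\<close> by auto
  finally have no_bad: "(\<Prod>p\<in>S. of_bool (\<not> ?bad p))
      = (of_bool ({p\<in>X. \<not> p dvd d1 * \<delta>} \<inter> {p\<in>Y. \<not> p dvd d3 * \<delta>} = {}) :: real)" .
  show ?thesis
    by (simp only: euler_term_def prod.distrib prod_half_euler_term[OF S(1) \<open>X \<subseteq> S\<close>]
        prod_half_euler_term[OF S(1) \<open>Y \<subseteq> S\<close>]
        moebius_weight_prod_primes[OF X] moebius_weight_prod_primes[OF Y]
        h_weight_prod_primes[OF X Y] no_bad) simp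
qed

lemma sum_Pow_prod_mem:
  fixes t :: "'a \<Rightarrow> bool \<Rightarrow> 'b::comm_semiring_1"
  assumes "finite S"
  shows "(\<Sum>X\<in>Pow S. \<Prod>p\<in>S. t p (p \<in> X)) = (\<Prod>p\<in>S. t p True + t p False)"
proof -
  have "(\<Prod>p\<in>S. t p (p \<in> X)) = (\<Prod>p\<in>X. t p True) * (\<Prod>p\<in>S - X. t p False)" if "X \<subseteq> S" for X
    using prod.subset_diff[OF that assms, of "\<lambda>p. t p (p \<in> X)"] by (simp add: mult.commute)
  then show ?thesis using assms by (simp add: prod_add)
qed

lemma sum_Pow_Pow_prod_mem:
  fixes t :: "'a \<Rightarrow> bool \<Rightarrow> bool \<Rightarrow> 'b::comm_semiring_1"
  assumes "finite S"
  shows "(\<Sum>X\<in>Pow S. \<Sum>Y\<in>Pow S. \<Prod>p\<in>S. t p (p \<in> X) (p \<in> Y))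
    = (\<Prod>p\<in>S. t p True True + t p True False + (t p False True + t p False False))"
  using sum_Pow_prod_mem[OF assms, of "\<lambda>p x. t p x True + t p x False"]
    sum_Pow_prod_mem[OF assms, of "\<lambda>p. t p (p \<in> X)" for X] by simp

definition compositions4 :: "nat \<Rightarrow> (nat \<times> nat \<times> nat \<times> nat) set" where
  "compositions4 v = {(a, b, e, f). a + b + e + f = v}"

lemma finite_compositions4: "finite (compositions4 v)"
  by (rule finite_subset[of _ "{..v} \<times> {..v} \<times> {..v} \<times> {..v}"]) (auto simp: compositions4_def)

definition exponents4 :: "nat \<Rightarrow> nat \<times> nat \<times> nat \<times> nat \<Rightarrow> nat \<times> nat \<times> nat \<times> nat" where
  "exponents4 p = (\<lambda>(n, \<delta>, d1, d3).
      (multiplicity p n, multiplicity p \<delta>, multiplicity p d1, multiplicity p d3))"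

lemma prod_prime_powers_eq:
  assumes "finite S" "(n::nat) \<noteq> 0" "prime_factors n \<subseteq> S" "\<And>p. p \<in> S \<Longrightarrow> prime p"
  shows "(\<Prod>p\<in>S. p ^ multiplicity p n) = n"
proof -
  have "(\<Prod>p\<in>S. p ^ multiplicity p n) = (\<Prod>p\<in>prime_factors n. p ^ multiplicity p n)"
    using assms by (intro prod.mono_neutral_right) (auto simp: prime_factors_multiplicity)
  also have "\<dots> = n" using assms(2) prod_prime_factors[of n] by simp
  finally show ?thesis .
qed

lemma sum_factorizations4_prod:
  fixes F :: "nat \<Rightarrow> nat \<times> nat \<times> nat \<times> nat \<Rightarrow> 'a::comm_semiring_1"
  assumes S: "finite S" "\<And>p. p \<in> S \<Longrightarrow> prime p" and m: "m \<noteq> 0" "prime_factors m \<subseteq> S"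
  shows "(\<Sum>u\<in>factorizations4 m. \<Prod>p\<in>S. F p (exponents4 p u))
    = (\<Prod>p\<in>S. \<Sum>e\<in>compositions4 (multiplicity p m). F p e)"
proof -
  let ?P = "\<lambda>f :: nat \<Rightarrow> nat. \<Prod>p\<in>S. p ^ f p"
  let ?number = "\<lambda>g. (?P (\<lambda>p. fst (g p)), ?P (\<lambda>p. fst (snd (g p))), ?P (\<lambda>p. fst (snd (snd (g p)))),
    ?P (\<lambda>p. snd (snd (snd (g p)))))"
  let ?exps = "\<lambda>u. \<lambda>p\<in>S. exponents4 p u"
  have P_pos: "?P f \<ge> Suc 0" for f
    using S by (auto simp: Suc_le_eq prime_gt_0_nat intro!: prod_pos)
  have mult_P: "multiplicity p (?P f) = f p" if "p \<in> S" for p f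
    using that S by (simp add: multiplicity_prod_prime_powers)
  have factor: "?P (\<lambda>p. multiplicity p n) = n" if "n dvd m" for n
    using that m S dvd_prime_factors[OF m(1) that] by (intro prod_prime_powers_eq) auto
  have mult_sum: "exponents4 p u \<in> compositions4 (multiplicity p m)"
      if "p \<in> S" "u \<in> factorizations4 m" for p u
    using that S(2)
    by (auto simp: factorizations4_def compositions4_def exponents4_def
        prime_elem_multiplicity_mult_distrib)
  have "(\<Sum>g\<in>PiE S (\<lambda>p. compositions4 (multiplicity p m)). \<Prod>p\<in>S. F p (g p))
      = (\<Sum>u\<in>factorizations4 m. \<Prod>p\<in>S. F p (exponents4 p u))"
  proof (rule sum.reindex_bij_witness[of _ ?exps ?number])
    fix g assume g: "g \<in> PiE S (\<lambda>p. compositions4 (multiplicity p m))"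
    have exps: "exponents4 p (?number g) = g p" if "p \<in> S" for p
      using that by (simp add: exponents4_def mult_P)
    then show "?exps (?number g) = g" using PiE_arb[OF g] by (auto simp: fun_eq_iff)
    show "(\<Prod>p\<in>S. F p (exponents4 p (?number g))) = (\<Prod>p\<in>S. F p (g p))"
      by (intro prod.cong refl) (simp only: exps)
    have "fst (g p) + fst (snd (g p)) + fst (snd (snd (g p))) + snd (snd (snd (g p)))
        = multiplicity p m" if "p \<in> S" for p
      using PiE_mem[OF g that] by (auto simp: compositions4_def)
    then have "?P (\<lambda>p. fst (g p)) * ?P (\<lambda>p. fst (snd (g p))) * ?P (\<lambda>p. fst (snd (snd (g p)))) *
        ?P (\<lambda>p. snd (snd (snd (g p)))) = ?P (\<lambda>p. multiplicity p m)"
      by (simp flip: prod.distrib power_add)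
    then show "?number g \<in> factorizations4 m"
      using P_pos factor[of m] by (simp add: factorizations4_def)
  next
    fix u assume u: "u \<in> factorizations4 m"
    then show "?exps u \<in> PiE S (\<lambda>p. compositions4 (multiplicity p m))" using mult_sum by auto
    obtain n \<delta> d1 d3 where n: "u = (n, \<delta>, d1, d3)" by (metis prod.exhaust)
    then have "n dvd m" "\<delta> dvd m" "d1 dvd m" "d3 dvd m" using u by (auto simp: factorizations4_def)
    then show "?number (?exps u) = u" by (simp add: exponents4_def n factor)
  qed
  then show ?thesis using S(1) finite_compositions4 by (simp add: prod_sum_PiE)
qed

definition moebius_exponent :: "nat \<Rightarrow> real" where
  "moebius_exponent e = (if e = 0 then 1 else if e = 1 then - 1 else 0)"

lemma moebius_eq_prod_moebius_exponent:
  assumes S: "finite S" "\<And>p. p \<in> S \<Longrightarrow> prime p" and d: "d \<noteq> 0" "prime_factors d \<subseteq> S"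
  shows "of_int (moebius d) = (\<Prod>p\<in>S. moebius_exponent (multiplicity p d))"
proof -
  have "(\<Prod>p\<in>S. moebius_exponent (multiplicity p d))
      = (\<Prod>p\<in>prime_factors d. moebius_exponent (multiplicity p d))"
    using S d
    by (intro prod.mono_neutral_right) (auto simp: moebius_exponent_def prime_factors_multiplicity)
  also have "\<dots> = of_int (moebius d)"
  proof (cases "squarefree d")
    case True
    then show ?thesis using d
      by (simp add: squarefree_factorial_semiring' moebius_def moebius_exponent_def)
  next
    case False
    then obtain p where p: "p \<in> prime_factors d" "multiplicity p d \<noteq> 1"
      using d by (auto simp: squarefree_factorial_semiring')
    then have "moebius_exponent (multiplicity p d) = 0"
      by (auto simp: moebius_exponent_def prime_factors_multiplicity)
    then have "(\<Prod>p\<in>prime_factors d. moebius_exponent (multiplicity p d)) = 0"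
      using p(1) by (intro prod_zero) auto
    then show ?thesis using False by (simp add: moebius_def)
  qed
  finally show ?thesis ..
qed

definition local_sum :: "(nat \<Rightarrow> bool \<Rightarrow> bool \<Rightarrow> real) \<Rightarrow> nat \<Rightarrow> nat \<Rightarrow> real" where
  "local_sum E p v = real p ^ v * E p False False +
     (if v = 0 then 0 else real p ^ (v - 1) * (E p True True - E p True False - E p False True))"

lemma sum_compositions4_squarefree:
  fixes F :: "nat \<Rightarrow> nat \<Rightarrow> nat \<Rightarrow> nat \<Rightarrow> real"
  shows "(\<Sum>(a, b, e, f)\<in>compositions4 v. moebius_exponent e * moebius_exponent f * F a b e f)
    = (\<Sum>e\<le>1. \<Sum>f\<le>1. (- 1) ^ (e + f) * (\<Sum>a<Suc v - (e + f). F a (v - (e + f) - a) e f))"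
proof -
  let ?I = "SIGMA e:{..1}. SIGMA f:{..1}. {..<Suc v - (e + f)}"
  have sign: "moebius_exponent e = (- 1) ^ e" if "e \<le> 1" for e
    using that by (cases e) (auto simp: moebius_exponent_def)
  have "(\<Sum>(a, b, e, f)\<in>compositions4 v. moebius_exponent e * moebius_exponent f * F a b e f)
      = (\<Sum>(a, b, e, f)\<in>{(a, b, e, f). (a, b, e, f) \<in> compositions4 v \<and> e \<le> 1 \<and> f \<le> 1}.
          moebius_exponent e * moebius_exponent f * F a b e f)"
    by (rule sum.mono_neutral_right[OF finite_compositions4])
       (auto simp: moebius_exponent_def split: if_splits)
  also have "\<dots> = (\<Sum>(e, f, a)\<in>?I. (- 1) ^ (e + f) * F a (v - (e + f) - a) e f)"
    by (rule sum.reindex_bij_witness[of _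
          "\<lambda>(e, f, a). (a, v - (e + f) - a, e, f)" "\<lambda>(a, b, e, f). (e, f, a)"])
       (auto simp: compositions4_def sign power_add)
  also have "\<dots> = (\<Sum>e\<le>1. \<Sum>f\<le>1. (- 1) ^ (e + f) * (\<Sum>a<Suc v - (e + f). F a (v - (e + f) - a) e f))"
    unfolding sum_distrib_left
    by (simp add: sum.Sigma del: sum.atMost_Suc sum.lessThan_Suc One_nat_def)
  finally show ?thesis .
qed

lemma sum_compositions4_eq_local_sum:
  "(\<Sum>(a, b, e, f)\<in>compositions4 v.
      real p ^ a * moebius_exponent e * moebius_exponent f * E p (b + e > 0) (b + f > 0))
    = local_sum E p v"
proof -
  have triangle: "(\<Sum>a<Suc w. real p ^ a * G (w - a > 0))
      = real p ^ w * G False + (\<Sum>a<w. real p ^ a * G True)"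
    for w and G :: "bool \<Rightarrow> real"
    by simp
  have "(\<Sum>(a, b, e, f)\<in>compositions4 v.
        real p ^ a * moebius_exponent e * moebius_exponent f * E p (b + e > 0) (b + f > 0))
    = (\<Sum>(a, b, e, f)\<in>compositions4 v.
        moebius_exponent e * moebius_exponent f * (real p ^ a * E p (b + e > 0) (b + f > 0)))"
    by (intro sum.cong refl) auto
  also have "\<dots> = (\<Sum>e\<le>1. \<Sum>f\<le>1. (- 1) ^ (e + f) *
      (\<Sum>a<Suc v - (e + f). real p ^ a * E p (v - (e + f) - a + e > 0) (v - (e + f) - a + f > 0)))"
    by (rule sum_compositions4_squarefree)
  also have "\<dots> = (\<Sum>a<Suc v. real p ^ a * E p (v - a > 0) (v - a > 0))
      - (\<Sum>a<v. real p ^ a * E p (v - 1 - a > 0) True) - (\<Sum>a<v. real p ^ a * E p True (v - 1 - a > 0))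
      + (\<Sum>a<v - 1. real p ^ a * E p True True)"
    by (simp add: less_diff_conv del: sum.lessThan_Suc cong: sum.cong_simp)
  also have "\<dots> = local_sum E p v"
  proof (cases v)
    case (Suc w)
    show ?thesis
      using triangle[of "\<lambda>x. E p x x" v] triangle[of "\<lambda>x. E p x True" w]
        triangle[of "\<lambda>x. E p True x" w]
      by (simp add: Suc local_sum_def algebra_simps)
  qed (simp add: local_sum_def)
  finally show ?thesis .
qed

lemma sum_factorizations4_eq_prod_local_sum:
  fixes E :: "nat \<Rightarrow> bool \<Rightarrow> bool \<Rightarrow> real"
  assumes S: "finite S" "\<And>p. p \<in> S \<Longrightarrow> prime p" and m: "m \<noteq> 0" "prime_factors m \<subseteq> S"
  shows "(\<Sum>(n, \<delta>, d1, d3)\<in>factorizations4 m. real n * of_int (moebius d1) * of_int (moebius d3) *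
            (\<Prod>p\<in>S. E p (p dvd d1 * \<delta>) (p dvd d3 * \<delta>)))
       = (\<Prod>p\<in>S. local_sum E p (multiplicity p m))"
proof -
  let ?F = "\<lambda>p (a, b, e, f).
    real p ^ a * moebius_exponent e * moebius_exponent f * E p (b + e > 0) (b + f > 0)"
  have "real n * of_int (moebius d1) * of_int (moebius d3) * (\<Prod>p\<in>S. E p (p dvd d1 * \<delta>) (p dvd d3 * \<delta>))
      = (\<Prod>p\<in>S. ?F p (exponents4 p (n, \<delta>, d1, d3)))"
    if u: "(n, \<delta>, d1, d3) \<in> factorizations4 m" for n \<delta> d1 d3
  proof -
    have nonzero: "n \<noteq> 0" "\<delta> \<noteq> 0" "d1 \<noteq> 0" "d3 \<noteq> 0" and "n dvd m" "d1 dvd m" "d3 dvd m"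
      using u by (auto simp: factorizations4_def)
    then have factors: "prime_factors n \<subseteq> S" "prime_factors d1 \<subseteq> S" "prime_factors d3 \<subseteq> S"
      using dvd_prime_factors[OF m(1)] m(2) by blast+
    have "p dvd d * \<delta> \<longleftrightarrow> multiplicity p \<delta> + multiplicity p d > 0" if "p \<in> S" "d \<noteq> 0" for p d
      using S(2)[OF that(1)] that(2) nonzero(2)
      by (auto simp: prime_dvd_mult_iff prime_multiplicity_gt_zero_iff)
    then have "(\<Prod>p\<in>S. E p (p dvd d1 * \<delta>) (p dvd d3 * \<delta>)) = (\<Prod>p\<in>S.
        E p (multiplicity p \<delta> + multiplicity p d1 > 0) (multiplicity p \<delta> + multiplicity p d3 > 0))"
      using nonzero by (intro prod.cong refl) simp
    moreover have "real n = (\<Prod>p\<in>S. real p ^ multiplicity p n)"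
      using arg_cong[OF prod_prime_powers_eq[OF S(1) nonzero(1) factors(1) S(2)], of real] by simp
    ultimately show ?thesis
      using factors nonzero
      by (simp add: moebius_eq_prod_moebius_exponent[OF S] exponents4_def prod.distrib)
  qed
  then have "(\<Sum>(n, \<delta>, d1, d3)\<in>factorizations4 m.
        real n * of_int (moebius d1) * of_int (moebius d3) *
          (\<Prod>p\<in>S. E p (p dvd d1 * \<delta>) (p dvd d3 * \<delta>)))
      = (\<Sum>u\<in>factorizations4 m. \<Prod>p\<in>S. ?F p (exponents4 p u))"
    by (intro sum.cong refl) auto
  also have "\<dots> = (\<Prod>p\<in>S. \<Sum>e\<in>compositions4 (multiplicity p m). ?F p e)"
    by (rule sum_factorizations4_prod[OF S m])
  also have "\<dots> = (\<Prod>p\<in>S. local_sum E p (multiplicity p m))"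
    by (simp only: sum_compositions4_eq_local_sum)
  finally show ?thesis .
qed

definition euler_factor :: "nat \<Rightarrow> bool \<Rightarrow> bool \<Rightarrow> real" where
  "euler_factor p A B = euler_term p True True A B + euler_term p True False A B +
     (euler_term p False True A B + euler_term p False False A B)"

lemma sum_Pow_moebius_weight_h_fun:
  assumes S: "finite S" "\<And>p. p \<in> S \<Longrightarrow> prime p" and m: "m \<noteq> 0" "prime_factors m \<subseteq> S"
  shows "(\<Sum>X\<in>Pow S. \<Sum>Y\<in>Pow S. moebius_weight (\<Prod>X) * moebius_weight (\<Prod>Y) * h_fun (\<Prod>X) (\<Prod>Y) m)
    = (\<Prod>p\<in>S. local_sum euler_factor p (multiplicity p m))"
proof -
  let ?c = "\<lambda>(n, \<delta>, d1, d3). real n * of_int (moebius d1) * of_int (moebius d3)"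
  let ?t = "\<lambda>(n, \<delta>, d1, d3) p x y. euler_term p x y (p dvd d1 * \<delta>) (p dvd d3 * \<delta>)"
  have "moebius_weight (\<Prod>X) * moebius_weight (\<Prod>Y) * h_fun (\<Prod>X) (\<Prod>Y) m
      = (\<Sum>u\<in>factorizations4 m. ?c u * (\<Prod>p\<in>S. ?t u p (p \<in> X) (p \<in> Y)))"
    if "X \<in> Pow S" "Y \<in> Pow S" for X Y
    unfolding h_fun_eq_sum_h_weight sum_distrib_left using that
    by (intro sum.cong refl)
       (auto simp: mult.left_commute simp flip: moebius_weight_h_weight_prod_primes[OF S])
  then have "(\<Sum>X\<in>Pow S. \<Sum>Y\<in>Pow S. moebius_weight (\<Prod>X) * moebius_weight (\<Prod>Y) * h_fun (\<Prod>X) (\<Prod>Y) m)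
     = (\<Sum>X\<in>Pow S. \<Sum>Y\<in>Pow S. \<Sum>u\<in>factorizations4 m. ?c u * (\<Prod>p\<in>S. ?t u p (p \<in> X) (p \<in> Y)))"
    by (intro sum.cong refl)
  also have "\<dots> = (\<Sum>u\<in>factorizations4 m. ?c u * (\<Sum>X\<in>Pow S. \<Sum>Y\<in>Pow S. \<Prod>p\<in>S. ?t u p (p \<in> X) (p \<in> Y)))"
    unfolding sum_distrib_left by (subst (2) sum.swap, subst sum.swap) (rule refl)
  also have "\<dots> = (\<Sum>(n, \<delta>, d1, d3)\<in>factorizations4 m.
        real n * of_int (moebius d1) * of_int (moebius d3) *
          (\<Prod>p\<in>S. euler_factor p (p dvd d1 * \<delta>) (p dvd d3 * \<delta>)))"
    unfolding sum_Pow_Pow_prod_mem[OF S(1)] by (intro sum.cong refl) (auto simp: euler_factor_def)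
  also have "\<dots> = (\<Prod>p\<in>S. local_sum euler_factor p (multiplicity p m))"
    by (rule sum_factorizations4_eq_prod_local_sum[OF S m])
  finally show ?thesis .
qed

lemma local_density_pair:
  assumes "prime p"
  shows "local_density {(0, 0), (- 1, 0)} p = 1 - 2 / (real p)\<^sup>2"
proof -
  have "int p > 1" using prime_gt_1_nat[OF assms] by simp
  then have "(- 1) mod int p \<noteq> 0" by (simp add: zmod_minus1)
  then show ?thesis by (simp add: local_density_def reduce_mod_def)
qed

lemma local_density_triple:
  fixes k r :: int
  assumes p: "prime p" and kr: "coprime k r"
  shows "local_density (viewpoints r k) p
    = 1 - (3 - of_bool (int p dvd r \<and> int p dvd k - 1)) / (real p)\<^sup>2"
proof -
  have p1: "int p > 1" using prime_gt_1_nat[OF p] by simp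
  have "(- r) mod int p = 0 \<longleftrightarrow> int p dvd r" "k mod int p = 1 \<longleftrightarrow> int p dvd k - 1"
      "k mod int p = 0 \<longleftrightarrow> int p dvd k"
    using p1 by (simp_all add: mod_eq_0_iff_dvd mod_eq_dvd_iff[symmetric])
  moreover have "\<not> (int p dvd k \<and> int p dvd r)"
    using kr p by (auto simp: coprime_int_iff_no_common_prime)
  ultimately have "real (card {(0, 0), (1, 0), (k mod int p, (- r) mod int p)})
      = 3 - of_bool (int p dvd r \<and> int p dvd k - 1)"
    by (auto simp: card_insert_if)
  then show ?thesis using p1 by (simp add: local_density_def reduce_mod_def)
qed

lemma sum_residue_class_prod:
  fixes f :: "nat \<Rightarrow> int \<Rightarrow> real" and r m a :: int
  assumes "finite T" "\<And>p. p \<in> T \<Longrightarrow> prime p" "\<And>p k. p \<in> T \<Longrightarrow> f p (k mod int p) = f p k"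
    and "r \<ge> 0" "m > 0" "\<And>p. p \<in> T \<Longrightarrow> coprime m (int p)" "m * int (\<Prod>T) dvd r"
  shows "(\<Sum>k\<in>{0..<r} \<inter> residue_class m a. \<Prod>p\<in>T. f p k)
    = of_int r / of_int m * (\<Prod>p\<in>T. (\<Sum>j\<in>{0..<int p}. f p j) / real p)"
  using assms
proof (induction T arbitrary: m a rule: finite_induct)
  case empty
  then have "real (nat (r div m)) = of_int r / of_int m"
    by (auto simp: pos_imp_zdiv_nonneg_iff real_of_int_div)
  then show ?case using empty by (simp add: card_residue_class_period)
next
  case (insert q T)
  let ?K = "\<lambda>m a. {0..<r} \<inter> residue_class m a"
  let ?\<Pi> = "\<Prod>p\<in>T. (\<Sum>j\<in>{0..<int p}. f p j) / real p"
  have q: "prime q" "q > 0" "coprime m (int q)" using insert.prems by (auto simp: prime_gt_0_nat)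
  have coprime: "coprime (m * int q) (int p)" if "p \<in> T" for p
    using that insert.prems insert.hyps(2) primes_coprime[of q p] by auto
  have fibre: "(\<Sum>k\<in>{k\<in>?K m a. k mod int q = j}. \<Prod>p\<in>insert q T. f p k)
      = f q j * (of_int r / of_int (m * int q) * ?\<Pi>)"
    if j: "j \<in> {0..<int q}" for j
  proof -
    obtain c where c: "{k\<in>?K m a. k mod int q = j} = ?K (m * int q) c"
      using residue_class_fibre[OF q(3) j] by blast
    have "f q k = f q j" if "k \<in> ?K (m * int q) c" for k
      using that insert.prems(2)[of q k] by (auto simp flip: c)
    then have "(\<Sum>k\<in>?K (m * int q) c. \<Prod>p\<in>insert q T. f p k)
        = f q j * (\<Sum>k\<in>?K (m * int q) c. \<Prod>p\<in>T. f p k)"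
      using insert.hyps by (simp add: sum_distrib_left)
    also have "(\<Sum>k\<in>?K (m * int q) c. \<Prod>p\<in>T. f p k) = of_int r / of_int (m * int q) * ?\<Pi>"
      using insert.prems insert.hyps q coprime by (intro insert.IH) (auto simp: mult.assoc)
    finally show ?thesis unfolding c .
  qed
  have "(\<Sum>k\<in>?K m a. \<Prod>p\<in>insert q T. f p k)
      = (\<Sum>j\<in>{0..<int q}. \<Sum>k\<in>{k\<in>?K m a. k mod int q = j}. \<Prod>p\<in>insert q T. f p k)"
    using q(2) by (intro sum.group[symmetric]) auto
  also have "\<dots> = (\<Sum>j\<in>{0..<int q}. f q j) * (of_int r / of_int (m * int q) * ?\<Pi>)"
    by (simp only: fibre sum_distrib_right cong: sum.cong)
  also have "\<dots> = of_int r / of_int m * (\<Prod>p\<in>insert q T. (\<Sum>j\<in>{0..<int p}. f p j) / real p)"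
    using insert.hyps by simp
  finally show ?case .
qed

definition local_singular_factor :: "nat \<Rightarrow> nat \<Rightarrow> real" where
  "local_singular_factor p v = (if v = 0 then 1 - 3 / (real p)\<^sup>2
     else real p ^ v * ((1 - 3 / (real p)\<^sup>2) * (1 - 1 / real p) + 1 / real p ^ 3))"

definition residue_weight :: "nat \<Rightarrow> int \<Rightarrow> real" where
  "residue_weight p k = (if int p dvd k then 0 else 1 - (3 - of_bool (int p dvd k - 1)) / (real p)\<^sup>2)"

lemma sum_residue_weight:
  assumes "prime p"
  shows "(\<Sum>j\<in>{0..<int p}. residue_weight p j) / real p
    = (1 - 3 / (real p)\<^sup>2) * (1 - 1 / real p) + 1 / real p ^ 3"
proof -
  have p: "int p \<ge> 2" using prime_ge_2_nat[OF assms] by simp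
  then have interval: "{0..<int p} = {0, 1} \<union> {2..<int p}" by auto
  have "residue_weight p j = 1 - 3 / (real p)\<^sup>2" if "j \<in> {2..<int p}" for j
    using that by (auto simp: residue_weight_def zdvd_not_zless)
  then have "(\<Sum>j\<in>{0..<int p}. residue_weight p j)
      = residue_weight p 0 + residue_weight p 1 + (real p - 2) * (1 - 3 / (real p)\<^sup>2)"
    unfolding interval using p by (subst sum.union_disjoint) (auto simp: of_nat_diff)
  also have "\<dots> = (real p - 1) * (1 - 3 / (real p)\<^sup>2) + 1 / (real p)\<^sup>2"
    using p by (simp add: residue_weight_def diff_divide_distrib algebra_simps)
  finally show ?thesis using p by (simp add: field_simps power2_eq_square power3_eq_cube)
qed

lemma prod_local_density_triple:
  fixes r :: nat
  assumes "finite S" "\<And>p. p \<in> S \<Longrightarrow> prime p" "r > 0" "prime_factors r \<subseteq> S"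
  shows "of_bool (coprime k (int r)) * (\<Prod>p\<in>S. local_density (viewpoints (int r) k) p)
    = (\<Prod>p\<in>S - prime_factors r. 1 - 3 / (real p)\<^sup>2) * (\<Prod>p\<in>prime_factors r. residue_weight p k)"
proof (cases "coprime k (int r)")
  case True
  have "\<not> int p dvd k" if "p \<in> prime_factors r" for p
    using True that by (auto simp: coprime_int_iff_no_common_prime in_prime_factors_iff)
  then have "local_density (viewpoints (int r) k) p = residue_weight p k"
      if "p \<in> prime_factors r" for p
    using that by (simp add: local_density_triple[OF _ True] residue_weight_def in_prime_factors_iff)
  moreover have "local_density (viewpoints (int r) k) p = 1 - 3 / (real p)\<^sup>2"
      if "p \<in> S - prime_factors r" for p
  proof -
    have "prime p" "\<not> p dvd r" using that assms by (auto simp: in_prime_factors_iff)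
    then show ?thesis by (simp add: local_density_triple[OF _ True])
  qed
  ultimately show ?thesis
    using True prod.subset_diff[OF assms(4,1), of "local_density (viewpoints (int r) k)"] by simp
next
  case False
  then obtain p where p: "prime p" "int p dvd k" "p dvd r"
    by (auto simp: coprime_int_iff_no_common_prime)
  then have "p \<in> prime_factors r" "residue_weight p k = 0"
    using assms(3) by (auto simp: in_prime_factors_iff residue_weight_def)
  then have "(\<Prod>p\<in>prime_factors r. residue_weight p k) = 0" by (intro prod_zero) auto
  then show ?thesis using False by simp
qed

lemma sum_reduced_residues_local_density:
  fixes r :: nat
  assumes S: "finite S" "\<And>p. p \<in> S \<Longrightarrow> prime p" and r: "r \<noteq> 0" "prime_factors r \<subseteq> S"
  shows "(\<Sum>k\<in>reduced_residues (int r). \<Prod>p\<in>S. local_density (viewpoints (int r) k) p)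
    = (\<Prod>p\<in>S. local_singular_factor p (multiplicity p r))"
proof -
  let ?T = "prime_factors r"
  let ?\<alpha> = "\<lambda>p. 1 - 3 / (real p)\<^sup>2"
  have T: "p \<in> ?T \<Longrightarrow> prime p" for p by (simp add: in_prime_factors_iff)
  have mult: "multiplicity p r = 0 \<longleftrightarrow> p \<notin> ?T" if "p \<in> S" for p
    using that S(2) by (simp add: prime_factors_multiplicity)
  have "(\<Sum>k\<in>reduced_residues (int r). \<Prod>p\<in>S. local_density (viewpoints (int r) k) p)
      = (\<Sum>k\<in>{0..<int r}. of_bool (coprime k (int r)) *
          (\<Prod>p\<in>S. local_density (viewpoints (int r) k) p))"
    by (rule sum.mono_neutral_cong_left) (auto simp: reduced_residues_def)
  also have "\<dots> = (\<Prod>p\<in>S - ?T. ?\<alpha> p) * (\<Sum>k\<in>{0..<int r} \<inter> residue_class 1 0. \<Prod>p\<in>?T. residue_weight p k)"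
    using S r by (simp add: prod_local_density_triple sum_distrib_left)
  also have "(\<Sum>k\<in>{0..<int r} \<inter> residue_class 1 0. \<Prod>p\<in>?T. residue_weight p k)
      = of_int (int r) / of_int 1 * (\<Prod>p\<in>?T. (\<Sum>j\<in>{0..<int p}. residue_weight p j) / real p)"
  proof (rule sum_residue_class_prod)
    have "\<Prod>?T dvd r" using r by (intro prod_primes_dvd) (auto simp: in_prime_factors_iff)
    then show "1 * int (\<Prod>?T) dvd int r" by (simp only: mult_1 int_dvd_int_iff)
    show "residue_weight p (k mod int p) = residue_weight p k" for p k
      by (simp add: residue_weight_def dvd_mod_iff mod_diff_left_eq flip: mod_eq_0_iff_dvd)
  qed (use T in auto)
  also have "of_int (int r) / of_int 1 = (\<Prod>p\<in>?T. real p ^ multiplicity p r)"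
    using arg_cong[OF prod_prime_factors[of r], of real] r by simp
  also have "(\<Prod>p\<in>?T. real p ^ multiplicity p r) *
      (\<Prod>p\<in>?T. (\<Sum>j\<in>{0..<int p}. residue_weight p j) / real p)
      = (\<Prod>p\<in>?T. local_singular_factor p (multiplicity p r))"
    unfolding prod.distrib[symmetric] using mult r(2) T
    by (intro prod.cong refl) (auto simp: sum_residue_weight local_singular_factor_def)
  also have "(\<Prod>p\<in>S - ?T. ?\<alpha> p) = (\<Prod>p\<in>S - ?T. local_singular_factor p (multiplicity p r))"
    using mult by (intro prod.cong refl) (auto simp: local_singular_factor_def)
  finally show ?thesis
    by (simp only: prod.subset_diff[OF r(2) S(1), of "\<lambda>p. local_singular_factor p (multiplicity p r)"])
qed

lemma euler_factor_identities:
  assumes "prime p"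
  shows "(1 - 1 / (real p)\<^sup>2) * euler_factor p False False = 1 - 3 / (real p)\<^sup>2"
    and "(1 - 1 / (real p)\<^sup>2) *
      (euler_factor p True True - euler_factor p True False - euler_factor p False True)
      = - (1 - 4 / (real p)\<^sup>2)"
proof -
  define q where "q = real p"
  have q: "q > 1" using prime_gt_1_nat[OF assms] by (simp add: q_def)
  define s t where "s = 1 / (q - 1)" and "t = 1 / ((q + 1) * (q - 1))"
  have "inverse (1 + 1 / q) = q / (q + 1)" using q by (simp add: field_simps)
  then have "half_euler_term p True True = - s" "half_euler_term p True False = - t"
      "half_euler_term p False A = 1" for A
    using q by (simp_all add: half_euler_term_def s_def t_def flip: q_def)
  then have factors: "euler_factor p False False = 1 - 2 * t"
      "euler_factor p True True = (1 - s) * (1 - s)"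
    "euler_factor p True False = (1 - s) * (1 - t)" "euler_factor p False True = (1 - t) * (1 - s)"
    by (simp_all add: euler_factor_def euler_term_def algebra_simps)
  have "s = (q + 1) * t" using q by (simp add: s_def t_def)
  then have "s * s + 2 * t - 2 * s * t = t * (s * (q - 1)) + 2 * t" by (simp add: algebra_simps)
  moreover have "s * (q - 1) = 1" using q by (simp add: s_def)
  ultimately have "s * s + 2 * t - 2 * s * t = 3 * t" by simp
  then have combination:
      "euler_factor p True True - euler_factor p True False - euler_factor p False True
          = - (1 - 3 * t)"
    by (simp add: factors algebra_simps)
  have "1 - 1 / q\<^sup>2 = (q + 1) * (q - 1) / q\<^sup>2" using q by (simp add: field_simps power2_eq_square)
  then have t_eq: "(1 - 1 / q\<^sup>2) * t = 1 / q\<^sup>2" using q by (simp add: t_def)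
  have "u * (1 - c * t) = u - c * (u * t)" for u c by (simp add: algebra_simps)
  from this[of "1 - 1 / q\<^sup>2"] have expand: "(1 - 1 / q\<^sup>2) * (1 - c * t) = 1 - (c + 1) / q\<^sup>2" for c
    unfolding t_eq by (simp add: add_divide_distrib)
  show "(1 - 1 / (real p)\<^sup>2) * euler_factor p False False = 1 - 3 / (real p)\<^sup>2"
    unfolding q_def[symmetric] factors expand by simp
  show "(1 - 1 / (real p)\<^sup>2) *
      (euler_factor p True True - euler_factor p True False - euler_factor p False True)
      = - (1 - 4 / (real p)\<^sup>2)"
    unfolding q_def[symmetric] combination mult_minus_right expand by simp
qed

lemma local_sum_euler_factor:
  assumes "prime p"
  shows "(1 - 1 / (real p)\<^sup>2) * local_sum euler_factor p v = local_singular_factor p v"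
proof (cases v)
  case 0
  then show ?thesis using euler_factor_identities(1)[OF assms]
    by (simp add: local_sum_def local_singular_factor_def)
next
  case (Suc w)
  define q where "q = real p"
  have q: "q > 0" using prime_gt_0_nat[OF assms] by (simp add: q_def)
  have "(1 - 1 / q\<^sup>2) * local_sum euler_factor p v
      = q ^ v * ((1 - 1 / q\<^sup>2) * euler_factor p False False)
      + q ^ w * ((1 - 1 / q\<^sup>2) *
          (euler_factor p True True - euler_factor p True False - euler_factor p False True))"
    unfolding local_sum_def q_def[symmetric] Suc by (simp add: distrib_left mult.left_commute)
  also have "\<dots> = q ^ v * ((1 - 3 / q\<^sup>2) * (1 - 1 / q) + 1 / q ^ 3)"
    unfolding q_def euler_factor_identities[OF assms] unfolding q_def[symmetric] Suc
    using q by (simp add: field_simps power2_eq_square power3_eq_cube)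
  finally show ?thesis using Suc by (simp add: local_singular_factor_def q_def)
qed

lemma truncated_singular_series_identity:
  assumes S: "finite S" "\<And>p. p \<in> S \<Longrightarrow> prime p" and r: "r \<noteq> 0" "prime_factors r \<subseteq> S"
  shows "(\<Sum>k\<in>reduced_residues (int r). \<Prod>p\<in>S. local_density (viewpoints (int r) k) p)
    = (\<Prod>p\<in>S. 1 - 1 / (real p)\<^sup>2) *
      (\<Sum>X\<in>Pow S. \<Sum>Y\<in>Pow S. moebius_weight (\<Prod>X) * moebius_weight (\<Prod>Y) * h_fun (\<Prod>X) (\<Prod>Y) r)"
  using S(2)
  by (simp add: sum_reduced_residues_local_density[OF S r] sum_Pow_moebius_weight_h_fun[OF S r]
      local_sum_euler_factor
      flip: prod.distrib)

section \<open>The constants \<open>\<beta>\<close> and \<open>\<zeta>(2)\<close>\<close>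

lemma infsum_completely_multiplicative_coprime:
  fixes f :: "nat \<Rightarrow> 'a::{real_normed_field, banach}"
  assumes f: "f summable_on UNIV" "\<And>m n. f (m * n) = f m * f n"
    and "finite S" "\<And>p. p \<in> S \<Longrightarrow> prime p"
  shows "infsum f {n. n > 0 \<and> (\<forall>p\<in>S. \<not> p dvd n)} = (\<Prod>p\<in>S. 1 - f p) * infsum f {0<..}"
  using assms(3,4)
proof (induction S rule: finite_induct)
  case empty
  then show ?case by (simp add: greaterThan_def)
next
  case (insert q S)
  let ?A = "\<lambda>S. {n. n > 0 \<and> (\<forall>p\<in>S. \<not> p dvd n)}"
  have q: "prime q" "q > 0" using insert by (auto simp: prime_gt_0_nat)
  have dvd_iff: "p dvd q * n \<longleftrightarrow> p dvd n" if "p \<in> S" for p n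
  proof -
    have "prime p" "p \<noteq> q" using that insert by auto
    then show ?thesis using q by (auto simp: prime_dvd_mult_iff dest: primes_dvd_imp_eq)
  qed
  have summable: "f summable_on A" for A
    using f(1) by (rule summable_on_subset_banach) simp
  have mem_iff: "q * n \<in> ?A S \<longleftrightarrow> n \<in> ?A S" for n using dvd_iff q(2) by simp
  have multiples: "{n\<in>?A S. q dvd n} = (\<lambda>n. q * n) ` ?A S"
  proof (intro equalityI subsetI)
    fix n assume "n \<in> {n\<in>?A S. q dvd n}"
    then obtain j where "n = q * j" "q * j \<in> ?A S" by (auto elim: dvdE)
    then show "n \<in> (\<lambda>n. q * n) ` ?A S" using mem_iff by blast
  next
    fix n assume "n \<in> (\<lambda>n. q * n) ` ?A S"
    then obtain j where "n = q * j" "j \<in> ?A S" by blast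
    then show "n \<in> {n\<in>?A S. q dvd n}" using mem_iff[of j] by simp
  qed
  have "?A (insert q S) = ?A S - {n\<in>?A S. q dvd n}" by auto
  then have "infsum f (?A (insert q S)) = infsum f (?A S - (\<lambda>n. q * n) ` ?A S)"
    by (simp only: multiples)
  also have "\<dots> = infsum f (?A S) - infsum f ((\<lambda>n. q * n) ` ?A S)"
    unfolding multiples[symmetric] by (rule infsum_Diff[OF summable summable]) auto
  also have "infsum f ((\<lambda>n. q * n) ` ?A S) = f q * infsum f (?A S)"
    using q(2) by (subst infsum_reindex) (auto simp: inj_on_def o_def f(2) infsum_cmult_right')
  also have "infsum f (?A S) = (\<Prod>p\<in>S. 1 - f p) * infsum f {0<..}" using insert by auto
  finally show ?case using insert(1,2) by (simp add: algebra_simps)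
qed

lemma infsum_greaterThan_tendsto_0:
  fixes f :: "nat \<Rightarrow> 'a::banach"
  assumes "f summable_on UNIV"
  shows "(\<lambda>z. infsum f {z<..}) \<longlonglongrightarrow> 0"
proof -
  have "f sums infsum f UNIV" using assms by (intro has_sum_imp_sums has_sum_infsum)
  then have "(\<lambda>z. infsum f UNIV - (\<Sum>n\<le>z. f n)) \<longlonglongrightarrow> infsum f UNIV - infsum f UNIV"
    unfolding sums_def_le by (intro tendsto_intros)
  moreover have "infsum f UNIV - (\<Sum>n\<le>z. f n) = infsum f {z<..}" for z
  proof -
    have "infsum f (UNIV - {..z}) = infsum f UNIV - infsum f {..z}"
      using assms by (intro infsum_Diff) auto
    moreover have "UNIV - {..z} = {z<..}" by auto
    ultimately show ?thesis by simp
  qed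
  ultimately show ?thesis by simp
qed

theorem euler_product_completely_multiplicative:
  fixes f :: "nat \<Rightarrow> 'a::{real_normed_field, banach}"
  assumes f: "(\<lambda>n. norm (f n)) summable_on UNIV" "f 1 = 1" "\<And>m n. f (m * n) = f m * f n"
  shows "(\<lambda>z. (\<Prod>p\<in>primes_le z. 1 - f p) * infsum f {0<..}) \<longlonglongrightarrow> 1"
proof -
  let ?A = "\<lambda>z. {n. n > 0 \<and> (\<forall>p\<in>primes_le z. \<not> p dvd n)}"
  have norm_summable: "(\<lambda>n. norm (f n)) summable_on A" for A
    using f(1) by (rule summable_on_subset_banach) simp
  then have summable: "f summable_on A" for A by (rule abs_summable_summable)
  have bound: "norm (infsum f (?A z) - 1) \<le> infsum (\<lambda>n. norm (f n)) {z<..}" for z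
  proof -
    have "?A z - {1} \<subseteq> {z<..}"
    proof
      fix n assume n: "n \<in> ?A z - {1}"
      then obtain p where p: "prime p" "p dvd n" using prime_factor_nat by blast
      then have "p \<le> n" using n by (intro dvd_imp_le) auto
      moreover have "p > z" using p n by (auto simp: primes_le_def not_le)
      ultimately show "n \<in> {z<..}" by simp
    qed
    moreover have "infsum f (?A z - {1}) = infsum f (?A z) - infsum f {1}"
      using summable by (intro infsum_Diff) (auto simp: primes_le_def)
    then have "norm (infsum f (?A z) - 1) \<le> infsum (\<lambda>n. norm (f n)) (?A z - {1})"
      using norm_infsum_bound[OF norm_summable, of "?A z - {1}"] f(2) by simp
    ultimately show ?thesis
      using infsum_mono_neutral[OF norm_summable norm_summable, of "?A z - {1}" "{z<..}"] by fastforce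
  qed
  have "(\<lambda>z. infsum f (?A z) - 1) \<longlonglongrightarrow> 0"
    by (rule Lim_null_comparison[OF always_eventually[OF allI[OF bound]]
        infsum_greaterThan_tendsto_0[OF f(1)]])
  moreover have "infsum f (?A z) = (\<Prod>p\<in>primes_le z. 1 - f p) * infsum f {0<..}" for z
    using summable f(3) prime_if_in_primes_le by (intro infsum_completely_multiplicative_coprime) auto
  ultimately show ?thesis by (simp add: LIM_zero_iff)
qed

lemma zeta_eq_infsum:
  assumes "s > 1"
  shows "(\<lambda>n. 1 / real n powr s) summable_on UNIV" "zeta s = infsum (\<lambda>n. 1 / real n powr s) {0<..}"
proof -
  have summable: "summable (\<lambda>n. 1 / real n powr s)"
    using assms summable_real_powr_iff[of "- s"] by (simp add: powr_minus_divide)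
  then show "(\<lambda>n. 1 / real n powr s) summable_on UNIV"
    by (intro norm_summable_imp_summable_on) simp
  have "zeta s = (\<Sum>\<^sub>\<infinity>n. 1 / real (Suc n) powr s)"
    using summable[THEN summable_Suc_iff[THEN iffD2]] unfolding zeta_def
    by (intro infsumI[symmetric] norm_summable_imp_has_sum summable_sums) auto
  also have "\<dots> = infsum (\<lambda>n. 1 / real n powr s) (range Suc)"
    by (subst infsum_reindex) (auto simp: o_def)
  also have "range Suc = {0<..}" by (auto simp: image_iff gr0_conv_Suc)
  finally show "zeta s = infsum (\<lambda>n. 1 / real n powr s) {0<..}" .
qed

lemma euler_product_zeta:
  assumes "s > 1"
  shows "zeta s \<noteq> 0" and "(\<lambda>z. \<Prod>p\<in>primes_le z. 1 - 1 / real p powr s) \<longlonglongrightarrow> 1 / zeta s"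
proof -
  have prod: "(\<lambda>z. (\<Prod>p\<in>primes_le z. 1 - 1 / real p powr s) * zeta s) \<longlonglongrightarrow> 1"
    unfolding zeta_eq_infsum(2)[OF assms]
    using zeta_eq_infsum(1)[OF assms]
    by (intro euler_product_completely_multiplicative) (simp_all add: powr_mult)
  then show "zeta s \<noteq> 0" using LIMSEQ_unique[of "\<lambda>_. 0" "0::real" 1] by auto
  then show "(\<lambda>z. \<Prod>p\<in>primes_le z. 1 - 1 / real p powr s) \<longlonglongrightarrow> 1 / zeta s"
    using tendsto_divide[OF prod tendsto_const, of "zeta s"] by simp
qed

lemma euler_product_zeta_2:
  shows "zeta 2 \<noteq> 0" and "(\<lambda>z. \<Prod>p\<in>primes_le z. 1 - 1 / (real p)\<^sup>2) \<longlonglongrightarrow> 1 / zeta 2"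
  using euler_product_zeta[of 2] by simp_all

lemma root_count_pronic_poly:
  assumes "prime p"
  shows "root_count pronic_poly p = 2"
proof -
  have p: "p \<ge> 2" using assms by (rule prime_ge_2_nat)
  have "[poly pronic_poly (int a) = 0] (mod int p) \<longleftrightarrow> p dvd a \<or> p dvd a + 1" for a
  proof -
    have "[poly pronic_poly (int a) = 0] (mod int p) \<longleftrightarrow> int p dvd int (a * (a + 1))"
      by (simp add: poly_pronic_poly cong_0_iff algebra_simps)
    then show ?thesis using prime_dvd_mult_iff[OF assms] by (simp only: int_dvd_int_iff)
  qed
  moreover have "1 \<le> a \<and> a \<le> p \<and> (p dvd a \<or> p dvd a + 1) \<longleftrightarrow> a \<in> {p - 1, p}" for a
  proof
    assume "1 \<le> a \<and> a \<le> p \<and> (p dvd a \<or> p dvd a + 1)"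
    then show "a \<in> {p - 1, p}" by (auto dest: dvd_imp_le)
  qed (use p in auto)
  ultimately have "{a. 1 \<le> a \<and> a \<le> p \<and> [poly pronic_poly (int a) = 0] (mod int p)} = {p - 1, p}"
    by auto
  then show ?thesis using p by (simp add: root_count_def)
qed

lemma beta_pronic_poly:
  shows "beta pronic_poly = visible_density {(0, 0), (- 1, 0)}" and "beta pronic_poly > 0"
proof -
  let ?B = "{(0, 0), (- 1, 0)}"
  define f where "f p = (if prime p then 1 - real (root_count pronic_poly p) / (real p)\<^sup>2 else 1)"
      for p
  have f: "f p = (if prime p then 1 - 2 / (real p)\<^sup>2 else 1)" for p
    by (simp add: f_def root_count_pronic_poly)
  have "summable (\<lambda>n. 2 * (1 / (real n)\<^sup>2))"
    using inverse_power_summable[of 2] by (intro summable_mult) (simp add: field_simps)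
  then have "summable (\<lambda>n. norm (f n - 1))"
    by (rule summable_comparison_test[rotated]) (auto simp: f)
  then have conv: "convergent_prod f"
    by (intro abs_convergent_prod_imp_convergent_prod) (simp add: abs_convergent_prod_conv_summable)
  have beta: "beta pronic_poly = prodinf f" unfolding beta_def f_def ..
  have "(\<Prod>i\<le>z. f i) = (\<Prod>p\<in>primes_le z. local_density ?B p)" for z
    unfolding f primes_le_def by (rule prod.mono_neutral_cong_right) (auto simp: local_density_pair)
  then have "(\<lambda>z. \<Prod>i\<le>z. f i) \<longlonglongrightarrow> visible_density ?B" using LIMSEQ_visible_density by simp
  then show eq: "beta pronic_poly = visible_density ?B"
    unfolding beta using convergent_prod_LIMSEQ[OF conv] LIMSEQ_unique by blast
  have pos: "1 - 2 / (real p)\<^sup>2 > 0" if "prime p" for p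
  proof -
    have "2\<^sup>2 \<le> (real p)\<^sup>2" using prime_ge_2_nat[OF that] by (intro power_mono) auto
    then show ?thesis by (simp add: divide_less_eq)
  qed
  have "beta pronic_poly \<noteq> 0"
    unfolding beta using pos by (intro prodinf_nonzero[OF conv]) (auto simp: f less_le)
  moreover have "beta pronic_poly \<ge> 0"
    unfolding eq by (rule LIMSEQ_le_const[OF LIMSEQ_visible_density])
      (auto intro!: prod_nonneg local_density_bounds dest: prime_if_in_primes_le)
  ultimately show "beta pronic_poly > 0" by simp
qed

section \<open>Convergence of the singular series\<close>

definition smooth_squarefrees :: "nat \<Rightarrow> nat set" where
  "smooth_squarefrees z = (\<lambda>X. \<Prod>X) ` Pow (primes_le z)"

lemma finite_smooth_squarefrees: "finite (smooth_squarefrees z)"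
  by (simp add: smooth_squarefrees_def)

lemma squarefree_if_in_smooth_squarefrees: "d \<in> smooth_squarefrees z \<Longrightarrow> squarefree d"
  by (auto simp: smooth_squarefrees_def primes_le_def intro!: squarefree_prod_primes)

lemma sum_smooth_squarefrees: "(\<Sum>d\<in>smooth_squarefrees z. f d) = (\<Sum>X\<in>Pow (primes_le z). f (\<Prod>X))"
proof -
  have "prime_factors (\<Prod>X) = X" if "X \<in> Pow (primes_le z)" for X
    using that prime_if_in_primes_le by (intro prime_factors_prod_primes) (auto intro: finite_subset)
  then have "inj_on (\<lambda>X. \<Prod>X) (Pow (primes_le z))" by (rule inj_on_inverseI)
  then show ?thesis by (simp add: smooth_squarefrees_def sum.reindex)
qed

lemma prime_factors_subset_primes_le:
  assumes "d \<noteq> 0" "d \<le> z"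
  shows "prime_factors d \<subseteq> primes_le z"
  using assms by (auto simp: primes_le_def in_prime_factors_iff intro: order_trans[OF dvd_imp_le])

lemma squarefree_in_smooth_squarefrees:
  assumes "squarefree d" "d \<le> z"
  shows "d \<in> smooth_squarefrees z"
proof -
  have d: "d \<noteq> 0" using assms(1) by (metis not_squarefree_0)
  have "d = (\<Prod>p\<in>prime_factors d. p ^ multiplicity p d)" using prod_prime_factors[OF d] by simp
  also have "\<dots> = \<Prod>(prime_factors d)"
    using assms(1) d by (intro prod.cong refl) (simp add: squarefree_factorial_semiring')
  finally show ?thesis
    using prime_factors_subset_primes_le[OF d assms(2)] unfolding smooth_squarefrees_def by blast
qed

lemma filterlim_smooth_squarefrees:
  "filterlim (\<lambda>z. smooth_squarefrees z \<times> smooth_squarefrees z)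
    (finite_subsets_at_top ({d. squarefree d} \<times> {d. squarefree d})) sequentially"
  unfolding filterlim_finite_subsets_at_top
proof (intro allI impI)
  fix X :: "(nat \<times> nat) set" assume X: "finite X \<and> X \<subseteq> {d. squarefree d} \<times> {d. squarefree d}"
  let ?D = "\<lambda>z. smooth_squarefrees z \<times> smooth_squarefrees z"
  show "\<forall>\<^sub>F z in sequentially. finite (?D z) \<and> X \<subseteq> ?D z \<and> ?D z \<subseteq> {d. squarefree d} \<times> {d. squarefree d}"
    using eventually_ge_at_top[of "\<Sum>x\<in>X. fst x + snd x"]
  proof eventually_elim
    case (elim z)
    have "x \<in> ?D z" if "x \<in> X" for x
    proof -
      have "fst x + snd x \<le> (\<Sum>x\<in>X. fst x + snd x)" using that X by (intro member_le_sum) auto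
      then have "fst x \<le> z" "snd x \<le> z" using elim by auto
      then show ?thesis
        using that X by (cases x) (auto intro: squarefree_in_smooth_squarefrees)
    qed
    then show ?case
      using finite_smooth_squarefrees squarefree_if_in_smooth_squarefrees by auto
  qed
qed

lemma sum_primes_le_bounded: "(\<Sum>p\<in>primes_le z. 1 / (real p * (real p - 1))) \<le> 1"
proof (cases "z \<ge> 1")
  case True
  have "(\<Sum>p\<in>primes_le z. 1 / (real p * (real p - 1))) \<le> (\<Sum>n\<in>{1<..z}. 1 / (real n * (real n - 1)))"
    by (intro sum_mono2) (auto simp: primes_le_def prime_gt_Suc_0_nat)
  also have "\<dots> \<le> 1" using sum_inverse_consecutive_products[of 1 z] True by simp
  finally show ?thesis .
next
  case False
  then have "z = 0" by simp
  then show ?thesis by (simp add: primes_le_def)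
qed

lemma sum_abs_moebius_weight_le:
  assumes "finite F"
  shows "(\<Sum>d\<in>F. \<bar>moebius_weight d\<bar>) \<le> exp 1"
proof -
  define z where "z = \<Sum>F"
  let ?w = "\<lambda>p. 1 / (real p * (real p - 1))"
  have w: "0 \<le> ?w p" if "p \<in> primes_le z" for p
    using prime_gt_1_nat[OF prime_if_in_primes_le[OF that]] by simp
  have "(\<Sum>d\<in>F. \<bar>moebius_weight d\<bar>) = (\<Sum>d\<in>{d\<in>F. squarefree d}. \<bar>moebius_weight d\<bar>)"
    using assms by (intro sum.mono_neutral_right) (auto simp: moebius_weight_def moebius_def)
  also have "\<dots> \<le> (\<Sum>d\<in>smooth_squarefrees z. \<bar>moebius_weight d\<bar>)"
    using assms finite_smooth_squarefrees unfolding z_def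
    by (intro sum_mono2) (auto intro!: squarefree_in_smooth_squarefrees member_le_sum[of _ F "\<lambda>d. d"])
  also have "\<dots> = (\<Sum>X\<in>Pow (primes_le z). (\<Prod>p\<in>X. ?w p) * (\<Prod>p\<in>primes_le z - X. 1))"
    unfolding sum_smooth_squarefrees
  proof (intro sum.cong refl)
    fix X assume X: "X \<in> Pow (primes_le z)"
    then have "moebius_weight (\<Prod>X) = (\<Prod>p\<in>X. - 1 / (real p * (real p - 1)))"
      by (intro moebius_weight_prod_primes) (auto intro: finite_subset dest: prime_if_in_primes_le)
    moreover have "\<bar>\<Prod>p\<in>X. - 1 / (real p * (real p - 1))\<bar> = (\<Prod>p\<in>X. ?w p)"
      unfolding abs_prod using w X by (intro prod.cong refl) (auto simp: abs_minus_commute)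
    ultimately show "\<bar>moebius_weight (\<Prod>X)\<bar> = (\<Prod>p\<in>X. ?w p) * (\<Prod>p\<in>primes_le z - X. 1)" by simp
  qed
  also have "\<dots> = (\<Prod>p\<in>primes_le z. ?w p + 1)" by (simp add: prod_add)
  also have "\<dots> \<le> (\<Prod>p\<in>primes_le z. exp (?w p))"
    using w exp_ge_add_one_self by (intro prod_mono) (auto simp: add.commute)
  also have "\<dots> = exp (\<Sum>p\<in>primes_le z. ?w p)" by (simp add: exp_sum)
  also have "\<dots> \<le> exp 1" using sum_primes_le_bounded by simp
  finally show ?thesis .
qed

lemma abs_summable_on_moebius_weight: "(\<lambda>d. norm (moebius_weight d)) summable_on A"
proof (rule nonneg_bdd_above_summable_on)
  show "bdd_above (sum (\<lambda>d. norm (moebius_weight d)) ` {F. F \<subseteq> A \<and> finite F})"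
    using sum_abs_moebius_weight_le by (intro bdd_aboveI2[of _ _ "exp 1"]) simp
qed simp

lemma abs_summable_on_Times:
  fixes f :: "'a \<Rightarrow> real" and g :: "'b \<Rightarrow> real"
  assumes "(\<lambda>x. norm (f x)) summable_on A" "(\<lambda>y. norm (g y)) summable_on B"
  shows "(\<lambda>z. norm (case z of (x, y) \<Rightarrow> f x * g y)) summable_on A \<times> B"
proof (rule summable_on_SigmaI)
  fix x assume "x \<in> A"
  show "((\<lambda>y. norm (case (x, y) of (x, y) \<Rightarrow> f x * g y)) has_sum norm (f x) * (\<Sum>\<^sub>\<infinity>y\<in>B. norm (g y))) B"
    using assms(2) by (simp add: abs_mult has_sum_cmult_right)
qed (use assms(1) in \<open>auto intro: summable_on_cmult_left\<close>)

lemma abs_h_weight_le: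
  assumes "\<delta> \<ge> 1" "d1 \<ge> 1" "d3 \<ge> 1"
  shows "\<bar>h_weight d2 d4 \<delta> d1 d3\<bar> \<le> real (d1 * d3 * \<delta> * \<delta>)"
proof -
  have gcd_le: "gcd d1 d2 \<le> d1" "gcd d3 d4 \<le> d3" "gcd \<delta> a \<le> \<delta>" for a
    using assms by (auto intro!: gcd_le1_nat)
  have bound: "\<bar>real (gcd d1 d2 * gcd d3 d4 * gcd \<delta> a * gcd \<delta> b) * (\<Prod>p\<in>A. inverse (1 + 1 / real p))\<bar>
      \<le> real (d1 * d3 * \<delta> * \<delta>) * 1" for a b A
    unfolding abs_mult
  proof (rule mult_mono)
    show "\<bar>\<Prod>p\<in>A. inverse (1 + 1 / real p)\<bar> \<le> 1"
      unfolding abs_prod by (intro prod_le_1) (auto intro!: inverse_le_1_iff[THEN iffD2])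
    have "gcd d1 d2 * gcd d3 d4 * gcd \<delta> a * gcd \<delta> b \<le> d1 * d3 * \<delta> * \<delta>"
      by (intro mult_mono gcd_le) auto
    then show "\<bar>real (gcd d1 d2 * gcd d3 d4 * gcd \<delta> a * gcd \<delta> b)\<bar> \<le> real (d1 * d3 * \<delta> * \<delta>)"
      unfolding abs_of_nat by (rule of_nat_mono)
  qed auto
  then show ?thesis unfolding h_weight_def Let_def by (auto simp del: of_nat_mult)
qed

lemma h_fun_bounded: "\<exists>C. \<forall>d2 d4. \<bar>h_fun d2 d4 m\<bar> \<le> C"
proof (intro exI allI)
  fix d2 d4
  show "\<bar>h_fun d2 d4 m\<bar> \<le> (\<Sum>(n, \<delta>, d1, d3)\<in>factorizations4 m. real n * real (d1 * d3 * \<delta> * \<delta>))"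
    unfolding h_fun_eq_sum_h_weight
  proof (rule order_trans[OF sum_abs], rule sum_mono, clarify)
    fix n \<delta> d1 d3 assume "(n, \<delta>, d1, d3) \<in> factorizations4 m"
    then have "\<bar>h_weight d2 d4 \<delta> d1 d3\<bar> \<le> real (d1 * d3 * \<delta> * \<delta>)"
      by (intro abs_h_weight_le) (auto simp: factorizations4_def)
    moreover have "\<bar>real_of_int (moebius a)\<bar> \<le> 1" for a by (simp add: moebius_def power_abs)
    ultimately have "real n * \<bar>real_of_int (moebius d1)\<bar> * \<bar>real_of_int (moebius d3)\<bar> *
          \<bar>h_weight d2 d4 \<delta> d1 d3\<bar>
        \<le> real n * 1 * 1 * real (d1 * d3 * \<delta> * \<delta>)"
      by (intro mult_mono) auto
    then show "\<bar>real n * of_int (moebius d1) * of_int (moebius d3) * h_weight d2 d4 \<delta> d1 d3\<bar>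
        \<le> real n * real (d1 * d3 * \<delta> * \<delta>)"
      by (simp add: abs_mult)
  qed
qed

lemma summable_on_moebius_weight_h_fun:
  "(\<lambda>(d2, d4). moebius_weight d2 * moebius_weight d4 * h_fun d2 d4 m) summable_on A \<times> B"
proof -
  obtain C where C: "\<And>d2 d4. \<bar>h_fun d2 d4 m\<bar> \<le> C" using h_fun_bounded by blast
  have weights: "(\<lambda>x. norm (case x of (d2, d4) \<Rightarrow> C * moebius_weight d2 * moebius_weight d4))
      summable_on A \<times> B"
    using abs_summable_on_moebius_weight
    by (intro abs_summable_on_Times) (auto simp: abs_mult intro: summable_on_cmult_right)
  have "norm (case x of (d2, d4) \<Rightarrow> moebius_weight d2 * moebius_weight d4 * h_fun d2 d4 m)
      \<le> norm (case x of (d2, d4) \<Rightarrow> C * moebius_weight d2 * moebius_weight d4)" for x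
  proof (cases x)
    case (Pair d2 d4)
    have "\<bar>h_fun d2 d4 m\<bar> * \<bar>moebius_weight d2 * moebius_weight d4\<bar>
        \<le> \<bar>C\<bar> * \<bar>moebius_weight d2 * moebius_weight d4\<bar>"
      by (intro mult_right_mono order_trans[OF C abs_ge_self]) simp
    then show ?thesis by (simp only: Pair prod.case real_norm_def abs_mult mult_ac)
  qed
  with weights have "(\<lambda>x. norm (case x of (d2, d4) \<Rightarrow> moebius_weight d2 * moebius_weight d4 *
      h_fun d2 d4 m))
      summable_on A \<times> B"
    by (rule Infinite_Sum.abs_summable_on_comparison_test)
  then show ?thesis by (rule abs_summable_summable)
qed

definition singular_sum :: "nat \<Rightarrow> real" where
  "singular_sum r = (\<Sum>k\<in>reduced_residues (int r). visible_density (viewpoints (int r) k))"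

definition singular_series :: "nat \<Rightarrow> real" where
  "singular_series r =
     (\<Sum>\<^sub>\<infinity>(d2, d4)\<in>{1..} \<times> {1..}. moebius_weight d2 * moebius_weight d4 * h_fun d2 d4 r)"

lemma LIMSEQ_singular_series:
  "(\<lambda>z. \<Sum>d2\<in>smooth_squarefrees z. \<Sum>d4\<in>smooth_squarefrees z.
      moebius_weight d2 * moebius_weight d4 * h_fun d2 d4 r)
    \<longlonglongrightarrow> singular_series r"
proof -
  let ?f = "\<lambda>(d2, d4). moebius_weight d2 * moebius_weight d4 * h_fun d2 d4 r"
  let ?A = "{d. squarefree d}"
  have positive: "d \<ge> 1" if "squarefree d" for d :: nat
    using that by (metis not_squarefree_0 less_one not_less)
  have "(?f has_sum singular_series r) ({1..} \<times> {1..})"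
    unfolding singular_series_def by (rule has_sum_infsum[OF summable_on_moebius_weight_h_fun])
  also have "(?f has_sum singular_series r) ({1..} \<times> {1..}) \<longleftrightarrow> (?f has_sum singular_series r) (?A \<times> ?A)"
    using positive
    by (intro has_sum_cong_neutral) (auto simp: moebius_weight_def moebius_def split: if_splits)
  finally have "(\<lambda>z. \<Sum>x\<in>smooth_squarefrees z \<times> smooth_squarefrees z. ?f x) \<longlonglongrightarrow> singular_series r"
    unfolding has_sum_def by (rule filterlim_compose) (rule filterlim_smooth_squarefrees)
  then show ?thesis by (simp add: sum.cartesian_product)
qed

theorem singular_sum_eq_singular_series:
  assumes "r \<noteq> 0"
  shows "singular_sum r = singular_series r / zeta 2"
proof (rule LIMSEQ_unique)
  let ?trunc = "\<lambda>z. \<Sum>k\<in>reduced_residues (int r). \<Prod>p\<in>primes_le z.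
      local_density (viewpoints (int r) k) p"
  let ?f = "\<lambda>d2 d4. moebius_weight d2 * moebius_weight d4 * h_fun d2 d4 r"
  show "?trunc \<longlonglongrightarrow> singular_sum r"
    unfolding singular_sum_def by (intro tendsto_sum LIMSEQ_visible_density)
  have "(\<lambda>z. (\<Prod>p\<in>primes_le z. 1 - 1 / (real p)\<^sup>2) *
      (\<Sum>d2\<in>smooth_squarefrees z. \<Sum>d4\<in>smooth_squarefrees z. ?f d2 d4))
      \<longlonglongrightarrow> 1 / zeta 2 * singular_series r"
    by (intro tendsto_mult euler_product_zeta_2 LIMSEQ_singular_series)
  moreover have "\<forall>\<^sub>F z in sequentially. (\<Prod>p\<in>primes_le z. 1 - 1 / (real p)\<^sup>2) *
      (\<Sum>d2\<in>smooth_squarefrees z. \<Sum>d4\<in>smooth_squarefrees z. ?f d2 d4) = ?trunc z"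
    using eventually_ge_at_top[of r]
  proof eventually_elim
    case (elim z)
    then show ?case
      unfolding sum_smooth_squarefrees using prime_if_in_primes_le assms
      by (intro truncated_singular_series_identity[symmetric] prime_factors_subset_primes_le) auto
  qed
  ultimately have "?trunc \<longlonglongrightarrow> 1 / zeta 2 * singular_series r" by (rule Lim_transform_eventually)
  then show "?trunc \<longlonglongrightarrow> singular_series r / zeta 2" by simp
qed

section \<open>The pair correlation limit\<close>

lemma has_integral_log_kernel:
  fixes c \<Lambda> :: real
  assumes "c > 0" "\<Lambda> > 0"
  shows "((\<lambda>t. if c < t then ln (t / c) / t\<^sup>2 else 0) has_integral hyperbola_area (c / \<Lambda>) / c) {0..\<Lambda>}"
proof (cases "c < \<Lambda>")
  case False
  then have "hyperbola_area (c / \<Lambda>) = 0" using assms by (intro hyperbola_area_eq_0) simp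
  moreover have "((\<lambda>t. if c < t then ln (t / c) / t\<^sup>2 else 0) has_integral 0) {0..\<Lambda>}"
    using False by (intro has_integral_is_0) auto
  ultimately show ?thesis by simp
next
  case True
  let ?F = "\<lambda>t. - (ln (t / c) + 1) / t"
  have "((\<lambda>t. ln (t / c) / t\<^sup>2) has_integral ?F \<Lambda> - ?F c) {c..\<Lambda>}"
  proof (rule fundamental_theorem_of_calculus)
    show "c \<le> \<Lambda>" using True by simp
    fix t assume "t \<in> {c..\<Lambda>}"
    then have "t > 0" using assms by auto
    then show "(?F has_vector_derivative ln (t / c) / t\<^sup>2) (at t within {c..\<Lambda>})"
      unfolding has_real_derivative_iff_has_vector_derivative[symmetric]
      using assms by (auto intro!: derivative_eq_intros simp: field_simps power2_eq_square)
  qed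
  moreover have "?F \<Lambda> - ?F c = hyperbola_area (c / \<Lambda>) / c"
    using assms True by (simp add: hyperbola_area_def min_def ln_div field_simps)
  ultimately show ?thesis
    using assms True by (intro has_integral_zero_extension) simp_all
qed

lemma has_sum_finite_sum:
  fixes f :: "'i \<Rightarrow> 'a \<Rightarrow> 'b::topological_comm_monoid_add"
  assumes "finite I" "\<And>i. i \<in> I \<Longrightarrow> (f i has_sum s i) A"
  shows "((\<lambda>x. \<Sum>i\<in>I. f i x) has_sum (\<Sum>i\<in>I. s i)) A"
  using assms by (induction I rule: finite_induct) (auto intro!: has_sum_add)

lemma has_sum_g2_term:
  fixes P :: "int poly" and t :: real
  defines "M \<equiv> {m. 1 \<le> m \<and> real m < 2 * t / beta P}"
  shows "((\<lambda>(d2, d4). g2_term P t d2 d4) has_sum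
    (\<Sum>m\<in>M. ln (2 * t / (real m * beta P)) * singular_series m)) ({1..} \<times> {1..})"
proof -
  have finite: "finite M"
    by (rule finite_subset[of _ "{..nat \<lceil>2 * t / beta P\<rceil>}"]) (auto simp: M_def, linarith)
  have "g2_term P t d2 d4 = (\<Sum>m\<in>M.
      ln (2 * t / (real m * beta P)) * (moebius_weight d2 * moebius_weight d4 * h_fun d2 d4 m))"
    for d2 d4
    by (simp add: g2_term_def moebius_weight_def M_def sum_distrib_left mult_ac)
  then have "(\<lambda>(d2, d4). g2_term P t d2 d4) = (\<lambda>x. \<Sum>m\<in>M. ln (2 * t / (real m * beta P)) *
      (case x of (d2, d4) \<Rightarrow> moebius_weight d2 * moebius_weight d4 * h_fun d2 d4 m))"
    by auto
  then show ?thesis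
    unfolding singular_series_def
    by (simp only:) (intro has_sum_finite_sum finite has_sum_cmult_right has_sum_infsum
        summable_on_moebius_weight_h_fun)
qed

lemma g2_eq_sum:
  "g2 P t = (\<Sum>m | 1 \<le> m \<and> real m < 2 * t / beta P.
     singular_sum m * ln (2 * t / (real m * beta P))) / t\<^sup>2"
proof -
  have "(\<Sum>\<^sub>\<infinity>(d2, d4)\<in>{1..} \<times> {1..}. g2_term P t d2 d4)
      = (\<Sum>m | 1 \<le> m \<and> real m < 2 * t / beta P. ln (2 * t / (real m * beta P)) * singular_series m)"
    by (rule infsumI[OF has_sum_g2_term])
  also have "\<dots> = zeta 2 * (\<Sum>m | 1 \<le> m \<and> real m < 2 * t / beta P.
      singular_sum m * ln (2 * t / (real m * beta P)))"
    unfolding sum_distrib_left using euler_product_zeta_2(1)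
    by (intro sum.cong refl) (simp add: singular_sum_eq_singular_series)
  finally show ?thesis unfolding g2_def using euler_product_zeta_2(1) by simp
qed

lemma g2_has_integral:
  fixes P :: "int poly"
  assumes \<beta>: "beta P > 0" and "\<Lambda> > 0" and R: "real R > 2 * \<Lambda> / beta P"
  defines "c \<equiv> \<lambda>m. real m * beta P / 2"
  shows "(g2 P has_integral (\<Sum>m\<in>{1..R}. singular_sum m * (hyperbola_area (c m / \<Lambda>) / c m))) {0..\<Lambda>}"
proof (rule has_integral_eq)
  let ?kernel = "\<lambda>m t. if c m < t then ln (t / c m) / t\<^sup>2 else 0"
  show "((\<lambda>t. \<Sum>m\<in>{1..R}. singular_sum m * ?kernel m t) has_integral
      (\<Sum>m\<in>{1..R}. singular_sum m * (hyperbola_area (c m / \<Lambda>) / c m))) {0..\<Lambda>}"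
    using \<beta> \<open>\<Lambda> > 0\<close>
    by (intro has_integral_sum has_integral_mult_right has_integral_log_kernel) (auto simp: c_def)
  fix t assume t: "t \<in> {0..\<Lambda>}"
  let ?M = "{m. 1 \<le> m \<and> real m < 2 * t / beta P}"
  have mem_iff: "real m < 2 * t / beta P \<longleftrightarrow> c m < t" for m
    using \<beta> by (simp add: c_def less_divide_eq mult.commute)
  have "2 * t / beta P \<le> 2 * \<Lambda> / beta P" using t \<beta> by (intro divide_right_mono) auto
  then have "?M \<subseteq> {1..R}" using R by auto
  then have "(\<Sum>m\<in>{1..R}. singular_sum m * ?kernel m t)
      = (\<Sum>m\<in>?M. singular_sum m * (ln (t / c m) / t\<^sup>2))"
    unfolding mem_iff by (intro sum.mono_neutral_cong_right) auto
  also have "\<dots> = g2 P t"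
  proof -
    have "2 * t / (real m * beta P) = t / c m" for m by (simp add: c_def)
    then show ?thesis by (simp add: g2_eq_sum sum_divide_distrib)
  qed
  finally show "(\<Sum>m\<in>{1..R}. singular_sum m * ?kernel m t) = g2 P t" .
qed

lemma card_farey_pairs_density: "has_quadratic_density farey_pairs (beta pronic_poly / 2)"
  using visible_points_density_triangle[of "{(0, 0), (- 1, 0)}"]
  by (simp add: farey_pairs_eq_visible[abs_def] beta_pronic_poly(1))

lemma eventually_card_farey_pairs_large:
  assumes "C < beta pronic_poly / 2"
  shows "\<forall>\<^sub>F Q in sequentially. C * (real Q)\<^sup>2 \<le> real (card (farey_pairs Q))"
proof -
  have "\<forall>\<^sub>F Q in sequentially. C < real (card (farey_pairs Q)) / (real Q)\<^sup>2"
    using order_tendstoD(1)[OF card_farey_pairs_density[unfolded has_quadratic_density_def] assms] .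
  then show ?thesis
    using eventually_gt_at_top[of 0] by eventually_elim (simp add: less_divide_eq)
qed

lemma eventually_card_farey_pairs_ge: "\<forall>\<^sub>F Q in sequentially. \<Lambda> \<le> real (card (farey_pairs Q))"
proof -
  have "beta pronic_poly / 4 > 0" using beta_pronic_poly(2) by simp
  then have "filterlim (\<lambda>Q. beta pronic_poly / 4 * (real Q)\<^sup>2) at_top sequentially"
    by (intro filterlim_tendsto_pos_mult_at_top[OF tendsto_const] filterlim_pow_at_top
        filterlim_real_sequentially) auto
  then have "\<forall>\<^sub>F Q in sequentially. \<Lambda> \<le> beta pronic_poly / 4 * (real Q)\<^sup>2"
    by (simp add: filterlim_at_top)
  moreover have "\<forall>\<^sub>F Q in sequentially. beta pronic_poly / 4 * (real Q)\<^sup>2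
      \<le> real (card (farey_pairs Q))"
    using beta_pronic_poly(2) by (intro eventually_card_farey_pairs_large) simp
  ultimately show ?thesis by eventually_elim linarith
qed

lemma lattice_points_density:
  assumes "\<Lambda> > 0" and k: "k \<in> reduced_residues (int r)" and "finite B"
  shows "has_quadratic_density
    (\<lambda>Q. hyperbola_region (int r) k (real r * real (card (farey_pairs Q)) / \<Lambda>) Q \<inter> visible_from B)
    (hyperbola_area (real r * beta pronic_poly / (2 * \<Lambda>)) / of_int (int r) * visible_density B)"
proof (rule visible_points_density_hyperbola_region)
  have "(\<lambda>Q. real r / \<Lambda> * (real (card (farey_pairs Q)) / (real Q)\<^sup>2))
      \<longlonglongrightarrow> real r / \<Lambda> * (beta pronic_poly / 2)"
    by (rule tendsto_mult_left[OF card_farey_pairs_density[unfolded has_quadratic_density_def]])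
  then show "(\<lambda>Q. real r * real (card (farey_pairs Q)) / \<Lambda> / (real Q)\<^sup>2)
      \<longlonglongrightarrow> real r * beta pronic_poly / (2 * \<Lambda>)"
    by (simp add: mult.commute)
  show "real r * beta pronic_poly / (2 * \<Lambda>) > 0"
    using assms beta_pronic_poly(2) by (auto simp: reduced_residues_def)
qed (use assms in \<open>auto simp: reduced_residues_def\<close>)

lemma close_pairs_density:
  fixes \<Lambda> :: real
  defines "\<beta> \<equiv> beta pronic_poly"
  assumes \<Lambda>: "\<Lambda> > 0" and R: "real R > 2 * \<Lambda> / \<beta>"
  shows "has_quadratic_density (\<lambda>Q. close_pairs (fraction_of ` farey_pairs Q) \<Lambda>)
    (\<Sum>r\<in>{1..R}. hyperbola_area (real r * \<beta> / (2 * \<Lambda>)) / real r * singular_sum r)"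
proof -
  have \<beta>: "\<beta> > 0" unfolding \<beta>_def by (rule beta_pronic_poly)
  let ?N = "\<lambda>Q. real (card (farey_pairs Q))"
  let ?V = "\<lambda>Q r k. hyperbola_region (int r) k (real r * ?N Q / \<Lambda>) Q \<inter>
      visible_from (viewpoints (int r) k)"
  let ?area = "\<lambda>r. hyperbola_area (real r * \<beta> / (2 * \<Lambda>))"
  have "has_quadratic_density (\<lambda>Q. ?V Q r k) (?area r / of_int (int r) *
      visible_density (viewpoints (int r) k))"
    if "k \<in> reduced_residues (int r)" for r k
    unfolding \<beta>_def using \<Lambda> that by (intro lattice_points_density) auto
  then have "(\<lambda>Q. \<Sum>r\<in>{1..R}. \<Sum>k\<in>reduced_residues (int r). real (card (?V Q r k)) / (real Q)\<^sup>2) \<longlonglongrightarrow>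
      (\<Sum>r\<in>{1..R}. \<Sum>k\<in>reduced_residues (int r).
        ?area r / of_int (int r) * visible_density (viewpoints (int r) k))"
    unfolding has_quadratic_density_def by (intro tendsto_sum)
  also have "(\<Sum>r\<in>{1..R}. \<Sum>k\<in>reduced_residues (int r).
        ?area r / of_int (int r) * visible_density (viewpoints (int r) k))
      = (\<Sum>r\<in>{1..R}. ?area r / real r * singular_sum r)"
    by (simp add: singular_sum_def sum_distrib_left)
  finally have limit: "(\<lambda>Q. \<Sum>r\<in>{1..R}. \<Sum>k\<in>reduced_residues (int r).
        real (card (?V Q r k)) / (real Q)\<^sup>2)
      \<longlonglongrightarrow> (\<Sum>r\<in>{1..R}. ?area r / real r * singular_sum r)" .
  have "2 * \<Lambda> / \<beta> > 0" using \<Lambda> \<beta> by simp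
  then have "real R > 0" using R by linarith
  then have "\<Lambda> / real R < \<beta> / 2" using R \<beta> by (simp add: field_simps)
  then have "\<forall>\<^sub>F Q in sequentially. \<Lambda> / real R * (real Q)\<^sup>2 \<le> ?N Q"
    unfolding \<beta>_def by (rule eventually_card_farey_pairs_large)
  then have "\<forall>\<^sub>F Q in sequentially. (\<Sum>r\<in>{1..R}. \<Sum>k\<in>reduced_residues (int r).
        real (card (?V Q r k)) / (real Q)\<^sup>2)
      = real (card (close_pairs (fraction_of ` farey_pairs Q) \<Lambda>)) / (real Q)\<^sup>2"
    using eventually_card_farey_pairs_ge[of \<Lambda>]
  proof eventually_elim
    case (elim Q)
    then have "\<Lambda> * (real Q)\<^sup>2 \<le> real R * ?N Q" using \<open>real R > 0\<close> by (simp add: field_simps)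
    then show ?case using card_close_pairs[OF \<Lambda> elim(2)] by (simp add: sum_divide_distrib)
  qed
  with limit show ?thesis unfolding has_quadratic_density_def by (rule Lim_transform_eventually)
qed

lemma pair_correlation_pronic_poly_tendsto:
  assumes "has_quadratic_density (\<lambda>Q. close_pairs (fraction_of ` farey_pairs Q) \<Lambda>) A"
  shows "(\<lambda>Q. pair_correlation (poly_farey pronic_poly Q) \<Lambda>) \<longlonglongrightarrow> A / (beta pronic_poly / 2)"
proof -
  let ?c = "\<lambda>Q. real (card (close_pairs (fraction_of ` farey_pairs Q) \<Lambda>))"
  let ?N = "\<lambda>Q. real (card (farey_pairs Q))"
  have "(\<lambda>Q. (?c Q / (real Q)\<^sup>2) / (?N Q / (real Q)\<^sup>2)) \<longlonglongrightarrow> A / (beta pronic_poly / 2)"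
    using beta_pronic_poly(2)
    by (intro tendsto_divide[OF assms[unfolded has_quadratic_density_def]]
        card_farey_pairs_density[unfolded has_quadratic_density_def]) simp
  moreover have "\<forall>\<^sub>F Q in sequentially. (?c Q / (real Q)\<^sup>2) / (?N Q / (real Q)\<^sup>2)
      = pair_correlation (poly_farey pronic_poly Q) \<Lambda>"
    using eventually_gt_at_top[of 0]
  proof eventually_elim
    case (elim Q)
    have "pair_correlation (poly_farey pronic_poly Q) \<Lambda> = 1 / ?N Q * ?c Q"
      unfolding pair_correlation_def close_pairs_def poly_farey_pronic_poly
        card_fraction_of_farey_pairs ..
    then show ?case using elim by simp
  qed
  ultimately show ?thesis by (rule Lim_transform_eventually)
qed

theorem theorem1p4:
  fixes P :: "int poly"
  assumes "P = [:0, 1:] * [:1, 1:]"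
  shows "(\<forall>t>0. (\<lambda>(d2, d4). g2_term P t d2 d4) summable_on {1..} \<times> {1..}) \<and>
         (\<forall>\<Lambda>>0. g2 P integrable_on {0..\<Lambda>} \<and>
           (\<lambda>Q. pair_correlation (poly_farey P Q) \<Lambda>) \<longlonglongrightarrow> integral {0..\<Lambda>} (g2 P))"
proof (intro conjI allI impI)
  show "(\<lambda>(d2, d4). g2_term P t d2 d4) summable_on {1..} \<times> {1..}" for t
    using has_sum_g2_term by (rule has_sum_imp_summable)
next
  fix \<Lambda> :: real assume \<Lambda>: "\<Lambda> > 0"
  have P: "P = pronic_poly" using assms by (simp add: pronic_poly_def)
  obtain R :: nat where R: "real R > 2 * \<Lambda> / beta P" using reals_Archimedean2 by blast
  let ?c = "\<lambda>m. real m * beta P / 2"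
  have integral: "(g2 P has_integral
      (\<Sum>m\<in>{1..R}. singular_sum m * (hyperbola_area (?c m / \<Lambda>) / ?c m))) {0..\<Lambda>}"
    using beta_pronic_poly(2) \<Lambda> R unfolding P by (rule g2_has_integral)
  then show "g2 P integrable_on {0..\<Lambda>}" by blast
  have "(\<lambda>Q. pair_correlation (poly_farey P Q) \<Lambda>) \<longlonglongrightarrow>
      (\<Sum>r\<in>{1..R}. hyperbola_area (real r * beta P / (2 * \<Lambda>)) / real r * singular_sum r) / (beta P / 2)"
    using \<Lambda> R unfolding P by (intro pair_correlation_pronic_poly_tendsto close_pairs_density)
  also have "(\<Sum>r\<in>{1..R}.
        hyperbola_area (real r * beta P / (2 * \<Lambda>)) / real r * singular_sum r) / (beta P / 2)
      = (\<Sum>m\<in>{1..R}. singular_sum m * (hyperbola_area (?c m / \<Lambda>) / ?c m))"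
    unfolding sum_divide_distrib by (intro sum.cong refl) (simp add: mult_ac)
  also have "\<dots> = integral {0..\<Lambda>} (g2 P)" using integral by (simp add: integral_unique)
  finally show "(\<lambda>Q. pair_correlation (poly_farey P Q) \<Lambda>) \<longlonglongrightarrow> integral {0..\<Lambda>} (g2 P)" .
qed

end
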